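(* Let $G$ be a simple graph and $v$ a vertex of $G$ of degree $d$. For a uniformly random $m\in\mathcal{M}(G)$ let $p=\Pr[\omega_v(m)\text{ is odd}]$. Then $$\| L_v - U_{D_v,p}\|^2 \le \frac{2\,\mathbb{E}[F_{G-\{v\}}]}{\sqrt{d-1}}.$$
   Context: Let $G$ be a simple graph with vertices $v_1,\dots,v_n$. Let $D=D_1\cup\dots\cup D_n$ be a disjoint union of sets of "darts" with $|D_i|=\deg(v_i)$. $\mathcal{R}(G)$ is the set of permutations of $D$ consisting of exactly $n$ cycles $\pi_1,\dots,\pi_n$, where $\pi_i$ is a full cycle on $D_i$ (local rotations). $\mathcal{E}(G)$ is the set of fixed-point-free involutions $E$ of $D$ such that for every edge $v_iv_j$ of $G$ there is exactly one $2$-cycle of $E$ containing a dart of $D_i$ and a dart of $D_j$ (edge schemes). $\mathcal{M}(G)=\{(D,R,E): R\in\mathcal{R}(G), E\in\mathcal{E}(G)\}$; a random embedding is a uniformly random element of $\mathcal{M}(G)$. The faces of $m=(D,R,E)$ are the cycles of $R\cdot E$, and $F_G$ is the random variable giving the number of cycles of $R\cdot E$ for a random embedding of $G$. $G-\{v\}$ is obtained from $G$ by deleting $v$ and its incident edges. For $Y\subseteq X$ and $\alpha\in S_X$, the induced permutation of $\alpha$ on $Y$ is obtained by deleting from the disjoint cycle notation of $\alpha$ all symbols not in $Y$ and discarding empty cycles. For $v=v_i$ write $D_v=D_i$; $\omega_v(m)\in S_{D_v}$ is the induced permutation of $R\cdot E$ on $D_v$, and $L_v$ is the distribution of $\omega_v(m)$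 on $S_{D_v}$ for random $m$. For a finite set $X$ and $p\in[0,1]$, $U_{X,p}$ is the distribution on $S_X$ taking value $\tfrac{2p}{|X|!}$ at each odd permutation and $\tfrac{2(1-p)}{|X|!}$ at each even permutation. The total variation distance is $\|P-Q\|=\tfrac12\sum_x|P(x)-Q(x)|$.
   Formalization: The number of faces F counts, besides the cycles of R·E, one face for each isolated vertex (otherwise the claim fails for a star with d ≥ 3 leaves centred at v, where G−{v} has no darts); the degree d is assumed to be at least 2. *)

theory Defs
  imports
    "HOL-Probability.Probability"
    "HOL-Combinatorics.Combinatorics"
    "Graph_Theory.Digraph"
begin

text \<open>
  A simple graph is a loop-free symmetric digraph without multiple arcs (\<^locale>\<open>graph\<close>): an edge
  is a pair of opposite arcs, so the degree of a vertex is its \<^const>\<open>out_degree\<close>, and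
  \<^const>\<open>pre_digraph.del_vert\<close> removes a vertex with its incident edges.
\<close>

definition dart_system :: "('v, 'a) pre_digraph \<Rightarrow> ('v \<Rightarrow> 'd set) \<Rightarrow> bool" where
  "dart_system G D \<longleftrightarrow>
     disjoint_family_on D (verts G) \<and>
     (\<forall>u\<in>verts G. finite (D u) \<and> card (D u) = out_degree G u)"

definition darts :: "('v, 'a) pre_digraph \<Rightarrow> ('v \<Rightarrow> 'd set) \<Rightarrow> 'd set" where
  "darts G D = (\<Union>u\<in>verts G. D u)"

text \<open>
  \<^const>\<open>cyclic_on\<close> is false on the empty set; the full cycle on the empty dart set of an isolated
  vertex is the empty cycle and imposes no condition.
\<close>

definition rotations :: "('v, 'a) pre_digraph \<Rightarrow> ('v \<Rightarrow> 'd set) \<Rightarrow> ('d \<Rightarrow> 'd) set" where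
  "rotations G D = {R. R permutes darts G D \<and> (\<forall>u\<in>verts G. D u \<noteq> {} \<longrightarrow> cyclic_on R (D u))}"

definition edge_schemes :: "('v, 'a) pre_digraph \<Rightarrow> ('v \<Rightarrow> 'd set) \<Rightarrow> ('d \<Rightarrow> 'd) set" where
  "edge_schemes G D = {E. E permutes darts G D \<and> E \<circ> E = id \<and> (\<forall>x\<in>darts G D. E x \<noteq> x) \<and>
     (\<forall>u w. u \<rightarrow>\<^bsub>G\<^esub> w \<longrightarrow>
       (\<exists>!c. c \<in> (\<lambda>x. {x, E x}) ` darts G D \<and> c \<inter> D u \<noteq> {} \<and> c \<inter> D w \<noteq> {}))}"

definition embeddings ::
    "('v, 'a) pre_digraph \<Rightarrow> ('v \<Rightarrow> 'd set) \<Rightarrow> (('d \<Rightarrow> 'd) \<times> ('d \<Rightarrow> 'd)) set" where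
  "embeddings G D = rotations G D \<times> edge_schemes G D"

definition random_embedding ::
    "('v, 'a) pre_digraph \<Rightarrow> ('v \<Rightarrow> 'd set) \<Rightarrow> (('d \<Rightarrow> 'd) \<times> ('d \<Rightarrow> 'd)) pmf" where
  "random_embedding G D = pmf_of_set (embeddings G D)"

fun face_perm :: "('d \<Rightarrow> 'd) \<times> ('d \<Rightarrow> 'd) \<Rightarrow> 'd \<Rightarrow> 'd" where
  "face_perm (R, E) = R \<circ> E"

text \<open>
  The orbits on the darts are the cycles of the face permutation, fixed points included. In addition,
  the empty cycle of each isolated vertex is counted as one face (an isolated vertex is embedded in a
  sphere with a single face). If no vertex is isolated, the second summand is zero.
\<close>

definition num_faces ::
    "('v, 'a) pre_digraph \<Rightarrow> ('v \<Rightarrow> 'd set) \<Rightarrow> ('d \<Rightarrow> 'd) \<times> ('d \<Rightarrow> 'd) \<Rightarrow> nat" where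
  "num_faces G D m = card (orbit (face_perm m) ` darts G D) + card {u \<in> verts G. D u = {}}"

text \<open>
  After the symbols outside \<open>Y\<close> are deleted from the cycles of \<open>\<alpha>\<close>, the symbol following \<open>x \<in> Y\<close> is
  the first of \<open>\<alpha> x, \<alpha> (\<alpha> x), \<dots>\<close> that lies in \<open>Y\<close>.
\<close>

definition induced_perm :: "('d \<Rightarrow> 'd) \<Rightarrow> 'd set \<Rightarrow> 'd \<Rightarrow> 'd" where
  "induced_perm \<alpha> Y x = (if x \<in> Y then (\<alpha> ^^ (LEAST k. 0 < k \<and> (\<alpha> ^^ k) x \<in> Y)) x else x)"

definition local_perm ::
    "('v \<Rightarrow> 'd set) \<Rightarrow> 'v \<Rightarrow> ('d \<Rightarrow> 'd) \<times> ('d \<Rightarrow> 'd) \<Rightarrow> 'd \<Rightarrow> 'd" where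
  "local_perm D v m = induced_perm (face_perm m) (D v)"

definition local_dist :: "('v, 'a) pre_digraph \<Rightarrow> ('v \<Rightarrow> 'd set) \<Rightarrow> 'v \<Rightarrow> ('d \<Rightarrow> 'd) pmf" where
  "local_dist G D v = map_pmf (local_perm D v) (random_embedding G D)"

text \<open>
  Given as a mass function rather than a \<open>pmf\<close>, since for \<open>card X < 2\<close> there are no odd permutations
  and the values need not sum to one.
\<close>

definition parity_uniform :: "'d set \<Rightarrow> real \<Rightarrow> ('d \<Rightarrow> 'd) \<Rightarrow> real" where
  "parity_uniform X p \<alpha> =
     (if \<alpha> permutes X then (if evenperm \<alpha> then 2 * (1 - p) else 2 * p) / fact (card X) else 0)"

definition tv_dist :: "'b set \<Rightarrow> ('b \<Rightarrow> real) \<Rightarrow> ('b \<Rightarrow> real) \<Rightarrow> real" where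
  "tv_dist S P Q = (1 / 2) * (\<Sum>x\<in>S. \<bar>P x - Q x\<bar>)"

end

theory Submission
  imports Defs
begin

text \<open>
  Write a rotation as \<open>R = \<zeta> \<circ> R'\<close>, where \<open>\<zeta>\<close> is the full cycle at \<open>v\<close>. The local permutation is then
  \<open>\<zeta> \<circ> \<tau>\<close>, where \<open>\<tau>\<close> is induced by \<open>R' \<circ> E\<close>. Relabelling the darts at \<open>v\<close> separately in \<open>R\<close> and in \<open>E\<close>
  shows that \<open>\<zeta>\<close> is a uniform full cycle and that \<open>\<tau>\<close> may be replaced by a uniformly random conjugate of
  itself. So the law of the local permutation is a mixture over \<open>\<tau>\<close> of products of two random elements
  of conjugacy classes, one of them the class of full cycles.

  The uniform law on full cycles is an alternating sum of hook characters. Expanding it in Young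
  symmetrizers, the squared \<open>L\<^sup>2\<close> distance of the product law to the uniform law on its parity class
  becomes the sum over the nontrivial hooks of \<open>(\<chi> \<tau> / \<chi> 1)\<^sup>2\<close>. If \<open>\<tau>\<close> has \<open>c\<close> cycles, the value at \<open>\<tau>\<close> of the
  hook character with leg length \<open>k\<close> counts, with signs, some sets of at most \<open>min k (d - 1 - k)\<close> cycles
  of \<open>\<tau>\<close>, so for \<open>c \<le> (d - 1) / 2\<close> each quotient is at most \<open>c / (d - 1)\<close>. When
  \<open>4 * c\<^sup>2\<close> exceeds \<open>d - 1\<close>, the claimed bound is at least \<open>1\<close>.

  Finally, every cycle of \<open>\<tau>\<close> comes from a face of the embedding obtained by deleting \<open>v\<close>, and this
  embedding is again uniformly random, because the conjugations by permutations that preserve every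
  dart set act transitively on the rotations. Hence the expected number of cycles of \<open>\<tau>\<close> is at most
  the expected number of faces of the graph without \<open>v\<close>.
\<close>

section \<open>Conjugate, induced and cyclic permutations\<close>

text \<open>Only the expectation of the face count is at hand, not its second moment, so the squared
  distance must be bounded linearly in the number \<open>c\<close> of cycles of \<tau>. With
  \<open>n = d - 1\<close> the hook estimate gives at most \<open>n\<close> terms
  \<open>(c / n)^2\<close>, hence \<open>c^2 / n\<close>. This is at most \<open>c / sqrt n\<close>
  while \<open>c \<le> sqrt n\<close>, and beyond \<open>sqrt n / 2\<close> the trivial bound takes
  over; hence the square root. The target law is a mixture too: for fixed \<tau> the sign of the
  local permutation is forced, and averaging the uniform laws on the two parity classes yields
  \<open>parity_uniform\<close>. The character quotients arise as scalars: averaging over conjugates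
  multiplies each hook symmetrizer by one. In the square of the product law one factor is expanded
  in hooks and the other is read as a law, so the scalar appears a second time. The last subtlety is
  that a neighbour of \<open>v\<close> of degree one becomes isolated, so some cycles of \<tau> keep
  no dart after the deletion; they are paid for by the face that \<open>num_faces\<close> adds for
  each isolated vertex.\<close>

definition conj_perm :: "('a \<Rightarrow> 'a) \<Rightarrow> ('a \<Rightarrow> 'a) \<Rightarrow> 'a \<Rightarrow> 'a" where
  "conj_perm s f = s \<circ> f \<circ> inv s"

lemma conj_perm_apply: "bij s \<Longrightarrow> conj_perm s f (s x) = s (f x)"
  by (simp add: conj_perm_def bij_is_inj)

lemma conj_perm_funpow: "bij s \<Longrightarrow> (conj_perm s f ^^ n) (s x) = s ((f ^^ n) x)"
  by (induction n) (simp_all add: conj_perm_apply)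

lemma conj_perm_comp: "bij s \<Longrightarrow> conj_perm s (f \<circ> g) = conj_perm s f \<circ> conj_perm s g"
  by (simp add: conj_perm_def fun_eq_iff bij_is_inj)

lemma conj_perm_conj_perm: "bij s \<Longrightarrow> bij t \<Longrightarrow> conj_perm s (conj_perm t f) = conj_perm (s \<circ> t) f"
  by (simp add: conj_perm_def o_inv_distrib comp_assoc)

lemma conj_perm_inv_cancel: "bij s \<Longrightarrow> conj_perm (inv s) (conj_perm s f) = f"
  by (simp add: conj_perm_def fun_eq_iff bij_is_inj inv_inv_eq)

lemma conj_perm_cancel_inv: "bij s \<Longrightarrow> conj_perm s (conj_perm (inv s) f) = f"
  by (simp add: conj_perm_def fun_eq_iff bij_is_surj surj_f_inv_f inv_inv_eq)

lemma conj_perm_permutes: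
  assumes "bij s" "f permutes X" shows "conj_perm s f permutes s ` X"
proof -
  have "bij (conj_perm s f)"
    using assms by (simp add: conj_perm_def bij_comp bij_imp_bij_inv permutes_bij)
  moreover have "conj_perm s f y = y" if "y \<notin> s ` X" for y
  proof -
    obtain x where "y = s x" using assms(1) by (meson bij_pointE)
    moreover then have "x \<notin> X" using that by blast
    ultimately show ?thesis using assms by (simp add: conj_perm_apply permutes_not_in)
  qed
  ultimately show ?thesis by (auto simp: permutes_def bij_iff)
qed

lemma conj_perm_permutes_same:
  "s permutes X \<Longrightarrow> f permutes X \<Longrightarrow> conj_perm s f permutes X"
  using conj_perm_permutes[of s f X] by (simp add: permutes_bij permutes_image)

lemma conj_perm_eqI:
  assumes "bij s" "\<And>x. g (s x) = s (f x)" shows "conj_perm s f = g"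
  using assms by (auto simp: conj_perm_def fun_eq_iff bij_is_surj surj_f_inv_f) (metis bij_inv_eq_iff)

lemma sign_conj_perm:
  assumes "permutation s" "permutation f" shows "sign (conj_perm s f) = sign f"
  using assms
  by (simp add: conj_perm_def sign_compose permutation_compose permutation_inverse sign_inverse)

lemma orbit_semiconj:
  assumes "\<And>y. y \<in> A \<Longrightarrow> a y \<in> A" "\<And>y. y \<in> A \<Longrightarrow> h (a y) = b (h y)" "x \<in> A"
  shows "orbit b (h x) = h ` orbit a x"
proof -
  have "(a ^^ n) x \<in> A \<and> (b ^^ n) (h x) = h ((a ^^ n) x)" for n
    by (induction n) (use assms in auto)
  then have eq: "(b ^^ n) (h x) = h ((a ^^ n) x)" for n by blast
  show ?thesis unfolding orbit_altdef eq by blast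
qed

lemma orbit_conj_perm: "bij s \<Longrightarrow> orbit (conj_perm s f) (s x) = s ` orbit f x"
  by (rule orbit_semiconj[where A=UNIV]) (auto simp: conj_perm_apply)

lemma cyclic_on_conj_perm:
  assumes "bij s" "cyclic_on f S" shows "cyclic_on (conj_perm s f) (s ` S)"
  using assms by (intro cyclic_on_image) (auto simp: conj_perm_apply)

lemma cyclic_on_enum:
  assumes "cyclic_on f S" "x \<in> S"
  shows "bij_betw (\<lambda>i. (f ^^ i) x) {..<card S} S" "(f ^^ card S) x = x"
proof -
  have S: "orbit f x = S" using assms by (rule orbit_cyclic_eq3)
  then have x: "x \<in> orbit f x" using assms by simp
  let ?N = "funpow_dist1 f x x"
  have 1: "bij_betw (\<lambda>i. (f ^^ i) x) {..<?N} S"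
    using inj_on_funpow_dist1[OF x] orbit_conv_funpow_dist1[OF x] S
    by (simp add: bij_betw_def atLeast0LessThan)
  then have N: "?N = card S" using bij_betw_same_card by fastforce
  show "bij_betw (\<lambda>i. (f ^^ i) x) {..<card S} S" using 1 N by simp
  show "(f ^^ card S) x = x" using funpow_dist1_prop[OF x] N by simp
qed

text \<open>Both cycles are listed from the same base point and matched position by position; the
  only special case is the last position, where both lists wrap around.\<close>

lemma cyclic_on_conjugate:
  assumes f: "cyclic_on f S" and g: "cyclic_on g S"
  obtains s where "s permutes S" "\<And>x. x \<in> S \<Longrightarrow> s (f x) = g (s x)"
proof -
  obtain x where x: "x \<in> S" using f by (auto simp: cyclic_on_def)
  let ?n = "card S"
  define a where "a i = (f ^^ i) x" for i
  define b where "b i = (g ^^ i) x" for i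
  have a: "bij_betw a {..<?n} S" and an: "a ?n = a 0"
    using cyclic_on_enum[OF f x] unfolding a_def by simp_all
  have b: "bij_betw b {..<?n} S" and bn: "b ?n = b 0"
    using cyclic_on_enum[OF g x] unfolding b_def by simp_all
  define s where "s y = (if y \<in> S then b (inv_into {..<?n} a y) else y)" for y
  have sa: "s (a i) = b i" if "i < ?n" for i
    using that a by (auto simp: s_def bij_betw_def inv_into_f_f)
  have "bij_betw (b \<circ> inv_into {..<?n} a) S S"
    using a b by (meson bij_betw_inv_into bij_betw_trans)
  then have "bij_betw s S S" by (rule bij_betw_cong[THEN iffD1, rotated]) (simp add: s_def)
  then have "s permutes S" by (rule bij_imp_permutes) (simp add: s_def)
  moreover have "s (f y) = g (s y)" if "y \<in> S" for y
  proof -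
    have "y \<in> a ` {..<?n}" using a that by (simp add: bij_betw_def)
    then obtain i where i: "i < ?n" "y = a i" by blast
    have fy: "f y = a (Suc i)" and gb: "g (b i) = b (Suc i)" unfolding i(2) a_def b_def by simp_all
    show ?thesis
    proof (cases "Suc i < ?n")
      case True
      then have "s (f y) = b (Suc i)" using sa[of "Suc i"] fy by simp
      moreover have "s y = b i" using sa[of i] i by simp
      ultimately show ?thesis using gb by simp
    next
      case False
      then have "Suc i = ?n" using i by simp
      then have "s (f y) = b 0" using sa[of 0] fy an by simp
      moreover have "s y = b i" using sa[of i] i by simp
      ultimately show ?thesis using gb bn \<open>Suc i = ?n\<close> by simp
    qed
  qed
  ultimately show thesis using that by blast
qed

section \<open>Permutations induced on a subset\<close>

lemma permutes_return:
  assumes "f permutes X" "finite X"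
  obtains n where "0 < n" "(f ^^ n) x = x"
  using assms permutation_self permutation_permutes by metis

lemma induced_perm_eqI:
  assumes "x \<in> Y" "0 < k" "(f ^^ k) x \<in> Y" "\<And>j. 0 < j \<Longrightarrow> j < k \<Longrightarrow> (f ^^ j) x \<notin> Y"
  shows "induced_perm f Y x = (f ^^ k) x"
proof -
  have "(LEAST k. 0 < k \<and> (f ^^ k) x \<in> Y) = k"
    by (rule Least_equality) (use assms in \<open>auto simp: not_less[symmetric]\<close>)
  then show ?thesis using assms(1) by (simp add: induced_perm_def)
qed

lemma induced_permE:
  assumes "f permutes X" "finite X" "x \<in> Y"
  obtains k where "0 < k" "(f ^^ k) x \<in> Y" "\<And>j. 0 < j \<Longrightarrow> j < k \<Longrightarrow> (f ^^ j) x \<notin> Y"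
    "induced_perm f Y x = (f ^^ k) x"
proof -
  let ?P = "\<lambda>k. 0 < k \<and> (f ^^ k) x \<in> Y"
  obtain n where "?P n" using permutes_return[OF assms(1,2), of x] assms(3) by metis
  then have 1: "?P (Least ?P)" by (rule LeastI)
  have 2: "(f ^^ j) x \<notin> Y" if "0 < j" "j < Least ?P" for j using not_less_Least[OF that(2)] that(1) by simp
  show thesis using that[of "Least ?P"] 1 2 assms(3) by (simp add: induced_perm_def)
qed

lemma induced_perm_not_in: "x \<notin> Y \<Longrightarrow> induced_perm f Y x = x"
  by (simp add: induced_perm_def)

lemma induced_perm_step: "x \<in> Y \<Longrightarrow> f x \<in> Y \<Longrightarrow> induced_perm f Y x = f x"
  using induced_perm_eqI[of x Y 1 f] by simp

lemma orbit_induced_perm: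
  assumes f: "f permutes X" "finite X" and x: "x \<in> Y"
  shows "orbit (induced_perm f Y) x = orbit f x \<inter> Y"
proof (intro equalityI subsetI)
  fix y assume "y \<in> orbit (induced_perm f Y) x"
  then show "y \<in> orbit f x \<inter> Y"
  proof induction
    case base
    obtain k where k: "0 < k" "(f ^^ k) x \<in> Y" "induced_perm f Y x = (f ^^ k) x"
      using induced_permE[OF f x] by metis
    then have "(f ^^ k) x \<in> orbit f x" unfolding orbit_altdef by blast
    then show ?case using k by simp
  next
    case (step y)
    then have "y \<in> Y" by simp
    obtain k where k: "0 < k" "(f ^^ k) y \<in> Y" "induced_perm f Y y = (f ^^ k) y"
      using induced_permE[OF f \<open>y \<in> Y\<close>] by metis
    have "(f ^^ k) y \<in> orbit f x" using step.IH by (intro funpow_in_orbit) simp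
    then show ?case using k by simp
  qed
next
  \<comment> \<open>Strong induction on the number of steps: the first return to \<open>Y\<close>
    happens after some \<open>k \<le> m\<close> steps and splits off one application of the induced
    permutation.\<close>
  have *: "(f ^^ m) x \<in> orbit (induced_perm f Y) x" if "0 < m" "(f ^^ m) x \<in> Y" "x \<in> Y" for m x
    using that
  proof (induction m arbitrary: x rule: less_induct)
    case (less m)
    obtain k where k: "0 < k" "(f ^^ k) x \<in> Y" "\<And>j. 0 < j \<Longrightarrow> j < k \<Longrightarrow> (f ^^ j) x \<notin> Y"
      "induced_perm f Y x = (f ^^ k) x"
      using induced_permE[OF f less.prems(3)] by metis
    have "k \<le> m" using k(3) less.prems by (meson not_le)
    show ?case
    proof (cases "k = m")
      case True
      then show ?thesis using k(4) orbit.base[of "induced_perm f Y" x] by simp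
    next
      case False
      have eq: "(f ^^ (m - k)) ((f ^^ k) x) = (f ^^ m) x"
        using \<open>k \<le> m\<close> by (metis comp_apply funpow_add le_add_diff_inverse2)
      have "(f ^^ (m - k)) ((f ^^ k) x) \<in> orbit (induced_perm f Y) ((f ^^ k) x)"
        using less.IH[of "m - k" "(f ^^ k) x"] False \<open>k \<le> m\<close> k less.prems(2) eq by simp
      then have "(f ^^ m) x \<in> orbit (induced_perm f Y) (induced_perm f Y x)"
        using eq k(4) by simp
      then show ?thesis by (rule orbit_subset)
    qed
  qed
  fix y assume "y \<in> orbit f x \<inter> Y"
  then obtain m where "0 < m" "y = (f ^^ m) x" "y \<in> Y" unfolding orbit_altdef by blast
  then show "y \<in> orbit (induced_perm f Y) x" using * x by blast
qed

lemma induced_perm_permutes: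
  assumes f: "f permutes X" "finite X" and Y: "Y \<subseteq> X"
  shows "induced_perm f Y permutes Y"
proof -
  have fin: "finite Y" using f(2) Y by (rule rev_finite_subset)
  let ?g = "induced_perm f Y"
  \<comment> \<open>As \<open>Y\<close> is finite, surjectivity suffices: \<open>y\<close> lies on
    its own cycle, so it is the image of the point visited just before its return.\<close>
  have "Y \<subseteq> ?g ` Y"
  proof
    fix y assume y: "y \<in> Y"
    have "y \<in> orbit f y" using f permutation_self_in_orbit permutation_permutes by metis
    then have "y \<in> orbit ?g y" using orbit_induced_perm[OF f y] y by simp
    then obtain n where n: "0 < n" "y = (?g ^^ n) y" unfolding orbit_altdef by blast
    then obtain k where k: "n = Suc k" using gr0_implies_Suc by blast
    have "(?g ^^ k) y \<in> Y"
    proof (cases k)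
      case (Suc j)
      then have "(?g ^^ k) y \<in> orbit ?g y" unfolding orbit_altdef by blast
      then show ?thesis using orbit_induced_perm[OF f y] by auto
    qed (use y in simp)
    moreover have "?g ((?g ^^ k) y) = y" using n k by simp
    ultimately show "y \<in> ?g ` Y" by (metis imageI)
  qed
  moreover have "?g ` Y \<subseteq> Y"
    using orbit.base orbit_induced_perm[OF f] by (metis IntE image_subsetI)
  ultimately have "?g ` Y = Y" by auto
  then have "bij_betw ?g Y Y" using fin by (simp add: bij_betw_def eq_card_imp_inj_on)
  then show ?thesis by (rule bij_imp_permutes) (simp add: induced_perm_not_in)
qed

lemma induced_perm_conj:
  assumes "bij s"
  shows "induced_perm (conj_perm s f) (s ` Y) = conj_perm s (induced_perm f Y)"
proof (rule conj_perm_eqI[symmetric, OF assms])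
  fix x
  have *: "s y \<in> s ` Y \<longleftrightarrow> y \<in> Y" for y using assms by (simp add: bij_is_inj inj_image_mem_iff)
  show "induced_perm (conj_perm s f) (s ` Y) (s x) = s (induced_perm f Y x)"
    by (simp add: induced_perm_def * conj_perm_funpow[OF assms])
qed

text \<open>Outside \<open>Y\<close> the factor \<open>z\<close> does nothing, so the walks of
  \<open>b\<close> and \<open>z \<circ> b\<close> agree until the first return to \<open>Y\<close>,
  where \<open>z\<close> acts once. This separates the rotation at \<open>v\<close> from everything
  else.\<close>

lemma induced_perm_comp_left:
  assumes z: "z permutes Y" and b: "b permutes X" "finite X"
  shows "induced_perm (z \<circ> b) Y = z \<circ> induced_perm b Y"
proof
  fix x
  show "induced_perm (z \<circ> b) Y x = (z \<circ> induced_perm b Y) x"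
  proof (cases "x \<in> Y")
    case True
    obtain k where k: "0 < k" "(b ^^ k) x \<in> Y" "\<And>j. 0 < j \<Longrightarrow> j < k \<Longrightarrow> (b ^^ j) x \<notin> Y"
      "induced_perm b Y x = (b ^^ k) x"
      using induced_permE[OF b True] by metis
    have zb: "((z \<circ> b) ^^ j) x = (b ^^ j) x" if "j < k" for j
      using that
    proof (induction j)
      case (Suc j)
      then have "(b ^^ Suc j) x \<notin> Y" using k(3) by blast
      then show ?case using Suc z by (simp add: permutes_not_in)
    qed simp
    obtain i where i: "k = Suc i" using k(1) gr0_implies_Suc by blast
    have zk: "((z \<circ> b) ^^ k) x = z ((b ^^ k) x)" using zb[of i] i by simp
    have "induced_perm (z \<circ> b) Y x = ((z \<circ> b) ^^ k) x"
      by (rule induced_perm_eqI[OF True k(1)]) (use k zb zk z in \<open>auto simp: permutes_in_image\<close>)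
    then show ?thesis using zk k(4) by simp
  qed (simp add: induced_perm_not_in permutes_not_in[OF z])
qed

lemma cyclic_on_induced_perm:
  assumes "f permutes X" "finite X" "cyclic_on f S" "S \<inter> Y \<noteq> {}"
  shows "cyclic_on (induced_perm f Y) (S \<inter> Y)"
proof -
  obtain y where y: "y \<in> S \<inter> Y" using assms(4) by blast
  then have "orbit (induced_perm f Y) y = S \<inter> Y"
    using orbit_induced_perm[OF assms(1,2), of y Y] orbit_cyclic_eq3[OF assms(3), of y] by simp
  then show ?thesis using y cyclic_on_singleI[of y] by metis
qed

text \<open>Cutting a point \<open>x\<close> out of the cycle costs one transposition:
  \<open>f\<close> is the swap of \<open>x\<close> and \<open>f x\<close> after the cycle induced on
  the remaining points.\<close>

lemma sign_cyclic:
  assumes "cyclic_on f S" "f permutes S"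
  shows "sign f = (-1) ^ (card S - 1)"
  using assms
proof (induction "card S" arbitrary: S f rule: less_induct)
  case less
  have fin: "finite S" using less.prems(1) by (rule finite_cyclic_on)
  obtain x where x: "x \<in> S" using less.prems(1) by (auto simp: cyclic_on_def)
  show ?case
  proof (cases "S = {x}")
    case True
    then show ?thesis using less.prems(2) by simp
  next
    case False
    define Y where "Y = S - {x}"
    define g where "g = induced_perm f Y"
    have "Y \<noteq> {}" "Y \<subseteq> S" using False x by (auto simp: Y_def)
    moreover have "card Y < card S" unfolding Y_def using fin x by (rule card_Diff1_less)
    moreover have "card S = Suc (card Y)" unfolding Y_def using fin x by (rule card.remove)
    ultimately have Y: "Y \<noteq> {}" "Y \<subseteq> S" "card Y < card S" "card S = Suc (card Y)" .
    have cpos: "card Y > 0" using fin Y(1,2) by (metis card_gt_0_iff finite_subset)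
    have cg: "cyclic_on g Y" using cyclic_on_induced_perm[OF less.prems(2) fin less.prems(1), of Y] Y
      by (simp add: g_def Int_absorb1)
    have pg: "g permutes Y" unfolding g_def using less.prems(2) fin Y(2) by (rule induced_perm_permutes)
    have fx: "f x \<noteq> x"
      using False orbit_eq_singleton_iff[of f x] orbit_cyclic_eq3[OF less.prems(1) x] by simp
    have inj: "f a = f b \<longleftrightarrow> a = b" for a b
      using permutes_inj[OF less.prems(2)] by (simp add: inj_eq)
    have fS: "f y \<in> S \<longleftrightarrow> y \<in> S" for y using less.prems(2) by (simp add: permutes_in_image)
    have geq: "f = Transposition.transpose x (f x) \<circ> g"
    proof
      fix y
      consider "y = x" | "y \<notin> S" | "y \<in> Y" "f y \<in> Y" | "y \<in> Y" "f y = x"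
        using fS[of y] by (auto simp: Y_def)
      then show "f y = (Transposition.transpose x (f x) \<circ> g) y"
      proof cases
        case 1
        then show ?thesis by (simp add: g_def Y_def induced_perm_not_in)
      next
        case 2
        then have "g y = y" "y \<noteq> x" "y \<noteq> f x" "f y = y"
          using x fS[of x] less.prems(2) by (auto simp: g_def Y_def induced_perm_not_in permutes_not_in)
        then show ?thesis by simp
      next
        case 3
        then have "g y = f y" "y \<noteq> x" "f y \<noteq> x" by (auto simp: g_def induced_perm_step Y_def)
        then show ?thesis by (simp add: inj)
      next
        case 4
        have "g y = (f ^^ 2) y" unfolding g_def
        proof (rule induced_perm_eqI)
          fix j :: nat assume "0 < j" "j < 2"
          then have "j = 1" by simp
          then show "(f ^^ j) y \<notin> Y" using 4 by (simp add: Y_def)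
        qed (use 4 fx fS[of x] x in \<open>auto simp: Y_def numeral_2_eq_2\<close>)
        then show ?thesis using 4 by (simp add: numeral_2_eq_2)
      qed
    qed
    have "permutation g" using pg fin Y(2) by (meson finite_subset permutation_permutes)
    then have "sign f = - sign g" using fx by (subst geq) (simp add: sign_compose sign_swap_id permutation_swap_id)
    also have "sign g = (-1) ^ (card Y - 1)" using less.hyps[OF Y(3) cg pg] .
    also have "- ((-1::int) ^ (card Y - 1)) = (-1) ^ (card S - 1)"
      using cpos Y(4) by (cases "card Y") simp_all
    finally show ?thesis .
  qed
qed

section \<open>Hook symmetrizers\<close>

text \<open>
  For \<open>A = X - (B - {x})\<close>, the map \<open>hook B x\<close> sends a product \<open>p \<circ> q\<close> of a permutation \<open>p\<close> of \<open>A\<close> and a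
  permutation \<open>q\<close> of \<open>B\<close> to the sign of \<open>q\<close>, and vanishes off such products: it is the Young
  symmetrizer of a hook, and \<open>close_perm\<close> recovers \<open>q\<close> from \<open>p \<circ> q\<close>.
\<close>

definition close_perm :: "'a set \<Rightarrow> 'a \<Rightarrow> ('a \<Rightarrow> 'a) \<Rightarrow> 'a \<Rightarrow> 'a" where
  "close_perm B x g y = (if y \<in> B then if g y \<in> B then g y else x else y)"

definition hook :: "'a set \<Rightarrow> 'a \<Rightarrow> ('a \<Rightarrow> 'a) \<Rightarrow> real" where
  "hook B x g = (if close_perm B x g permutes B then of_int (sign (close_perm B x g)) else 0)"

lemma abs_hook_le: "\<bar>hook B x g\<bar> \<le> 1"
  by (simp add: hook_def sign_def)

text \<open>A value in \<open>A\<close> stays in \<open>A\<close>, and every value in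
  \<open>A\<close> is recorded as \<open>x\<close>: either it is \<open>x\<close> itself or it lies
  outside \<open>B\<close>.\<close>

lemma close_perm_left:
  assumes "p permutes A" "A \<inter> B \<subseteq> {x}"
  shows "close_perm B x (p \<circ> g) = close_perm B x g"
proof
  fix y
  show "close_perm B x (p \<circ> g) y = close_perm B x g y"
  proof (cases "g y \<in> A")
    case True
    then have "p (g y) \<in> A" using assms(1) by (simp add: permutes_in_image)
    then show ?thesis using True assms(2) by (auto simp: close_perm_def)
  next
    case False
    then show ?thesis using assms(1) by (simp add: close_perm_def permutes_not_in)
  qed
qed

lemma close_perm_right:
  assumes "q permutes B" shows "close_perm B x (g \<circ> q) = close_perm B x g \<circ> q"
  using assms by (auto simp: close_perm_def fun_eq_iff permutes_in_image permutes_not_in)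

lemma hook_left:
  assumes "p permutes A" "A \<inter> B \<subseteq> {x}" shows "hook B x (p \<circ> g) = hook B x g"
  using close_perm_left[OF assms] by (simp add: hook_def)

lemma permutes_comp_right_iff:
  assumes "q permutes B" shows "f \<circ> q permutes B \<longleftrightarrow> f permutes B"
proof
  assume "f \<circ> q permutes B"
  then have "(f \<circ> q) \<circ> inv q permutes B" by (rule permutes_compose[OF permutes_inv[OF assms]])
  then show "f permutes B" using permutes_inv_o(1)[OF assms] by (simp add: comp_assoc)
qed (rule permutes_compose[OF assms])

lemma hook_right:
  assumes "finite B" "q permutes B"
  shows "hook B x (g \<circ> q) = of_int (sign q) * hook B x g"
proof (cases "close_perm B x g permutes B")
  case True
  then have "permutation (close_perm B x g)" "permutation q"
    using assms permutation_permutes by blast+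
  then show ?thesis
    using True assms(2) by (simp add: hook_def close_perm_right permutes_comp_right_iff sign_compose)
qed (use assms(2) in \<open>simp add: hook_def close_perm_right permutes_comp_right_iff\<close>)

lemma close_perm_in: "x \<in> B \<Longrightarrow> y \<in> B \<Longrightarrow> close_perm B x g y \<in> B"
  by (simp add: close_perm_def)

text \<open>With its converse \<open>close_perm_permutesI\<close> this turns nonvanishing of
  \<open>hook\<close> into a condition on \<open>B\<close> alone: every point of \<open>B\<close>
  except possibly \<open>x\<close> has its predecessor under \<open>g\<close> in
  \<open>B\<close>.\<close>

lemma close_perm_permutesD:
  assumes "close_perm B x g permutes B" shows "B - {x} \<subseteq> g ` B"
proof
  fix b assume b: "b \<in> B - {x}"
  then have "b \<in> close_perm B x g ` B" using permutes_image[OF assms] by simp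
  then show "b \<in> g ` B" using b by (auto simp: close_perm_def split: if_splits)
qed

lemma close_perm_permutesI:
  assumes "inj g" "finite B" "x \<in> B" "B - {x} \<subseteq> g ` B"
  shows "close_perm B x g permutes B"
proof -
  \<comment> \<open>The value \<open>x\<close> is attained in either case: if \<open>g\<close> keeps
    \<open>B\<close> inside \<open>B\<close>, it permutes \<open>B\<close> and so hits
    \<open>x\<close>; otherwise a point leaving \<open>B\<close> is sent to
    \<open>x\<close>.\<close>
  have "x \<in> close_perm B x g ` B"
  proof (cases "g ` B \<subseteq> B")
    case True
    then have "g ` B = B" using assms(2) inj_on_subset[OF assms(1)] by (intro endo_inj_surj) auto
    then have "x \<in> g ` B" using assms(3) by simp
    then obtain y where y: "y \<in> B" "g y = x" by blast
    have "close_perm B x g y = x" using y assms(3) by (simp add: close_perm_def)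
    then show ?thesis using y(1) by (metis imageI)
  next
    case False
    then obtain y where "y \<in> B" "g y \<notin> B" by auto
    then show ?thesis by (intro image_eqI[of _ _ y]) (auto simp: close_perm_def)
  qed
  moreover have "b \<in> close_perm B x g ` B" if b: "b \<in> B - {x}" for b
  proof -
    obtain y where "y \<in> B" "b = g y" using b assms(4) by auto
    then show ?thesis using b by (intro image_eqI[of _ _ y]) (auto simp: close_perm_def)
  qed
  ultimately have "B \<subseteq> close_perm B x g ` B" by blast
  moreover have "close_perm B x g ` B \<subseteq> B" using close_perm_in[OF assms(3)] by blast
  ultimately have "close_perm B x g ` B = B" by (rule equalityI[rotated])
  then have "bij_betw (close_perm B x g) B B" using assms(2) by (simp add: bij_betw_def eq_card_imp_inj_on)
  then show ?thesis by (rule bij_imp_permutes) (simp add: close_perm_def)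
qed

text \<open>
  Von Neumann's lemma on Young symmetrizers, for hooks. It takes the place of Schur's lemma.
\<close>

lemma hook_unique:
  fixes \<Phi> :: "('a \<Rightarrow> 'a) \<Rightarrow> real"
  assumes X: "finite X" and B: "x \<in> B" "B \<subseteq> X" and g: "g permutes X"
    and left: "\<And>p g. p permutes X - (B - {x}) \<Longrightarrow> g permutes X \<Longrightarrow> \<Phi> (p \<circ> g) = \<Phi> g"
    and right: "\<And>q g. q permutes B \<Longrightarrow> g permutes X \<Longrightarrow> \<Phi> (g \<circ> q) = of_int (sign q) * \<Phi> g"
  shows "\<Phi> g = hook B x g * \<Phi> id"
proof (cases "close_perm B x g permutes B")
  case True
  define q where "q = close_perm B x g"
  \<comment> \<open>A nonzero hook value makes \<open>g\<close> factor as
    \<open>p \<circ> q\<close>, with \<open>q\<close> acting on the column \<open>B\<close> of the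
    hook and \<open>p\<close> on its row \<open>X - (B - {x})\<close>. The two invariances then
    strip off both factors.\<close>
  define p where "p = g \<circ> inv q"
  have q: "q permutes B" and qX: "q permutes X" using True B(2) by (auto simp: q_def intro: permutes_subset)
  have gpq: "g = p \<circ> q" using permutes_inv_o(2)[OF q] by (simp add: p_def comp_assoc)
  have pX: "p permutes X" unfolding p_def using permutes_inv[OF qX] g by (rule permutes_compose)
  have p: "p permutes X - (B - {x})"
  proof (rule permutes_superset[OF pX])
    fix y assume "y \<in> X - (X - (B - {x}))"
    then have y: "y \<in> B" "y \<noteq> x" by auto
    define z where "z = inv q y"
    have z: "z \<in> B" "q z = y"
      using y(1) q by (auto simp: z_def permutes_inverses permutes_in_image permutes_inv)
    then have "g z = y" using y(2) by (auto simp: q_def close_perm_def split: if_splits)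
    then show "p y = y" by (simp add: p_def z_def)
  qed
  have "\<Phi> g = of_int (sign q) * \<Phi> p" by (subst gpq) (rule right[OF q pX])
  also have "\<Phi> p = \<Phi> id" using left[OF p permutes_id] by simp
  finally show ?thesis using True by (simp add: hook_def q_def)
next
  case False
  have injg: "inj g" using g by (rule permutes_inj)
  have "\<not> inj_on (close_perm B x g) B"
  proof
    assume "inj_on (close_perm B x g) B"
    then have "bij_betw (close_perm B x g) B B"
      using B X close_perm_in[OF B(1)] by (intro bij_betw_imageI endo_inj_surj) (auto intro: finite_subset)
    then have "close_perm B x g permutes B" by (rule bij_imp_permutes) (simp add: close_perm_def)
    with False show False by contradiction
  qed
  then obtain y z where yz: "y \<in> B" "z \<in> B" "y \<noteq> z" "close_perm B x g y = close_perm B x g z"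
    unfolding inj_on_def by blast
  have "g y \<noteq> g z" using yz(3) injg by (simp add: inj_eq)
  then have gyz: "g y \<in> X - (B - {x})" "g z \<in> X - (B - {x})"
    using yz B(2) permutes_in_image[OF g] by (auto simp: close_perm_def split: if_splits)
  \<comment> \<open>Both points close up to \<open>x\<close>, so their images under \<open>g\<close>
    lie in the row. The same permutation arises from \<open>g\<close> by a row swap on the left,
    which keeps \<Phi>, and by a column swap on the right, which negates it.\<close>
  let ?t = "Transposition.transpose y z" and ?p = "Transposition.transpose (g y) (g z)"
  have "?p permutes X - (B - {x})" using gyz by (rule permutes_swap_id)
  then have "\<Phi> (?p \<circ> g) = \<Phi> g" using g by (rule left)
  moreover have "?p \<circ> g = g \<circ> ?t" using injg by (auto simp: fun_eq_iff Transposition.transpose_def inj_eq)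
  moreover have "\<Phi> (g \<circ> ?t) = of_int (sign ?t) * \<Phi> g"
    using permutes_swap_id[OF yz(1,2)] g by (rule right)
  moreover have "sign ?t = -1" using yz(3) by (simp add: sign_swap_id)
  ultimately have "\<Phi> g = 0" by simp
  then show ?thesis using False by (simp add: hook_def)
qed

text \<open>The sum over all conjugates commutes with translations: a factor \<open>q\<close> on the
  right of \<open>g\<close> can be moved past the conjugate after replacing \<open>s\<close> by
  \<open>q \<circ> s\<close>. Hence the left side, as a function of \<open>g\<close>, has both
  invariances of \<open>hook_unique\<close>, and averaging acts on the hook function as a
  scalar.\<close>

lemma hook_conj_sum:
  assumes X: "finite X" and B: "x \<in> B" "B \<subseteq> X" and g: "g permutes X"
  shows "(\<Sum>s | s permutes X. hook B x (g \<circ> conj_perm s t)) =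
    hook B x g * (\<Sum>s | s permutes X. hook B x (conj_perm s t))"
proof -
  define \<Phi> where "\<Phi> g = (\<Sum>s | s permutes X. hook B x (g \<circ> conj_perm s t))" for g
  have fB: "finite B" using X B(2) by (rule rev_finite_subset)
  have "\<Phi> g = hook B x g * \<Phi> id"
  proof (rule hook_unique[OF X B g])
    fix p g assume "p permutes X - (B - {x})"
    then show "\<Phi> (p \<circ> g) = \<Phi> g"
      using hook_left[of p "X - (B - {x})" B x] by (auto simp: \<Phi>_def comp_assoc intro!: sum.cong)
  next
    fix q g assume q: "q permutes B"
    then have qX: "q permutes X" using B(2) by (rule permutes_subset)
    have "\<Phi> (g \<circ> q) = (\<Sum>s | s permutes X. hook B x ((g \<circ> conj_perm (q \<circ> s) t) \<circ> q))"
      unfolding \<Phi>_def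
    proof (rule sum.cong)
      fix s assume "s \<in> {s. s permutes X}"
      then have "conj_perm (q \<circ> s) t \<circ> q = q \<circ> conj_perm s t"
        using permutes_bij[OF qX]
        by (simp add: conj_perm_conj_perm[symmetric] permutes_bij)
           (simp add: conj_perm_def comp_assoc permutes_inv_o(2)[OF qX])
      then show "hook B x (g \<circ> q \<circ> conj_perm s t) = hook B x (g \<circ> conj_perm (q \<circ> s) t \<circ> q)"
        by (simp add: comp_assoc)
    qed simp
    also have "\<dots> = of_int (sign q) * (\<Sum>s | s permutes X. hook B x (g \<circ> conj_perm (q \<circ> s) t))"
      by (simp only: hook_right[OF fB q] sum_distrib_left)
    also have "(\<Sum>s | s permutes X. hook B x (g \<circ> conj_perm (q \<circ> s) t)) = \<Phi> g"
      unfolding \<Phi>_def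
      using setum_permutations_compose_left[OF qX, of "\<lambda>s. hook B x (g \<circ> conj_perm s t)"] by simp
    finally show "\<Phi> (g \<circ> q) = of_int (sign q) * \<Phi> g" .
  qed
  then show ?thesis by (simp add: \<Phi>_def)
qed

lemma close_perm_conj:
  assumes "bij s" shows "close_perm (s ` B) (s x) (conj_perm s g) = conj_perm s (close_perm B x g)"
  by (rule conj_perm_eqI[symmetric, OF assms])
     (use assms in \<open>simp add: close_perm_def conj_perm_apply bij_is_inj inj_image_mem_iff\<close>)

lemma hook_conj:
  assumes X: "finite X" and B: "B \<subseteq> X" and s: "s permutes X"
  shows "hook (s ` B) (s x) (conj_perm s g) = hook B x g"
proof -
  have bs: "bij s" using s by (rule permutes_bij)
  have iff: "conj_perm s f permutes s ` B \<longleftrightarrow> f permutes B" for f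
  proof
    assume "conj_perm s f permutes s ` B"
    then have "conj_perm (inv s) (conj_perm s f) permutes inv s ` s ` B"
      by (rule conj_perm_permutes[OF bij_imp_bij_inv[OF bs]])
    moreover have "inv s ` s ` B = B" using bs by (simp add: bij_is_inj inv_f_f image_image)
    ultimately show "f permutes B" using bs by (simp add: conj_perm_inv_cancel)
  qed (rule conj_perm_permutes[OF bs])
  have "sign (conj_perm s f) = sign f" if "f permutes B" for f
    using that s X B by (meson finite_subset permutation_permutes sign_conj_perm)
  then show ?thesis by (simp add: hook_def close_perm_conj[OF bs] iff)
qed

lemma permutes_image_eq_exists:
  assumes "finite X" "A \<subseteq> X" "A' \<subseteq> X" "card A = card A'"
  obtains s where "s permutes X" "s ` A = A'"
proof -
  have fin: "finite A" "finite A'" using assms by (auto intro: finite_subset)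
  obtain h where h: "bij_betw h A A'" using fin assms(4) finite_same_card_bij by blast
  have "card (X - A) = card (X - A')" using assms fin by (simp add: card_Diff_subset)
  then obtain k where k: "bij_betw k (X - A) (X - A')"
    using assms(1) finite_same_card_bij by (metis finite_Diff)
  define s where "s y = (if y \<in> A then h y else if y \<in> X then k y else y)" for y
  have "bij_betw s A A'" using h by (rule bij_betw_cong[THEN iffD1, rotated]) (simp add: s_def)
  moreover have "bij_betw s (X - A) (X - A')"
    using k by (rule bij_betw_cong[THEN iffD1, rotated]) (simp add: s_def)
  ultimately have "bij_betw s (A \<union> (X - A)) (A' \<union> (X - A'))" by (rule bij_betw_combine) blast
  then have "bij_betw s X X" using assms(2,3) by (simp add: Un_absorb1)
  then have "s permutes X" by (rule bij_imp_permutes) (use assms(2) in \<open>auto simp: s_def\<close>)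
  moreover have "s ` A = A'" using \<open>bij_betw s A A'\<close> by (simp add: bij_betw_def)
  ultimately show thesis by (rule that)
qed

text \<open>A permutation fixing \<open>x\<close> and carrying \<open>B\<close> to \<open>B'\<close>
  merely reindexes the conjugates. So the scalar of \<open>hook_conj_sum\<close> depends only on the
  shape of the hook.\<close>

lemma hook_conj_sum_cong_card:
  assumes X: "finite X" and B: "x \<in> B" "B \<subseteq> X" and B': "x \<in> B'" "B' \<subseteq> X" and card: "card B = card B'"
  shows "(\<Sum>s | s permutes X. hook B x (conj_perm s t)) = (\<Sum>s | s permutes X. hook B' x (conj_perm s t))"
proof -
  have "card (B - {x}) = card (B' - {x})" using B B' card by simp
  moreover have "B - {x} \<subseteq> X - {x}" "B' - {x} \<subseteq> X - {x}" using B(2) B'(2) by auto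
  ultimately obtain r where r: "r permutes X - {x}" "r ` (B - {x}) = B' - {x}"
    using X permutes_image_eq_exists[of "X - {x}" "B - {x}" "B' - {x}"] by (metis finite_Diff)
  have rX: "r permutes X" using r(1) by (rule permutes_subset) blast
  have rx: "r x = x" using r(1) by (rule permutes_not_in) simp
  have rB: "r ` B = B'" using r(2) rx B(1) B'(1) by (metis image_insert insert_Diff)
  have "(\<Sum>s | s permutes X. hook B' x (conj_perm s t)) = (\<Sum>s | s permutes X. hook B' x (conj_perm (r \<circ> s) t))"
    using setum_permutations_compose_left[OF rX, of "\<lambda>s. hook B' x (conj_perm s t)"] by simp
  also have "\<dots> = (\<Sum>s | s permutes X. hook B x (conj_perm s t))"
  proof (rule sum.cong)
    fix s assume "s \<in> {s. s permutes X}"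
    then have "conj_perm (r \<circ> s) t = conj_perm r (conj_perm s t)"
      using rX by (simp add: conj_perm_conj_perm permutes_bij)
    then show "hook B' x (conj_perm (r \<circ> s) t) = hook B x (conj_perm s t)"
      using hook_conj[OF X B(2) rX, of x "conj_perm s t"] rB rx by simp
  qed simp
  finally show ?thesis by simp
qed

section \<open>Supports of hook functions: whole cycles and initial segments\<close>

text \<open>Walking backwards along the cycle of \<open>b\<close> can leave \<open>B\<close> only at
  \<open>x\<close>, and this cycle does not pass through \<open>x\<close>.\<close>

lemma segment_set_closed:
  assumes X: "finite X" "g permutes X" and B: "B - {x} \<subseteq> g ` B"
    and b: "b \<in> B" "x \<notin> orbit g b"
  shows "orbit g b \<subseteq> B"
proof
  have bij: "bij g" using X(2) by (rule permutes_bij)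
  have perm: "permutation g" using X permutation_permutes by blast
  have step: "inv g z \<in> B" if z: "z \<in> B" "z \<in> orbit g b" for z
  proof -
    have "z \<in> B - {x}" using z b(2) by auto
    then obtain y where "y \<in> B" "z = g y" using B by auto
    then show ?thesis using bij by (simp add: bij_is_inj)
  qed
  fix z assume "z \<in> orbit g b"
  then have "z \<in> orbit (inv g) b" using perm by (simp add: orbit_inv_eq)
  then have "z \<in> B \<and> z \<in> orbit g b"
  proof induction
    case base
    have "inv g b \<in> orbit g b" using orbit_inv_eq[OF perm] orbit.base[of "inv g" b] by simp
    then show ?case using step b(1) permutation_self_in_orbit[OF perm] by blast
  next
    case (step z)
    then have "inv g z \<in> orbit g b" using orbit_inv_eq[OF perm] orbit.step[of z "inv g" b] by simp
    then show ?case using step.IH \<open>\<And>z. z \<in> B \<Longrightarrow> z \<in> orbit g b \<Longrightarrow> inv g z \<in> B\<close> by blast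
  qed
  then show "z \<in> B" by blast
qed

text \<open>The same backward walk, on the cycle of \<open>x\<close>: it stays in \<open>B\<close>
  until it arrives at \<open>x\<close>, so \<open>B\<close> meets this cycle in an initial
  segment.\<close>

lemma segment_set_initial:
  assumes X: "finite X" "g permutes X" and B: "B - {x} \<subseteq> g ` B"
    and i: "i < card (orbit g x)" "(g ^^ i) x \<in> B" and j: "j \<le> i"
  shows "(g ^^ j) x \<in> B"
  using j i
proof (induction i rule: dec_induct)
  case (step n)
  have perm: "permutation g" using X permutation_permutes by blast
  have c: "cyclic_on g (orbit g x)" using perm by (rule cyclic_on_orbit')
  have "inj_on (\<lambda>i. (g ^^ i) x) {..<card (orbit g x)}"
    using cyclic_on_enum(1)[OF c permutation_self_in_orbit[OF perm]] by (rule bij_betw_imp_inj_on)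
  then have "(g ^^ Suc n) x \<noteq> (g ^^ 0) x" using step.prems(1) by (subst inj_on_eq_iff) auto
  then have "(g ^^ Suc n) x \<in> B - {x}" using step.prems(2) by simp
  then obtain y where "y \<in> B" "g y = g ((g ^^ n) x)" using B by force
  then have "(g ^^ n) x \<in> B" using permutes_inj[OF X(2)] by (simp add: inj_eq)
  then show ?case using step.IH step.prems(1) by simp
qed

text \<open>On the cycle of \<open>x\<close> both sets are initial segments, hence nested, and they
  have the same size there because they agree elsewhere.\<close>

lemma segment_set_eqI:
  assumes X: "finite X" "g permutes X" and B: "B \<subseteq> X" "B - {x} \<subseteq> g ` B"
    and B': "B' \<subseteq> X" "B' - {x} \<subseteq> g ` B'"
    and card: "card B = card B'" and eq: "B - orbit g x = B' - orbit g x"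
  shows "B = B'"
proof -
  let ?O = "orbit g x"
  have perm: "permutation g" using X permutation_permutes by blast
  have enum: "?O = (\<lambda>i. (g ^^ i) x) ` {..<card ?O}"
    using cyclic_on_enum(1)[OF cyclic_on_orbit'[OF perm] permutation_self_in_orbit[OF perm]]
    by (simp add: bij_betw_def)
  have fin: "finite B" "finite B'" using X(1) B(1) B'(1) by (auto intro: finite_subset)
  have "card (B \<inter> ?O) + card (B - ?O) = card (B' \<inter> ?O) + card (B' - ?O)"
    using card fin by (simp add: card_Int_Diff[symmetric])
  then have c: "card (B \<inter> ?O) = card (B' \<inter> ?O)" using eq by simp
  have "B \<inter> ?O \<subseteq> B' \<or> B' \<inter> ?O \<subseteq> B"
  proof (rule ccontr)
    assume "\<not> ?thesis"
    then obtain y z where y: "y \<in> B" "y \<in> ?O" "y \<notin> B'" and z: "z \<in> B'" "z \<in> ?O" "z \<notin> B" by blast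
    obtain i where i: "i < card ?O" "y = (g ^^ i) x" using y(2) enum by blast
    obtain j where j: "j < card ?O" "z = (g ^^ j) x" using z(2) enum by blast
    show False
    proof (cases "i \<le> j")
      case True
      then show False using segment_set_initial[OF X B'(2) j(1) _ True] z(1) y(3) i(2) j(2) by blast
    next
      case False
      then show False using segment_set_initial[OF X B(2) i(1), of j] y(1) z(3) i(2) j(2) by auto
    qed
  qed
  then have "B \<inter> ?O = B' \<inter> ?O"
  proof
    assume "B \<inter> ?O \<subseteq> B'"
    then show ?thesis using c fin by (intro card_subset_eq) auto
  next
    assume "B' \<inter> ?O \<subseteq> B"
    then show ?thesis using c fin by (intro card_subset_eq[symmetric]) auto
  qed
  then show ?thesis using eq by blast
qed

text \<open>The possible first columns of a hook with corner \<open>x\<close> and leg length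
  \<open>k\<close>. Their number, \<open>card X - 1\<close> choose \<open>k\<close>, is the degree
  of the hook character.\<close>

definition pointed_subsets :: "'a set \<Rightarrow> 'a \<Rightarrow> nat \<Rightarrow> 'a set set" where
  "pointed_subsets X x k = {B. x \<in> B \<and> B \<subseteq> X \<and> card B = Suc k}"

lemma finite_pointed_subsets: "finite X \<Longrightarrow> finite (pointed_subsets X x k)"
  by (rule finite_subset[of _ "Pow X"]) (auto simp: pointed_subsets_def)

lemma card_pointed_subsets:
  assumes "finite X" "x \<in> X" shows "card (pointed_subsets X x k) = (card X - 1) choose k"
proof -
  have "bij_betw (insert x) {A. A \<subseteq> X - {x} \<and> card A = k} (pointed_subsets X x k)"
  proof (rule bij_betw_byWitness[where f'="\<lambda>B. B - {x}"])
    show "insert x ` {A. A \<subseteq> X - {x} \<and> card A = k} \<subseteq> pointed_subsets X x k"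
    proof
      fix B assume "B \<in> insert x ` {A. A \<subseteq> X - {x} \<and> card A = k}"
      then obtain A where A: "B = insert x A" "A \<subseteq> X - {x}" "card A = k" by blast
      then have "finite A" "x \<notin> A" using assms(1) by (auto intro: finite_subset)
      then show "B \<in> pointed_subsets X x k" using A assms(2) by (auto simp: pointed_subsets_def)
    qed
  qed (auto simp: pointed_subsets_def)
  then have "card (pointed_subsets X x k) = card {A. A \<subseteq> X - {x} \<and> card A = k}"
    by (simp add: bij_betw_same_card)
  then show ?thesis using assms by (simp add: n_subsets)
qed

lemma sum_pointed_subsets:
  assumes "finite X"
  shows "(\<Sum>B | x \<in> B \<and> B \<subseteq> X. f B) = (\<Sum>k<card X. \<Sum>B\<in>pointed_subsets X x k. f B)"
proof -
  have fin: "finite B" if "B \<subseteq> X" for B using assms that by (rule rev_finite_subset)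
  have "(\<lambda>B. card B - 1) ` {B. x \<in> B \<and> B \<subseteq> X} \<subseteq> {..<card X}"
  proof
    fix k assume "k \<in> (\<lambda>B. card B - 1) ` {B. x \<in> B \<and> B \<subseteq> X}"
    then obtain B where B: "x \<in> B" "B \<subseteq> X" "k = card B - 1" by blast
    then have "0 < card B" using fin by (auto simp: card_gt_0_iff)
    moreover have "card B \<le> card X" using B(2) assms by (simp add: card_mono)
    ultimately show "k \<in> {..<card X}" using B(3) by simp
  qed
  moreover have "finite {B. x \<in> B \<and> B \<subseteq> X}" using assms by (auto intro: finite_subset[of _ "Pow X"])
  ultimately have "(\<Sum>B | x \<in> B \<and> B \<subseteq> X. f B) =
      (\<Sum>k<card X. \<Sum>B | B \<in> {B. x \<in> B \<and> B \<subseteq> X} \<and> card B - 1 = k. f B)"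
    using sum.group[of "{B. x \<in> B \<and> B \<subseteq> X}" "{..<card X}" "\<lambda>B. card B - 1" f] by simp
  moreover have "{B \<in> {B. x \<in> B \<and> B \<subseteq> X}. card B - 1 = k} = pointed_subsets X x k" for k
  proof -
    have "card B - 1 = k \<longleftrightarrow> card B = Suc k" if "x \<in> B" "B \<subseteq> X" for B
    proof -
      have "0 < card B" using that fin by (auto simp: card_gt_0_iff)
      then show ?thesis by auto
    qed
    then show ?thesis by (auto simp: pointed_subsets_def)
  qed
  ultimately show ?thesis by simp
qed

definition binomial_sum :: "nat \<Rightarrow> nat \<Rightarrow> nat" where
  "binomial_sum a k = (\<Sum>j\<le>k. a choose j)"

lemma card_subsets_card_le:
  assumes "finite S"
  shows "card {T. T \<subseteq> S \<and> card T \<le> k} = binomial_sum (card S) k"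
proof -
  have "{T. T \<subseteq> S \<and> card T \<le> k} = (\<Union>j\<le>k. {T. T \<subseteq> S \<and> card T = j})" by auto
  also have "card \<dots> = (\<Sum>j\<le>k. card {T. T \<subseteq> S \<and> card T = j})"
    using assms by (intro card_UN_disjoint) (auto intro: finite_subset[of _ "Pow S"])
  finally show ?thesis using assms by (simp add: n_subsets binomial_sum_def)
qed

lemma card_orbit_family_le:
  assumes "T \<subseteq> orbit g ` X" "finite A" "\<Union>T \<subseteq> A" "permutation g"
  shows "card T \<le> card A"
proof -
  have fin: "finite (\<Union>T)" using assms(3,2) by (rule finite_subset)
  have "T \<subseteq> orbit g ` \<Union>T"
  proof
    fix O' assume O: "O' \<in> T"
    then obtain y where y: "O' = orbit g y" using assms(1) by blast
    then have "y \<in> \<Union>T" using O permutation_self_in_orbit[OF assms(4)] by blast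
    then show "O' \<in> orbit g ` \<Union>T" using y by blast
  qed
  then have "card T \<le> card (\<Union>T)" using fin by (rule surj_card_le[rotated])
  also have "\<dots> \<le> card A" using assms(2,3) by (simp add: card_mono)
  finally show ?thesis .
qed

text \<open>A supporting \<open>B\<close> consists of an initial segment of the cycle of
  \<open>x\<close> and of whole other cycles. As its size is given, it is determined by the set
  \<open>T B\<close> of these other cycles; at most \<open>k\<close> of them fit into
  \<open>B - {x}\<close>. The subtracted 1 stands for the cycle of \<open>x\<close>.\<close>

lemma card_hook_support:
  fixes k :: nat
  assumes X: "finite X" "g permutes X" "x \<in> X"
  defines "N \<equiv> {B \<in> pointed_subsets X x k. hook B x g \<noteq> 0}"
  shows "card N \<le> binomial_sum (card (orbit g ` X) - 1) k"
    and "card N \<le> binomial_sum (card (orbit g ` X) - 1) (card X - 1 - k)"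
proof -
  have perm: "permutation g" using X permutation_permutes by blast
  define S where "S = orbit g ` X - {orbit g x}"
  define T where "T B = {O' \<in> S. O' \<subseteq> B}" for B
  have S: "finite S" "card S = card (orbit g ` X) - 1" using X by (auto simp: S_def)
  have NB: "x \<in> B" "B \<subseteq> X" "card B = Suc k" "B - {x} \<subseteq> g ` B" "finite B" if "B \<in> N" for B
    using that close_perm_permutesD[of B x g] finite_subset[OF _ X(1), of B]
    by (auto simp: N_def pointed_subsets_def hook_def split: if_splits)
  have Oeq: "orbit g a = orbit g b" if "a \<in> orbit g b" for a b
    using that cyclic_on_orbit'[OF perm] by (simp add: orbit_cyclic_eq3)
  have SO: "O' = orbit g b" "x \<notin> orbit g b" if "O' \<in> S" "b \<in> O'" for O' b
    using that Oeq unfolding S_def by blast+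
  have meet: "O' \<subseteq> B" if "B \<in> N" "O' \<in> S" "b \<in> O'" "b \<in> B" for B O' b
    using segment_set_closed[OF X(1,2) NB(4)[OF that(1)] that(4)] SO[OF that(2,3)] by simp
  have T: "B - orbit g x = \<Union>(T B)" if B: "B \<in> N" for B
  proof
    show "\<Union>(T B) \<subseteq> B - orbit g x"
    proof
      fix b assume "b \<in> \<Union>(T B)"
      then obtain O' where O': "O' \<in> S" "O' \<subseteq> B" "b \<in> O'" by (auto simp: T_def)
      have "x \<notin> orbit g b" using SO O' by blast
      then have "b \<notin> orbit g x" using Oeq[of b x] permutation_self_in_orbit[OF perm, of x] by auto
      then show "b \<in> B - orbit g x" using O' by blast
    qed
    show "B - orbit g x \<subseteq> \<Union>(T B)"
    proof
      fix b assume b: "b \<in> B - orbit g x"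
      have "orbit g b \<in> S"
        using b NB(2)[OF B] permutation_self_in_orbit[OF perm, of b] by (auto simp: S_def)
      then show "b \<in> \<Union>(T B)"
        using b meet[OF B, of "orbit g b" b] permutation_self_in_orbit[OF perm, of b] by (auto simp: T_def)
    qed
  qed
  have inj: "inj_on T N"
  proof (rule inj_onI)
    fix B B' assume B: "B \<in> N" "B' \<in> N" "T B = T B'"
    show "B = B'"
      using segment_set_eqI[OF X(1,2) NB(2,4)[OF B(1)] NB(2,4)[OF B(2)]] NB(3) T B by simp
  qed
  have x_notin: "x \<notin> \<Union>S" using SO by blast
  have "T ` N \<subseteq> {T. T \<subseteq> S \<and> card T \<le> k}"
  proof
    fix U assume "U \<in> T ` N"
    then obtain B where B: "B \<in> N" "U = T B" by blast
    have "card (T B) \<le> card (B - {x})"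
      using NB(5)[OF B(1)] x_notin perm
      by (intro card_orbit_family_le[where g=g and X=X]) (auto simp: T_def S_def)
    then show "U \<in> {T. T \<subseteq> S \<and> card T \<le> k}" using B NB[OF B(1)] by (auto simp: T_def)
  qed
  then have "card N \<le> card {T. T \<subseteq> S \<and> card T \<le> k}"
    using S(1) by (intro card_inj_on_le[OF inj]) (auto intro: finite_subset[of _ "Pow S"])
  then show "card N \<le> binomial_sum (card (orbit g ` X) - 1) k" using S by (simp add: card_subsets_card_le)
  \<comment> \<open>The second bound counts complements: a cycle that avoids \<open>x\<close> and is
    not contained in \<open>B\<close> is disjoint from \<open>B\<close>, so all such cycles share
    the \<open>card X - 1 - k\<close> points of \<open>X - B\<close>.\<close>
  have inj': "inj_on (\<lambda>B. S - T B) N"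
  proof (rule inj_onI)
    fix B B' assume B: "B \<in> N" "B' \<in> N" "S - T B = S - T B'"
    have "T B \<subseteq> S" "T B' \<subseteq> S" by (auto simp: T_def)
    then have "T B = T B'" using B(3) by blast
    then show "B = B'" using inj B by (simp add: inj_on_eq_iff)
  qed
  have "(\<lambda>B. S - T B) ` N \<subseteq> {T. T \<subseteq> S \<and> card T \<le> card X - 1 - k}"
  proof
    fix U assume "U \<in> (\<lambda>B. S - T B) ` N"
    then obtain B where B: "B \<in> N" "U = S - T B" by blast
    have "\<Union>S \<subseteq> X" using X(2) permutes_orbit_subset by (fastforce simp: S_def)
    then have "card (S - T B) \<le> card (X - B)"
      using X(1) perm meet[OF B(1)]
      by (intro card_orbit_family_le[where g=g and X=X]) (auto simp: T_def S_def)
    also have "\<dots> = card X - 1 - k" using NB[OF B(1)] X by (simp add: card_Diff_subset)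
    finally show "U \<in> {T. T \<subseteq> S \<and> card T \<le> card X - 1 - k}" using B by auto
  qed
  then have "card N \<le> card {T. T \<subseteq> S \<and> card T \<le> card X - 1 - k}"
    using S(1) by (intro card_inj_on_le[OF inj']) (auto intro: finite_subset[of _ "Pow S"])
  then show "card N \<le> binomial_sum (card (orbit g ` X) - 1) (card X - 1 - k)"
    using S by (simp add: card_subsets_card_le)
qed

text \<open>The sum is the hook character at \<open>g\<close>: the trace on the \<open>k\<close>-th
  exterior power of the sum-zero vectors. In the basis of the differences \<open>e y - e x\<close>,
  the values \<open>hook B x g\<close> are the principal minors. Each is 0 or a sign, so the size of
  the support bounds the sum.\<close>

lemma abs_sum_hook_le:
  assumes "finite X" "g permutes X" "x \<in> X"
  shows "\<bar>\<Sum>B\<in>pointed_subsets X x k. hook B x g\<bar>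
    \<le> binomial_sum (card (orbit g ` X) - 1) (min k (card X - 1 - k))"
proof -
  let ?N = "{B \<in> pointed_subsets X x k. hook B x g \<noteq> 0}"
  have fin: "finite (pointed_subsets X x k)" using assms(1) by (rule finite_pointed_subsets)
  have "(\<Sum>B\<in>pointed_subsets X x k. hook B x g) = (\<Sum>B\<in>?N. hook B x g)"
    by (rule sum.mono_neutral_right) (use fin in auto)
  also have "\<bar>\<dots>\<bar> \<le> (\<Sum>B\<in>?N. \<bar>hook B x g\<bar>)" by (rule sum_abs)
  also have "\<dots> \<le> (\<Sum>B\<in>?N. 1)" by (intro sum_mono abs_hook_le)
  also have "\<dots> = card ?N" by simp
  finally show ?thesis using card_hook_support[OF assms, of k]
    by (simp add: min_def)
qed

section \<open>Full cycles as an alternating sum of hooks\<close>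

text \<open>For a full cycle the support contains exactly one set of size \<open>Suc k\<close>, the
  first \<open>Suc k\<close> points from \<open>x\<close> on; \<open>close_perm\<close> bends this
  segment into a cycle of sign \<open>(-1) ^ k\<close>.\<close>

lemma sum_hook_cyclic:
  assumes g: "g permutes X" "cyclic_on g X" and x: "x \<in> X" and k: "k < card X"
  shows "(\<Sum>B\<in>pointed_subsets X x k. hook B x g) = (-1) ^ k"
proof -
  have fin: "finite X" using g(2) by (rule finite_cyclic_on)
  have O: "orbit g x = X" using g(2) x by (rule orbit_cyclic_eq3)
  have injg: "inj g" using g(1) by (rule permutes_inj)
  define a where "a i = (g ^^ i) x" for i
  define C where "C = a ` {..k}"
  have a: "bij_betw a {..<card X} X" "a (card X) = x"
    using cyclic_on_enum[OF g(2) x] unfolding a_def by blast+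
  have ga: "g (a i) = a (Suc i)" and a0: "a 0 = x" for i by (simp_all add: a_def)
  have sub: "{..k} \<subseteq> {..<card X}" using k by auto
  have inj: "inj_on a {..k}" using a(1) sub by (meson bij_betw_imp_inj_on inj_on_subset)
  have C: "C \<in> pointed_subsets X x k"
  proof -
    have "C \<subseteq> X" using a(1) sub by (auto simp: C_def bij_betw_def)
    moreover have "x \<in> C" using a0 by (auto simp: C_def intro!: image_eqI[of _ _ 0])
    ultimately show ?thesis using inj by (simp add: pointed_subsets_def C_def card_image)
  qed
  then have C': "x \<in> C" "C \<subseteq> X" "card C = Suc k" by (auto simp: pointed_subsets_def)
  have Cgood: "C - {x} \<subseteq> g ` C"
  proof
    fix y assume "y \<in> C - {x}"
    then obtain i where i: "i \<le> k" "y = a i" "i \<noteq> 0" using a0 by (auto simp: C_def)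
    then obtain j where "i = Suc j" using not0_implies_Suc by blast
    then have "y = g (a j)" "j \<le> k" using i ga by auto
    then show "y \<in> g ` C" by (auto simp: C_def)
  qed
  define q where "q = close_perm C x g"
  have q: "q permutes C" unfolding q_def
    using injg finite_subset[OF C'(2) fin] C'(1) Cgood by (rule close_perm_permutesI)
  have qa: "(q ^^ i) x = a i" if "i \<le> k" for i
    using that
  proof (induction i)
    case (Suc i)
    have "a i \<in> C" "a (Suc i) \<in> C" using Suc.prems by (auto simp: C_def)
    then show ?case using Suc by (simp add: q_def close_perm_def ga)
  qed (simp add: a0)
  have "C \<subseteq> orbit q x"
  proof
    fix y assume "y \<in> C"
    then obtain i where i: "i \<le> k" "y = (q ^^ i) x" using qa by (auto simp: C_def)
    have "permutation q" using q finite_subset[OF C'(2) fin] permutation_permutes by blast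
    then show "y \<in> orbit q x" using i(2) by (auto simp: orbit_altdef_permutation)
  qed
  then have "orbit q x = C" using permutes_orbit_subset[OF q C'(1)] by blast
  then have "cyclic_on q C" using C'(1) by (metis cyclic_on_singleI)
  then have "sign q = (-1) ^ k" using sign_cyclic q C'(3) by fastforce
  then have hC: "hook C x g = (-1) ^ k" using q by (simp add: hook_def q_def)
  have h0: "hook B x g = 0" if B: "B \<in> pointed_subsets X x k" "B \<noteq> C" for B
  proof (rule ccontr)
    assume "hook B x g \<noteq> 0"
    then have "B - {x} \<subseteq> g ` B" using close_perm_permutesD[of B x g] by (auto simp: hook_def split: if_splits)
    moreover have "B \<subseteq> X" "card B = card C" using B(1) C'(3) by (auto simp: pointed_subsets_def)
    moreover have "B - orbit g x = C - orbit g x" using O \<open>B \<subseteq> X\<close> C'(2) by auto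
    ultimately have "B = C" using segment_set_eqI[OF fin g(1) _ _ C'(2) Cgood] by blast
    with B(2) show False by contradiction
  qed
  have "(\<Sum>B\<in>pointed_subsets X x k. hook B x g) = (\<Sum>B\<in>{C}. hook B x g)"
    using C h0 finite_pointed_subsets[OF fin] by (intro sum.mono_neutral_right) auto
  then show ?thesis using hC by simp
qed

text \<open>The adjoined cycle is closed under \<open>g\<close> and misses \<open>B\<close>, so it
  enters the closed permutation as a separate factor, with the sign from
  \<open>sign_cyclic\<close>.\<close>

lemma hook_Un_orbit:
  assumes X: "finite X" "g permutes X" and B: "B \<subseteq> X" "x \<in> B" and y: "y \<in> X" "B \<inter> orbit g y = {}"
  shows "hook (B \<union> orbit g y) x g = (-1) ^ (card (orbit g y) - 1) * hook B x g"
proof -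
  let ?O = "orbit g y"
  have perm: "permutation g" using X permutation_permutes by blast
  have OX: "?O \<subseteq> X" using X(2) y(1) by (rule permutes_orbit_subset)
  have fin: "finite ?O" "finite B" using OX B X(1) by (auto intro: finite_subset)
  have c: "cyclic_on g ?O" using perm by (rule cyclic_on_orbit')
  define r where "r = perm_restrict g ?O"
  have gO: "g z \<in> ?O \<longleftrightarrow> z \<in> ?O" for z using c X(2) cyclic_on_f_in cyclic_on_inI by metis
  have "bij_betw g ?O ?O"
    using fin gO permutes_inj[OF X(2)] by (intro bij_betw_imageI endo_inj_surj) (auto intro: inj_on_subset)
  then have "bij_betw r ?O ?O" by (rule bij_betw_cong[THEN iffD1, rotated]) (simp add: r_def perm_restrict_def)
  then have r: "r permutes ?O" by (rule bij_imp_permutes) (simp add: r_def perm_restrict_def)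
  then have rU: "r permutes B \<union> ?O" by (rule permutes_subset) blast
  have sr: "sign r = (-1) ^ (card ?O - 1)" using sign_cyclic[OF _ r] c by (simp add: r_def cyclic_on_perm_restrict)
  have eq: "close_perm (B \<union> ?O) x g = close_perm B x g \<circ> r"
  proof
    fix z
    show "close_perm (B \<union> ?O) x g z = (close_perm B x g \<circ> r) z"
      using y(2) gO[of z] by (auto simp: close_perm_def r_def perm_restrict_def)
  qed
  have iff: "close_perm (B \<union> ?O) x g permutes B \<union> ?O \<longleftrightarrow> close_perm B x g permutes B"
  proof -
    have "close_perm B x g permutes B \<union> ?O \<longleftrightarrow> close_perm B x g permutes B"
    proof
      assume "close_perm B x g permutes B \<union> ?O"
      then show "close_perm B x g permutes B"
        by (rule permutes_superset) (auto simp: close_perm_def)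
    qed (rule permutes_subset, auto)
    then show ?thesis unfolding eq permutes_comp_right_iff[OF rU] .
  qed
  show ?thesis
  proof (cases "close_perm B x g permutes B")
    case True
    have "permutation (close_perm B x g)" "permutation r" using True r fin permutation_permutes by blast+
    then show ?thesis using True iff by (simp add: hook_def eq sign_compose sr)
  qed (simp add: hook_def iff)
qed

text \<open>A sign-reversing pairing. If \<open>g\<close> is not a full cycle, some cycle avoids
  \<open>x\<close>, and every supporting \<open>B\<close> contains it or misses it. Adjoining it
  contributes its length to the exponent of the first sign and its length minus one to that of the
  hook, so each pair cancels. For a full cycle each size of \<open>B\<close> contributes 1.\<close>

lemma alternating_sum_hook:
  assumes X: "finite X" "g permutes X" "x \<in> X"
  shows "(\<Sum>B | x \<in> B \<and> B \<subseteq> X. (-1) ^ (card B - 1) * hook B x g) =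
    (if cyclic_on g X then card X else 0)"
proof (cases "cyclic_on g X")
  case True
  have "(\<Sum>B | x \<in> B \<and> B \<subseteq> X. (-1) ^ (card B - 1) * hook B x g) =
      (\<Sum>k<card X. (-1) ^ k * (\<Sum>B\<in>pointed_subsets X x k. hook B x g))"
    unfolding sum_pointed_subsets[OF X(1)] sum_distrib_left
    by (intro sum.cong) (auto simp: pointed_subsets_def)
  also have "\<dots> = (\<Sum>k<card X. 1)"
    by (intro sum.cong) (simp_all add: sum_hook_cyclic[OF X(2) True X(3)] flip: power_mult_distrib)
  finally show ?thesis using True by simp
next
  case False
  have perm: "permutation g" using X permutation_permutes by blast
  have "orbit g x \<noteq> X" using False X(3) cyclic_on_singleI by metis
  moreover have "orbit g x \<subseteq> X" using X permutes_orbit_subset by metis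
  ultimately obtain y where y: "y \<in> X" "y \<notin> orbit g x" by blast
  let ?O = "orbit g y" and ?f = "\<lambda>B. (-1) ^ (card B - 1) * hook B x g"
  have xO: "x \<notin> ?O" using y(2) permutation_self_in_orbit[OF perm] by (metis orbit_swap)
  have yO: "y \<in> ?O" using perm by (rule permutation_self_in_orbit)
  have OX: "?O \<subseteq> X" using X(2) y(1) by (rule permutes_orbit_subset)
  have finO: "finite ?O" using OX X(1) by (rule finite_subset)
  then have cO: "card ?O > 0" using yO by (auto simp: card_gt_0_iff)
  let ?A = "{B. x \<in> B \<and> B \<subseteq> X}"
  let ?L = "{B \<in> ?A. B \<inter> ?O = {}}" and ?M = "{B \<in> ?A. ?O \<subseteq> B}"
  have finA: "finite ?A" using X(1) by (auto intro: finite_subset[of _ "Pow X"])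
  have zero: "?f B = 0" if B: "B \<in> ?A" "B \<notin> ?L \<union> ?M" for B
  proof -
    obtain b where b: "b \<in> B" "b \<in> ?O" using B by auto
    have "orbit g b = ?O" using b(2) cyclic_on_orbit'[OF perm] by (simp add: orbit_cyclic_eq3)
    then have "\<not> B - {x} \<subseteq> g ` B"
      using segment_set_closed[OF X(1,2), of B x b] b(1) xO B by auto
    then have "\<not> close_perm B x g permutes B" using close_perm_permutesD[of B x g] by blast
    then show ?thesis by (simp add: hook_def)
  qed
  have flip: "?f (B \<union> ?O) = - ?f B" if B: "B \<in> ?L" for B
  proof -
    have fB: "finite B" using B X(1) by (auto intro: finite_subset)
    then have cB: "card B > 0" using B by (auto simp: card_gt_0_iff)
    have "card (B \<union> ?O) = card B + card ?O" using B fB finO by (intro card_Un_disjoint) auto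
    then have "card (B \<union> ?O) - 1 = (card B - 1) + Suc (card ?O - 1)" using cB cO by simp
    moreover have "hook (B \<union> ?O) x g = (-1) ^ (card ?O - 1) * hook B x g"
      using B y(1) by (intro hook_Un_orbit[OF X(1,2)]) auto
    ultimately show ?thesis by (simp add: power_add flip: power_mult_distrib)
  qed
  have "sum ?f ?A = sum ?f (?L \<union> ?M)"
  proof (rule sum.mono_neutral_right[OF finA])
    show "?L \<union> ?M \<subseteq> ?A" by auto
    show "\<forall>B\<in>?A - (?L \<union> ?M). ?f B = 0"
    proof
      fix B assume B: "B \<in> ?A - (?L \<union> ?M)"
      show "?f B = 0" using B by (intro zero) (simp_all only: Diff_iff not_False_eq_True)
    qed
  qed
  also have "\<dots> = sum ?f ?L + sum ?f ?M"
  proof (rule sum.union_disjoint)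
    show "finite ?L" "finite ?M" by (rule finite_subset[OF _ finA]; blast)+
    show "?L \<inter> ?M = {}"
    proof (rule equals0I)
      fix B assume "B \<in> ?L \<inter> ?M"
      then have "B \<inter> ?O = {}" "?O \<subseteq> B" by simp_all
      then show False using yO by blast
    qed
  qed
  also have "sum ?f ?M = (\<Sum>B\<in>?L. ?f (B \<union> ?O))"
    by (rule sum.reindex_bij_witness[of _ "\<lambda>B. B \<union> ?O" "\<lambda>B. B - ?O"])
       (use OX xO in \<open>auto simp: Un_absorb2\<close>)
  also have "\<dots> = - sum ?f ?L" using flip by (simp add: sum_negf)
  finally show ?thesis using False by simp
qed

text \<open>Summing \<open>alternating_sum_hook\<close> over all \<open>g\<close> counts full
  cycles. A transposition inside \<open>B\<close> that moves \<open>x\<close> shows that the total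
  of \<open>hook B x\<close> vanishes, so only \<open>B = {x}\<close> survives, where the hook is
  constantly 1.\<close>

lemma card_cyclic:
  assumes X: "finite X" "X \<noteq> {}"
  shows "card {g. g permutes X \<and> cyclic_on g X} = fact (card X - 1)"
proof -
  obtain x where x: "x \<in> X" using X(2) by blast
  have fS: "finite {g. g permutes X}" using X(1) by (rule finite_permutations)
  have z: "(\<Sum>g | g permutes X. hook B x g) = 0" if B: "x \<in> B" "B \<subseteq> X" "B \<noteq> {x}" for B
  proof -
    obtain y where y: "y \<in> B" "y \<noteq> x" using B by blast
    let ?t = "Transposition.transpose x y"
    have t: "?t permutes B" using B(1) y(1) by (rule permutes_swap_id)
    have tX: "?t permutes X" using t B(2) by (rule permutes_subset)
    have "(\<Sum>g | g permutes X. hook B x g) = (\<Sum>g | g permutes X. hook B x (g \<circ> ?t))"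
      using sum_permutations_compose_right[OF tX, of "hook B x"] by simp
    also have "\<dots> = - (\<Sum>g | g permutes X. hook B x g)"
      using hook_right[OF finite_subset[OF B(2) X(1)] t] y(2) by (simp add: sign_swap_id sum_negf)
    finally show ?thesis by simp
  qed
  have one: "hook {x} x g = 1" for g :: "'a \<Rightarrow> 'a"
  proof -
    have "close_perm {x} x g = id" by (auto simp: close_perm_def)
    then show ?thesis by (simp add: hook_def permutes_id)
  qed
  have "real (card X) * card {g. g permutes X \<and> cyclic_on g X} =
      (\<Sum>g | g permutes X. if cyclic_on g X then card X else 0)"
    using fS by (simp add: sum.If_cases Int_def)
  also have "\<dots> = (\<Sum>g | g permutes X. \<Sum>B | x \<in> B \<and> B \<subseteq> X. (-1) ^ (card B - 1) * hook B x g)"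
    using alternating_sum_hook[OF X(1) _ x] by (simp add: of_nat_sum)
  also have "\<dots> = (\<Sum>B | x \<in> B \<and> B \<subseteq> X. (-1) ^ (card B - 1) * (\<Sum>g | g permutes X. hook B x g))"
    unfolding sum_distrib_left by (rule sum.swap)
  also have "\<dots> = (\<Sum>B\<in>{{x}}. (-1) ^ (card B - 1) * (\<Sum>g | g permutes X. hook B x g))"
    using X(1) x z by (intro sum.mono_neutral_right) (auto intro: finite_subset[of _ "Pow X"])
  also have "\<dots> = fact (card X)" using one X(1) by (simp add: card_permutations)
  also have "\<dots> = real (card X) * fact (card X - 1)"
    using X by (simp add: fact_reduce card_gt_0_iff)
  finally have "real (card X) * card {g. g permutes X \<and> cyclic_on g X} = real (card X) * fact (card X - 1)" .
  then have "real (card {g. g permutes X \<and> cyclic_on g X}) = fact (card X - 1)" using X by simp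
  then show ?thesis by (metis of_nat_eq_iff of_nat_fact)
qed

section \<open>Products of a random full cycle and a random conjugate\<close>

definition cycle_density :: "'a set \<Rightarrow> ('a \<Rightarrow> 'a) \<Rightarrow> real" where
  "cycle_density X g = (if g permutes X \<and> cyclic_on g X then 1 / fact (card X - 1) else 0)"

lemma cycle_density_nonneg: "cycle_density X g \<ge> 0"
  by (simp add: cycle_density_def)

lemma cycle_density_hook:
  assumes X: "finite X" "g permutes X" "x \<in> X"
  shows "cycle_density X g = (\<Sum>B | x \<in> B \<and> B \<subseteq> X. (-1) ^ (card B - 1) * hook B x g) / fact (card X)"
proof -
  have "card X > 0" using X by (auto simp: card_gt_0_iff)
  then have "(fact (card X) :: real) = real (card X) * fact (card X - 1)" by (rule fact_reduce)
  then show ?thesis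
    using \<open>card X > 0\<close> X(2) unfolding alternating_sum_hook[OF X] cycle_density_def by simp
qed

lemma sum_cycle_density:
  assumes "finite X" "X \<noteq> {}"
  shows "(\<Sum>g | g permutes X. cycle_density X g) = 1"
proof -
  have "(\<Sum>g | g permutes X. cycle_density X g) =
      (\<Sum>g | g permutes X \<and> cyclic_on g X. 1 / fact (card X - 1))"
    using finite_permutations[OF assms(1)]
    by (intro sum.mono_neutral_cong_right) (auto simp: cycle_density_def)
  then show ?thesis using card_cyclic[OF assms] by simp
qed

section \<open>Normalised hook characters\<close>

definition hook_avg :: "'a set \<Rightarrow> 'a set \<Rightarrow> 'a \<Rightarrow> ('a \<Rightarrow> 'a) \<Rightarrow> real" where
  "hook_avg X B x t = (\<Sum>s | s permutes X. hook B x (conj_perm s t)) / fact (card X)"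

text \<open>This is the hook character at \<open>t\<close> divided by its degree. By
  \<open>hook_avg_eq_mean\<close> all summands agree; the mean over \<open>B\<close> is taken
  because the sum over \<open>B\<close>, unlike a single term, is controlled by
  \<open>abs_sum_hook_le\<close>.\<close>

definition hook_mean :: "'a set \<Rightarrow> 'a \<Rightarrow> nat \<Rightarrow> ('a \<Rightarrow> 'a) \<Rightarrow> real" where
  "hook_mean X x k t = (\<Sum>B\<in>pointed_subsets X x k. hook_avg X B x t) / ((card X - 1) choose k)"

lemma hook_avg_eq_mean:
  assumes X: "finite X" "x \<in> X" and B: "B \<in> pointed_subsets X x k"
  shows "hook_avg X B x t = hook_mean X x k t"
proof -
  have "hook_avg X B' x t = hook_avg X B x t" if "B' \<in> pointed_subsets X x k" for B'
    using that B hook_conj_sum_cong_card[OF X(1), of x B' B t]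
    by (simp add: hook_avg_def pointed_subsets_def)
  then have "(\<Sum>B'\<in>pointed_subsets X x k. hook_avg X B' x t) =
      ((card X - 1) choose k) * hook_avg X B x t"
    using card_pointed_subsets[OF X] by simp
  moreover have "((card X - 1) choose k) \<noteq> 0"
    using B finite_pointed_subsets[OF X(1)] card_pointed_subsets[OF X, of k] by (metis card_0_eq empty_iff)
  ultimately show ?thesis by (simp add: hook_mean_def)
qed

lemma card_orbits_conj_perm:
  assumes "s permutes X"
  shows "card (orbit (conj_perm s t) ` X) = card (orbit t ` X)"
proof -
  have bs: "bij s" using assms by (rule permutes_bij)
  have "orbit (conj_perm s t) ` X = orbit (conj_perm s t) ` s ` X"
    using assms by (simp add: permutes_image)
  also have "\<dots> = (`) s ` orbit t ` X" by (simp add: image_image orbit_conj_perm[OF bs])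
  finally have "orbit (conj_perm s t) ` X = (`) s ` orbit t ` X" .
  moreover have "inj_on ((`) s) (orbit t ` X)"
    using bs by (intro inj_onI) (simp add: bij_is_inj inj_image_eq_iff)
  ultimately show ?thesis by (simp add: card_image)
qed

lemma abs_hook_mean_le:
  assumes X: "finite X" "x \<in> X" and t: "t permutes X"
  shows "\<bar>hook_mean X x k t\<bar> \<le>
    binomial_sum (card (orbit t ` X) - 1) (min k (card X - 1 - k)) / ((card X - 1) choose k)"
proof -
  let ?b = "binomial_sum (card (orbit t ` X) - 1) (min k (card X - 1 - k))"
  have "(\<Sum>B\<in>pointed_subsets X x k. hook_avg X B x t) =
      (\<Sum>s | s permutes X. \<Sum>B\<in>pointed_subsets X x k. hook B x (conj_perm s t)) / fact (card X)"
    unfolding hook_avg_def sum_divide_distrib by (rule sum.swap)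
  also have "\<bar>\<dots>\<bar> \<le> (\<Sum>s | s permutes X. real ?b) / fact (card X)"
  proof -
    have "\<bar>\<Sum>s | s permutes X. \<Sum>B\<in>pointed_subsets X x k. hook B x (conj_perm s t)\<bar> \<le>
        (\<Sum>s | s permutes X. \<bar>\<Sum>B\<in>pointed_subsets X x k. hook B x (conj_perm s t)\<bar>)"
      by (rule sum_abs)
    also have "\<dots> \<le> (\<Sum>s | s permutes X. real ?b)"
    proof (rule sum_mono)
      fix s assume "s \<in> {s. s permutes X}"
      then show "\<bar>\<Sum>B\<in>pointed_subsets X x k. hook B x (conj_perm s t)\<bar> \<le> real ?b"
        using abs_sum_hook_le[OF X(1) conj_perm_permutes_same[OF _ t] X(2), of s k]
        by (simp add: card_orbits_conj_perm)
    qed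
    finally show ?thesis by (simp add: divide_right_mono)
  qed
  also have "\<dots> = real ?b" using X(1) by (simp add: card_permutations)
  finally show ?thesis unfolding hook_mean_def by (simp add: divide_right_mono)
qed

text \<open>The new term is \<open>(a - k) / Suc k\<close> times the last one, hence at most that
  multiple of the whole previous sum. The maximum is \<open>Suc k + (a - k)\<close> under truncated
  subtraction.\<close>

lemma binomial_sum_Suc:
  "Suc k * binomial_sum a (Suc k) \<le> max (Suc a) (Suc k) * binomial_sum a k"
proof -
  have "Suc k * (a choose Suc k) = (a - k) * (a choose k)"
    by (metis Suc_times_binomial_eq Suc_times_binomial binomial_absorb_comp binomial_absorption)
  also have "\<dots> \<le> (a - k) * binomial_sum a k"
    unfolding binomial_sum_def by (intro mult_left_mono member_le_sum) auto
  finally have "Suc k * binomial_sum a (Suc k) \<le> (Suc k + (a - k)) * binomial_sum a k"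
    by (simp add: binomial_sum_def algebra_simps)
  also have "Suc k + (a - k) = max (Suc a) (Suc k)" by simp
  finally show ?thesis .
qed

text \<open>Equality holds at \<open>k = 1\<close>, which fixes the constant. From \<open>k\<close>
  to \<open>Suc k\<close> the right side grows by \<open>(n - k) / Suc k\<close> and the left by at
  most \<open>max (Suc a) (Suc k) / Suc k\<close>; both entries of the maximum are at most
  \<open>n / 2\<close>, hence at most \<open>n - k\<close>.\<close>

lemma binomial_sum_le:
  assumes "1 \<le> k" "2 * k \<le> n" "2 * Suc a \<le> n"
  shows "n * binomial_sum a k \<le> Suc a * (n choose k)"
  using assms(1,2)
proof (induction k rule: dec_induct)
  case base
  show ?case by (simp add: binomial_sum_def)
next
  case (step k)
  have "Suc k * (n * binomial_sum a (Suc k)) = n * (Suc k * binomial_sum a (Suc k))" by (rule mult.left_commute)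
  also have "\<dots> \<le> n * ((n - k) * binomial_sum a k)"
  proof -
    have "max (Suc a) (Suc k) \<le> n - k" using step.prems assms(3) by simp
    then have "max (Suc a) (Suc k) * binomial_sum a k \<le> (n - k) * binomial_sum a k" by (rule mult_le_mono1)
    then show ?thesis using binomial_sum_Suc[of k a] by (intro mult_le_mono2) linarith
  qed
  also have "\<dots> = (n - k) * (n * binomial_sum a k)" by simp
  also have "\<dots> \<le> (n - k) * (Suc a * (n choose k))" using step.IH step.prems by (intro mult_le_mono2) simp
  also have "\<dots> = Suc a * ((n - k) * (n choose k))" by (rule mult.left_commute)
  also have "(n - k) * (n choose k) = Suc k * (n choose Suc k)"
    by (metis binomial_absorb_comp binomial_absorption)
  also have "Suc a * (Suc k * (n choose Suc k)) = Suc k * (Suc a * (n choose Suc k))" by (rule mult.left_commute)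
  finally show ?case by (simp only: mult_le_cancel1)
qed

lemma abs_hook_mean_le_cycles:
  assumes X: "finite X" "x \<in> X" and t: "t permutes X"
    and k: "1 \<le> k" "k < card X - 1" and c: "2 * card (orbit t ` X) \<le> card X - 1"
  shows "\<bar>hook_mean X x k t\<bar> \<le> real (card (orbit t ` X)) / real (card X - 1)"
proof -
  define n where "n = card X - 1"
  define a where "a = card (orbit t ` X) - 1"
  have "card (orbit t ` X) > 0" using X by (auto simp: card_gt_0_iff)
  then have a: "card (orbit t ` X) = Suc a" by (simp add: a_def)
  \<comment> \<open>By symmetry of the binomial coefficient \<open>k\<close> may be replaced by its
    distance \<open>?j\<close> to the nearer end, which lies in the range of
    \<open>binomial_sum_le\<close>.\<close>
  let ?j = "min k (n - k)"
  have "n choose k = n choose ?j"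
    using k binomial_symmetric[of k n] by (cases "k \<le> n - k") (simp_all add: n_def)
  moreover have "n * binomial_sum a ?j \<le> Suc a * (n choose ?j)"
    by (rule binomial_sum_le) (use k c a in \<open>auto simp: n_def\<close>)
  ultimately have "n * binomial_sum a ?j \<le> Suc a * (n choose k)" by simp
  then have "real n * binomial_sum a ?j \<le> real (Suc a) * (n choose k)"
    by (simp only: of_nat_mult[symmetric] of_nat_le_iff)
  moreover have "n choose k > 0" "n > 0" using k by (auto simp: n_def)
  ultimately have "binomial_sum a ?j / (n choose k) \<le> real (Suc a) / n"
    by (simp add: divide_simps mult.commute)
  then show ?thesis
    using abs_hook_mean_le[OF X t, of k] unfolding a n_def[symmetric] by simp
qed

text \<open>The one-row hook is the trivial character. Together with the one-column hook, the sign
  character of \<open>hook_mean_top\<close>, it forms the part that \<open>parity_density\<close>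
  accounts for.\<close>

lemma hook_mean_0:
  assumes X: "finite X" "x \<in> X" shows "hook_mean X x 0 t = 1"
proof -
  have "close_perm {x} x g = id" for g :: "'a \<Rightarrow> 'a" by (auto simp: close_perm_def)
  then have "hook_avg X {x} x t = 1"
    using X by (simp add: hook_avg_def hook_def permutes_id card_permutations)
  moreover have "{x} \<in> pointed_subsets X x 0" using X by (simp add: pointed_subsets_def)
  ultimately show ?thesis using hook_avg_eq_mean[OF X] by metis
qed

lemma hook_mean_top:
  assumes X: "finite X" "x \<in> X" and t: "t permutes X"
  shows "hook_mean X x (card X - 1) t = of_int (sign t)"
proof -
  have h: "hook X x (conj_perm s t) = of_int (sign t)" if s: "s permutes X" for s
  proof -
    let ?g = "conj_perm s t"
    have g: "?g permutes X" using s t by (rule conj_perm_permutes_same)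
    then have "close_perm X x ?g = ?g"
      by (auto simp: close_perm_def fun_eq_iff permutes_in_image permutes_not_in)
    moreover have "sign ?g = sign t"
      using s t X(1) by (meson permutation_permutes sign_conj_perm)
    ultimately show ?thesis using g by (simp add: hook_def)
  qed
  then have "hook_avg X X x t = of_int (sign t)"
    using X by (simp add: hook_avg_def card_permutations)
  moreover have "card X > 0" using X by (auto simp: card_gt_0_iff)
  then have "X \<in> pointed_subsets X x (card X - 1)" using X by (simp add: pointed_subsets_def)
  ultimately show ?thesis using hook_avg_eq_mean[OF X] by metis
qed

text \<open>
  The law of \<open>\<zeta> \<circ> conj_perm s t\<close> for independent uniform \<open>\<zeta>\<close> among the full cycles on \<open>X\<close> and \<open>s\<close>
  among the permutations of \<open>X\<close>.
\<close>

definition product_density :: "'a set \<Rightarrow> ('a \<Rightarrow> 'a) \<Rightarrow> ('a \<Rightarrow> 'a) \<Rightarrow> real" where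
  "product_density X t a =
    (\<Sum>s | s permutes X. cycle_density X (a \<circ> conj_perm s (inv t))) / fact (card X)"

lemma product_density_nonneg: "product_density X t a \<ge> 0"
  by (simp add: product_density_def sum_nonneg cycle_density_nonneg)

text \<open>The law of a full cycle is a combination of hook functions, evaluated here at
  \<open>a \<circ> conj_perm s (inv t)\<close>; averaging over \<open>s\<close> pulls a scalar out
  of each by \<open>hook_conj_sum\<close>.\<close>

lemma product_density_hook:
  assumes X: "finite X" "x \<in> X" and t: "t permutes X" and a: "a permutes X"
  shows "product_density X t a =
    (\<Sum>B | x \<in> B \<and> B \<subseteq> X. (-1) ^ (card B - 1) * hook_avg X B x (inv t) * hook B x a) / fact (card X)"
proof -
  have "(\<Sum>s | s permutes X. cycle_density X (a \<circ> conj_perm s (inv t))) =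
      (\<Sum>s | s permutes X. (\<Sum>B | x \<in> B \<and> B \<subseteq> X.
        (-1) ^ (card B - 1) * hook B x (a \<circ> conj_perm s (inv t))) / fact (card X))"
  proof (rule sum.cong)
    fix s assume "s \<in> {s. s permutes X}"
    then have "a \<circ> conj_perm s (inv t) permutes X"
      using a t by (simp add: conj_perm_permutes_same permutes_compose permutes_inv)
    then show "cycle_density X (a \<circ> conj_perm s (inv t)) = (\<Sum>B | x \<in> B \<and> B \<subseteq> X.
        (-1) ^ (card B - 1) * hook B x (a \<circ> conj_perm s (inv t))) / fact (card X)"
      using X by (intro cycle_density_hook)
  qed simp
  also have "\<dots> = (\<Sum>s | s permutes X. \<Sum>B | x \<in> B \<and> B \<subseteq> X.
        (-1) ^ (card B - 1) * hook B x (a \<circ> conj_perm s (inv t))) / fact (card X)"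
    by (simp only: sum_divide_distrib)
  also have "\<dots> = (\<Sum>B | x \<in> B \<and> B \<subseteq> X. (-1) ^ (card B - 1) *
      (\<Sum>s | s permutes X. hook B x (a \<circ> conj_perm s (inv t)))) / fact (card X)"
    unfolding sum_distrib_left by (subst sum.swap) (rule refl)
  also have "\<dots> = (\<Sum>B | x \<in> B \<and> B \<subseteq> X. (-1) ^ (card B - 1) *
      (hook B x a * (fact (card X) * hook_avg X B x (inv t)))) / fact (card X)"
  proof -
    have "(\<Sum>s | s permutes X. hook B x (a \<circ> conj_perm s (inv t))) =
        hook B x a * (fact (card X) * hook_avg X B x (inv t))" if "B \<in> {B. x \<in> B \<and> B \<subseteq> X}" for B
      using that hook_conj_sum[OF X(1) _ _ a, of x B "inv t"] by (simp add: hook_avg_def)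
    then show ?thesis by (metis (no_types, lifting) sum.cong)
  qed
  also have "\<dots> = (\<Sum>B | x \<in> B \<and> B \<subseteq> X. (-1) ^ (card B - 1) * hook_avg X B x (inv t) * hook B x a)"
    unfolding sum_divide_distrib by (intro sum.cong) simp_all
  finally show ?thesis by (simp add: product_density_def)
qed

text \<open>For each \<open>s\<close>, substituting \<open>a = b \<circ> conj_perm s t\<close>
  separates the cycle from the conjugate: the left side is the mean of \<open>f\<close> over the two
  independent factors.\<close>

lemma sum_product_density_mult:
  assumes X: "finite X" and t: "t permutes X"
  shows "(\<Sum>a | a permutes X. product_density X t a * f a) =
    (\<Sum>b | b permutes X. cycle_density X b * ((\<Sum>s | s permutes X. f (b \<circ> conj_perm s t)) / fact (card X)))"
proof -
  have "(\<Sum>a | a permutes X. product_density X t a * f a) =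
      (\<Sum>a | a permutes X. \<Sum>s | s permutes X. cycle_density X (a \<circ> conj_perm s (inv t)) * f a / fact (card X))"
    by (simp add: product_density_def sum_divide_distrib sum_distrib_right)
  also have "\<dots> = (\<Sum>s | s permutes X. \<Sum>a | a permutes X. cycle_density X (a \<circ> conj_perm s (inv t)) * f a / fact (card X))"
    by (rule sum.swap)
  also have "\<dots> = (\<Sum>s | s permutes X. \<Sum>b | b permutes X. cycle_density X b * f (b \<circ> conj_perm s t) / fact (card X))"
  proof (rule sum.cong)
    fix s assume "s \<in> {s. s permutes X}"
    then have s: "s permutes X" by simp
    have q: "conj_perm s t permutes X" using s t by (rule conj_perm_permutes_same)
    have "conj_perm s t \<circ> conj_perm s (inv t) = conj_perm s (t \<circ> inv t)"
      using permutes_bij[OF s] by (simp add: conj_perm_comp)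
    also have "\<dots> = id"
      using permutes_inv_o(1)[OF t] permutes_inv_o(1)[OF s] by (simp add: conj_perm_def)
    finally have *: "(b \<circ> conj_perm s t) \<circ> conj_perm s (inv t) = b" for b
      by (simp add: comp_assoc)
    show "(\<Sum>a | a permutes X. cycle_density X (a \<circ> conj_perm s (inv t)) * f a / fact (card X)) =
        (\<Sum>b | b permutes X. cycle_density X b * f (b \<circ> conj_perm s t) / fact (card X))"
      by (subst sum_permutations_compose_right[OF q]) (simp only: *)
  qed simp
  also have "\<dots> = (\<Sum>b | b permutes X. \<Sum>s | s permutes X. cycle_density X b * f (b \<circ> conj_perm s t) / fact (card X))"
    by (rule sum.swap)
  also have "\<dots> = (\<Sum>b | b permutes X. cycle_density X b * ((\<Sum>s | s permutes X. f (b \<circ> conj_perm s t)) / fact (card X)))"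
    by (simp add: sum_divide_distrib sum_distrib_left)
  finally show ?thesis .
qed

lemma sum_product_density:
  assumes "finite X" "X \<noteq> {}" "t permutes X"
  shows "(\<Sum>a | a permutes X. product_density X t a) = 1"
  using sum_product_density_mult[OF assms(1,3), of "\<lambda>_. 1"] sum_cycle_density[OF assms(1,2)] assms(1)
  by (simp add: card_permutations)

lemma sum_product_density_sign:
  assumes X: "finite X" "X \<noteq> {}" and t: "t permutes X"
  shows "(\<Sum>a | a permutes X. product_density X t a * of_int (sign a)) = (-1) ^ (card X - 1) * of_int (sign t)"
proof -
  have "cycle_density X b * ((\<Sum>s | s permutes X. of_int (sign (b \<circ> conj_perm s t))) / fact (card X)) =
      cycle_density X b * ((-1) ^ (card X - 1) * of_int (sign t))" if b: "b permutes X" for b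
  proof (cases "cyclic_on b X")
    case True
    have "sign (b \<circ> conj_perm s t) = (-1) ^ (card X - 1) * sign t" if s: "s permutes X" for s
    proof -
      have p: "permutation b" "permutation s" "permutation t" "permutation (conj_perm s t)"
        using b s t conj_perm_permutes_same[OF s t] X(1) permutation_permutes by blast+
      then show ?thesis using sign_cyclic[OF True b] by (simp add: sign_compose sign_conj_perm)
    qed
    then show ?thesis using X(1) by (simp add: card_permutations)
  qed (simp add: cycle_density_def)
  then have "(\<Sum>a | a permutes X. product_density X t a * of_int (sign a)) =
      (\<Sum>b | b permutes X. cycle_density X b * ((-1) ^ (card X - 1) * of_int (sign t)))"
    unfolding sum_product_density_mult[OF X(1) t] by (intro sum.cong) auto
  then show ?thesis using sum_cycle_density[OF X] by (simp add: sum_distrib_right[symmetric])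
qed

text \<open>A Plancherel identity. One factor of the square is expanded in hooks, which brings in
  the scalars of \<open>inv t\<close>; the other is read as a law, and its average over conjugates
  of \<open>t\<close> brings in the second scalar. What remains is a hook sum at a full cycle, equal
  to \<open>(-1) ^ k\<close>, and it cancels the sign of the expansion.\<close>

lemma sum_product_density_sq:
  assumes X: "finite X" "x \<in> X" and t: "t permutes X"
  shows "fact (card X) * (\<Sum>a | a permutes X. (product_density X t a)\<^sup>2) =
    (\<Sum>k<card X. hook_mean X x k (inv t) * hook_mean X x k t)"
proof -
  let ?m = "\<lambda>k. hook_mean X x k (inv t) * hook_mean X x k t"
  have inner: "(\<Sum>s | s permutes X. product_density X t (b \<circ> conj_perm s t)) =
      (\<Sum>k<card X. (-1) ^ k * ?m k * (\<Sum>B\<in>pointed_subsets X x k. hook B x b))" if b: "b permutes X" for b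
  proof -
    have "(\<Sum>s | s permutes X. product_density X t (b \<circ> conj_perm s t)) =
        (\<Sum>s | s permutes X. \<Sum>B | x \<in> B \<and> B \<subseteq> X.
          (-1) ^ (card B - 1) * hook_avg X B x (inv t) * hook B x (b \<circ> conj_perm s t) / fact (card X))"
    proof (rule sum.cong)
      fix s assume "s \<in> {s. s permutes X}"
      then have "b \<circ> conj_perm s t permutes X"
        using b t by (simp add: conj_perm_permutes_same permutes_compose)
      then show "product_density X t (b \<circ> conj_perm s t) = (\<Sum>B | x \<in> B \<and> B \<subseteq> X.
          (-1) ^ (card B - 1) * hook_avg X B x (inv t) * hook B x (b \<circ> conj_perm s t) / fact (card X))"
        using product_density_hook[OF X t] by (simp add: sum_divide_distrib)
    qed simp
    also have "\<dots> = (\<Sum>B | x \<in> B \<and> B \<subseteq> X. \<Sum>s | s permutes X.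
          (-1) ^ (card B - 1) * hook_avg X B x (inv t) * hook B x (b \<circ> conj_perm s t) / fact (card X))"
      by (rule sum.swap)
    also have "\<dots> = (\<Sum>B | x \<in> B \<and> B \<subseteq> X.
          (-1) ^ (card B - 1) * hook_avg X B x (inv t) * hook_avg X B x t * hook B x b)"
    proof (rule sum.cong)
      fix B assume "B \<in> {B. x \<in> B \<and> B \<subseteq> X}"
      then have "(\<Sum>s | s permutes X. hook B x (b \<circ> conj_perm s t)) = hook B x b * (hook_avg X B x t * fact (card X))"
        using hook_conj_sum[OF X(1) _ _ b, of x B t] by (simp add: hook_avg_def)
      then show "(\<Sum>s | s permutes X.
          (-1) ^ (card B - 1) * hook_avg X B x (inv t) * hook B x (b \<circ> conj_perm s t) / fact (card X)) =
          (-1) ^ (card B - 1) * hook_avg X B x (inv t) * hook_avg X B x t * hook B x b"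
        by (simp add: sum_divide_distrib[symmetric] sum_distrib_left[symmetric])
    qed simp
    also have "\<dots> = (\<Sum>k<card X. (-1) ^ k * ?m k * (\<Sum>B\<in>pointed_subsets X x k. hook B x b))"
      unfolding sum_pointed_subsets[OF X(1)] sum_distrib_left
    proof (intro sum.cong refl)
      fix k B assume B: "B \<in> pointed_subsets X x k"
      then have "card B - 1 = k" by (simp add: pointed_subsets_def)
      then show "(-1) ^ (card B - 1) * hook_avg X B x (inv t) * hook_avg X B x t * hook B x b =
          (-1) ^ k * ?m k * hook B x b"
        using hook_avg_eq_mean[OF X B] by simp
    qed
    finally show ?thesis .
  qed
  have "cycle_density X b * ((\<Sum>s | s permutes X. product_density X t (b \<circ> conj_perm s t)) / fact (card X)) =
      cycle_density X b * ((\<Sum>k<card X. ?m k) / fact (card X))" if b: "b permutes X" for b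
  proof (cases "cyclic_on b X")
    case True
    have "(\<Sum>k<card X. (-1) ^ k * ?m k * (\<Sum>B\<in>pointed_subsets X x k. hook B x b)) = (\<Sum>k<card X. ?m k)"
      using sum_hook_cyclic[OF b True X(2)]
      by (intro sum.cong) (simp_all add: mult.commute mult.assoc flip: power_mult_distrib)
    then show ?thesis using inner[OF b] by simp
  qed (simp add: cycle_density_def)
  then have "(\<Sum>a | a permutes X. product_density X t a * product_density X t a) =
      (\<Sum>b | b permutes X. cycle_density X b * ((\<Sum>k<card X. ?m k) / fact (card X)))"
    unfolding sum_product_density_mult[OF X(1) t] by (intro sum.cong) auto
  also have "\<dots> = (\<Sum>b | b permutes X. cycle_density X b) * ((\<Sum>k<card X. ?m k) / fact (card X))"
    by (rule sum_distrib_right[symmetric])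
  also have "(\<Sum>b | b permutes X. cycle_density X b) = 1"
    using X(2) by (intro sum_cycle_density[OF X(1)]) blast
  finally show ?thesis by (simp add: power2_eq_square)
qed

section \<open>Distance of the product law from the uniform law on its parity class\<close>

lemma sum_sign_eq_0:
  assumes "finite X" "card X \<ge> 2"
  shows "(\<Sum>a | a permutes X. of_int (sign a) :: real) = 0"
proof -
  obtain y z where yz: "y \<in> X" "z \<in> X" "y \<noteq> z"
    using assms by (metis One_nat_def Suc_1 card_le_Suc0_iff_eq not_less_eq_eq)
  let ?t = "Transposition.transpose y z"
  have t: "?t permutes X" using yz(1,2) by (rule permutes_swap_id)
  have "(\<Sum>a | a permutes X. of_int (sign a) :: real) = (\<Sum>a | a permutes X. of_int (sign (a \<circ> ?t)))"
    by (rule sum_permutations_compose_right[OF t])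
  also have "\<dots> = (\<Sum>a | a permutes X. - of_int (sign a))"
  proof (intro sum.cong refl)
    fix a assume "a \<in> {a. a permutes X}"
    then have "permutation a" using assms(1) permutation_permutes by blast
    then show "(of_int (sign (a \<circ> ?t)) :: real) = - of_int (sign a)"
      using yz(3) by (simp add: sign_compose permutation_swap_id sign_swap_id)
  qed
  finally show ?thesis by (simp add: sum_negf)
qed

text \<open>The numerator is 2 or 0. For \<open>card X \<ge> 2\<close> this is the uniform law on
  the permutations with the sign of a full cycle times a conjugate of \<open>t\<close>.\<close>

definition parity_density :: "'a set \<Rightarrow> ('a \<Rightarrow> 'a) \<Rightarrow> ('a \<Rightarrow> 'a) \<Rightarrow> real" where
  "parity_density X t a = (1 + (-1) ^ (card X - 1) * of_int (sign t) * of_int (sign a)) / fact (card X)"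

lemma parity_density_nonneg: "parity_density X t a \<ge> 0"
proof -
  have "\<bar>(-1) ^ (card X - 1) * of_int (sign t) * of_int (sign a) :: real\<bar> = 1"
    by (simp add: abs_mult sign_def)
  then show ?thesis by (auto simp: parity_density_def abs_if split: if_splits)
qed

lemma sum_parity_density:
  assumes "finite X" "card X \<ge> 2" shows "(\<Sum>a | a permutes X. parity_density X t a) = 1"
proof -
  have "(\<Sum>a | a permutes X. 1 + (-1) ^ (card X - 1) * of_int (sign t) * of_int (sign a) :: real) = fact (card X)"
    using sum_sign_eq_0[OF assms] assms(1)
    by (simp add: sum.distrib sum_distrib_left[symmetric] card_permutations)
  then show ?thesis by (simp add: parity_density_def sum_divide_distrib[symmetric])
qed

text \<open>After expanding the square, the cross term involves the product law only through its
  mass and its mean sign. The net effect is to subtract 2, which is exactly the contribution of the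
  trivial and the sign character, \<open>k = 0\<close> and \<open>k = card X - 1\<close>.\<close>

lemma product_density_parity_sq:
  assumes X: "finite X" "x \<in> X" "card X \<ge> 2" and t: "t permutes X"
  shows "fact (card X) * (\<Sum>a | a permutes X. (product_density X t a - parity_density X t a)\<^sup>2) =
    (\<Sum>k\<in>{1..<card X - 1}. hook_mean X x k (inv t) * hook_mean X x k t)"
proof -
  let ?F = "fact (card X) :: real" and ?e = "(-1) ^ (card X - 1) * of_int (sign t) :: real"
  let ?P = "product_density X t"
  have ne: "X \<noteq> {}" using X(2) by blast
  have e2: "?e * ?e = 1" by (simp add: sign_def flip: power_mult_distrib)
  have sq: "(?P a - parity_density X t a)\<^sup>2 =
      (?P a)\<^sup>2 - 2 / ?F * (?P a + ?e * (?P a * of_int (sign a))) + (2 + 2 * ?e * of_int (sign a)) / ?F\<^sup>2" for a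
  proof -
    have s2: "of_int (sign a) * of_int (sign a) = (1::real)" by (simp add: sign_def)
    have "(1 + ?e * of_int (sign a))\<^sup>2 = 1 + 2 * ?e * of_int (sign a) + (?e * ?e) * (of_int (sign a) * of_int (sign a))"
      by (simp add: power2_eq_square algebra_simps)
    then have "(1 + ?e * of_int (sign a))\<^sup>2 = 2 + 2 * ?e * of_int (sign a)" unfolding e2 s2 by simp
    moreover have "(p - u / F)\<^sup>2 = p\<^sup>2 - 2 / F * (p * u) + u\<^sup>2 / F\<^sup>2" for p u F :: real
      by (simp add: power2_diff power_divide)
    ultimately have "(?P a - parity_density X t a)\<^sup>2 = (?P a)\<^sup>2 - 2 / ?F * (?P a * (1 + ?e * of_int (sign a))) +
        (2 + 2 * ?e * of_int (sign a)) / ?F\<^sup>2"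
      unfolding parity_density_def by (simp only:)
    also have "?P a * (1 + ?e * of_int (sign a)) = ?P a + ?e * (?P a * of_int (sign a))"
      by (simp add: algebra_simps)
    finally show ?thesis .
  qed
  have "(\<Sum>a | a permutes X. (?P a - parity_density X t a)\<^sup>2) =
      (\<Sum>a | a permutes X. (?P a)\<^sup>2) - 2 / ?F * (1 + ?e * ?e) + 2 * ?F / ?F\<^sup>2"
  proof -
    have "(\<Sum>a | a permutes X. 2 + 2 * ?e * of_int (sign a)) = 2 * ?F"
      using sum_sign_eq_0[OF X(1,3)] X(1)
      by (simp add: sum.distrib sum_distrib_left[symmetric] card_permutations)
    moreover have "(\<Sum>a | a permutes X. ?P a + ?e * (?P a * of_int (sign a))) = 1 + ?e * ?e"
      using sum_product_density[OF X(1) ne t] sum_product_density_sign[OF X(1) ne t]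
      by (simp only: sum.distrib sum_distrib_left[symmetric])
    ultimately show ?thesis
      unfolding sq sum.distrib sum_subtractf sum_distrib_left[symmetric] sum_divide_distrib[symmetric] by simp
  qed
  also have "\<dots> = (\<Sum>a | a permutes X. (?P a)\<^sup>2) - 2 / ?F"
    unfolding e2 by (simp add: power2_eq_square)
  finally have "?F * (\<Sum>a | a permutes X. (?P a - parity_density X t a)\<^sup>2) =
      ?F * (\<Sum>a | a permutes X. (?P a)\<^sup>2) - 2"
    by (simp add: right_diff_distrib)
  also have "\<dots> = (\<Sum>k<card X. hook_mean X x k (inv t) * hook_mean X x k t) - 2"
    unfolding sum_product_density_sq[OF X(1,2) t] ..
  also have "{..<card X} = insert 0 (insert (card X - 1) {1..<card X - 1})" using X(3) by auto
  also have "(\<Sum>k\<in>\<dots>. hook_mean X x k (inv t) * hook_mean X x k t) =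
      2 + (\<Sum>k\<in>{1..<card X - 1}. hook_mean X x k (inv t) * hook_mean X x k t)"
  proof -
    have "permutation t" using t X(1) permutation_permutes by blast
    then have "hook_mean X x (card X - 1) (inv t) * hook_mean X x (card X - 1) t = 1"
      using hook_mean_top[OF X(1,2) t] hook_mean_top[OF X(1,2) permutes_inv[OF t]]
      by (simp add: sign_inverse) (simp add: sign_def)
    then show ?thesis using X(3) hook_mean_0[OF X(1,2)] by simp
  qed
  finally show ?thesis by simp
qed

lemma product_density_parity_bound:
  assumes X: "finite X" "card X \<ge> 2" and t: "t permutes X"
  shows "(\<Sum>a | a permutes X. \<bar>product_density X t a - parity_density X t a\<bar>)\<^sup>2 \<le>
    8 * card (orbit t ` X) / sqrt (real (card X) - 1)"
proof -
  define n where "n = real (card X) - 1"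
  define c where "c = real (card (orbit t ` X))"
  let ?P = "product_density X t" and ?U = "parity_density X t"
  obtain x where x: "x \<in> X" using X by fastforce
  have n1: "n \<ge> 1" using X(2) by (simp add: n_def)
  have perm: "permutation t" using X(1) t permutation_permutes by blast
  have cpos: "card (orbit t ` X) > 0" using X(1) x by (auto simp: card_gt_0_iff)
  then have c1: "c \<ge> 1" by (simp add: c_def)
  have sn: "sqrt n > 0" "sqrt n * sqrt n = n" using n1 by simp_all
  have "(\<Sum>a | a permutes X. \<bar>?P a - ?U a\<bar>)\<^sup>2 \<le> 8 * c / sqrt n"
  proof (cases "4 * c\<^sup>2 \<le> n")
    case True
    \<comment> \<open>As \<open>c \<ge> 1\<close>, the case assumption also yields
      \<open>2 * c \<le> n\<close>, the range of \<open>abs_hook_mean_le_cycles\<close>.\<close>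
    have "2 * c \<le> 4 * c * c" using c1 mult_mono[of 1 c 1 c] by simp
    then have "2 * c \<le> n" using True by (simp add: power2_eq_square)
    then have cc: "2 * card (orbit t ` X) \<le> card X - 1" using X(2) unfolding c_def n_def by linarith
    have orb: "orbit (inv t) ` X = orbit t ` X" by (simp add: orbit_inv_eq[OF perm])
    have m: "hook_mean X x k (inv t) * hook_mean X x k t \<le> (c / n)\<^sup>2" if "k \<in> {1..<card X - 1}" for k
    proof -
      have n': "real (card X - 1) = n" using X(2) by (simp add: n_def)
      have "\<bar>hook_mean X x k t\<bar> \<le> c / n"
        using abs_hook_mean_le_cycles[OF X(1) x t, of k] that cc unfolding c_def n' by simp
      moreover have "\<bar>hook_mean X x k (inv t)\<bar> \<le> c / n"
        using abs_hook_mean_le_cycles[OF X(1) x permutes_inv[OF t], of k] that cc orb unfolding c_def n' by simp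
      ultimately have "\<bar>hook_mean X x k (inv t)\<bar> * \<bar>hook_mean X x k t\<bar> \<le> c / n * (c / n)"
        using c1 n1 by (intro mult_mono) auto
      then show ?thesis by (simp add: power2_eq_square flip: abs_mult)
    qed
    have "(\<Sum>a | a permutes X. \<bar>?P a - ?U a\<bar>)\<^sup>2 \<le> (\<Sum>a | a permutes X. (?P a - ?U a)\<^sup>2) * fact (card X)"
      using sum_squared_le_sum_of_squares[of "\<lambda>a. \<bar>?P a - ?U a\<bar>" "{a. a permutes X}"] X(1)
      by (simp add: card_permutations)
    also have "\<dots> = (\<Sum>k\<in>{1..<card X - 1}. hook_mean X x k (inv t) * hook_mean X x k t)"
      using product_density_parity_sq[OF X(1) x X(2) t] by (simp only: mult.commute)
    also have "\<dots> \<le> (\<Sum>k\<in>{1..<card X - 1}. (c / n)\<^sup>2)" by (rule sum_mono) (rule m)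
    also have "\<dots> = real (card X - 2) * (c / n)\<^sup>2" by (simp add: numeral_2_eq_2)
    also have "\<dots> \<le> n * (c / n)\<^sup>2" using X(2) by (intro mult_right_mono) (auto simp: n_def)
    also have "\<dots> = (c / sqrt n)\<^sup>2" using n1 by (simp add: power_divide power2_eq_square)
    \<comment> \<open>Here \<open>c / sqrt n\<close> is at most 1, so its square is bounded by
      itself. The factor 8 is dictated by the other case.\<close>
    also have "\<dots> \<le> 8 * (c / sqrt n)"
    proof -
      have "c\<^sup>2 \<le> (sqrt n)\<^sup>2" using True n1 by simp
      then have "c \<le> sqrt n" by (rule power2_le_imp_le) (use sn(1) in simp)
      then have "c / sqrt n \<le> 1" using sn(1) by simp
      then have "c / sqrt n * (c / sqrt n) \<le> 1 * (c / sqrt n)" using c1 sn(1) by (intro mult_right_mono) auto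
      moreover have "c / sqrt n \<ge> 0" using c1 sn(1) by simp
      ultimately show ?thesis by (simp add: power2_eq_square)
    qed
    finally show ?thesis by simp
  next
    case False
    \<comment> \<open>The total masses bound the sum by 2 and its square by 4, and
      \<open>sqrt n \<le> 2 * c\<close> makes \<open>8 * c / sqrt n\<close> at least 4.\<close>
    have "(\<Sum>a | a permutes X. \<bar>?P a - ?U a\<bar>) \<le> (\<Sum>a | a permutes X. ?P a + ?U a)"
    proof (rule sum_mono)
      fix a
      show "\<bar>?P a - ?U a\<bar> \<le> ?P a + ?U a"
        using product_density_nonneg[of X t a] parity_density_nonneg[of X t a] by linarith
    qed
    also have "\<dots> = 2"
      using sum_product_density[OF X(1) _ t] sum_parity_density[OF X, of t] x
      unfolding sum.distrib by fastforce
    finally have "(\<Sum>a | a permutes X. \<bar>?P a - ?U a\<bar>)\<^sup>2 \<le> 2\<^sup>2" by (intro power_mono sum_nonneg) auto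
    also have "2\<^sup>2 \<le> 8 * c / sqrt n"
    proof -
      have "(sqrt n)\<^sup>2 \<le> (2 * c)\<^sup>2" using False n1 by (simp add: power_mult_distrib)
      then have "sqrt n \<le> 2 * c" by (rule power2_le_imp_le) (use c1 in simp)
      then show ?thesis using sn(1) by (simp add: field_simps)
    qed
    finally show ?thesis .
  qed
  then show ?thesis by (simp add: c_def n_def)
qed

section \<open>Rotations and edge schemes\<close>

locale dart_graph =
  fixes G :: "('v, 'a) pre_digraph" and D :: "'v \<Rightarrow> 'd set"
  assumes graph: "graph G" and dart_system: "dart_system G D"
begin

interpretation graph G by (rule graph)

lemma finite_vertices: "finite (verts G)"
  by simp

lemma arcs_endsD:
  assumes "(u, w) \<in> arcs_ends G"
  shows "u \<in> verts G" "w \<in> verts G" "u \<noteq> w" "(w, u) \<in> arcs_ends G"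
proof -
  show "u \<in> verts G" "w \<in> verts G" using assms by (auto simp: arcs_ends_def arc_to_ends_def)
  show "u \<noteq> w" using assms no_loops by (auto simp: arcs_ends_def arc_to_ends_def)
  show "(w, u) \<in> arcs_ends G" using assms sym_arcs by (auto simp: symmetric_def dest: symD)
qed

lemma out_degree_eq_card: "out_degree G u = card {w. (u, w) \<in> arcs_ends G}"
proof -
  have "bij_betw (head G) (out_arcs G u) {w. (u, w) \<in> arcs_ends G}"
  proof (rule bij_betw_imageI)
    show "inj_on (head G) (out_arcs G u)"
      using no_multi_arcs by (auto simp: inj_on_def out_arcs_def arc_to_ends_def)
    show "head G ` out_arcs G u = {w. (u, w) \<in> arcs_ends G}"
      by (auto simp: out_arcs_def arcs_ends_def arc_to_ends_def)
  qed
  then show ?thesis by (simp add: out_degree_def bij_betw_same_card)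
qed

lemma finite_D: "u \<in> verts G \<Longrightarrow> finite (D u)"
  and card_D: "u \<in> verts G \<Longrightarrow> card (D u) = card {w. (u, w) \<in> arcs_ends G}"
  using dart_system by (simp_all add: dart_system_def out_degree_eq_card)

lemma D_disjoint: "u \<in> verts G \<Longrightarrow> w \<in> verts G \<Longrightarrow> x \<in> D u \<Longrightarrow> x \<in> D w \<Longrightarrow> u = w"
  using dart_system unfolding dart_system_def disjoint_family_on_def by blast

lemma dartsI: "u \<in> verts G \<Longrightarrow> x \<in> D u \<Longrightarrow> x \<in> darts G D"
  by (auto simp: darts_def)

lemma dartsE: "x \<in> darts G D \<Longrightarrow> (\<And>u. u \<in> verts G \<Longrightarrow> x \<in> D u \<Longrightarrow> thesis) \<Longrightarrow> thesis"
  by (auto simp: darts_def)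

lemma finite_darts: "finite (darts G D)"
  using finite_D by (simp add: darts_def)

text \<open>Equality of the two counts will turn a map from the darts onto the arcs into a
  bijection. Simplicity of the graph enters through \<open>card_D\<close>.\<close>

lemma card_darts: "card (darts G D) = card (arcs_ends G)"
proof -
  have "card (darts G D) = (\<Sum>u\<in>verts G. card (D u))"
    unfolding darts_def using finite_D D_disjoint by (intro card_UN_disjoint) auto
  also have "\<dots> = (\<Sum>u\<in>verts G. card {w. (u, w) \<in> arcs_ends G})" using card_D by simp
  also have "\<dots> = card (SIGMA u:verts G. {w. (u, w) \<in> arcs_ends G})"
  proof (rule card_SigmaI[symmetric])
    show "\<forall>u\<in>verts G. finite {w. (u, w) \<in> arcs_ends G}"
      using finite_vertices arcs_endsD(2) by (auto intro: finite_subset[of _ "verts G"])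
  qed simp
  also have "(SIGMA u:verts G. {w. (u, w) \<in> arcs_ends G}) = arcs_ends G" using arcs_endsD(1) by auto
  finally show ?thesis .
qed

text \<open>
  By counting, every arc of the graph carries exactly one dart, so an edge scheme identifies the darts
  with the arcs and becomes the reversal of arcs.
\<close>

definition labelling :: "('v \<times> 'v \<Rightarrow> 'd) \<Rightarrow> ('d \<Rightarrow> 'd) \<Rightarrow> bool" where
  "labelling \<phi> E \<longleftrightarrow> bij_betw \<phi> (arcs_ends G) (darts G D) \<and>
    (\<forall>u w. (u, w) \<in> arcs_ends G \<longrightarrow> \<phi> (u, w) \<in> D u \<and> E (\<phi> (u, w)) = \<phi> (w, u))"

lemma labellingD:
  assumes "labelling \<phi> E"
  shows "bij_betw \<phi> (arcs_ends G) (darts G D)"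
    and "(u, w) \<in> arcs_ends G \<Longrightarrow> \<phi> (u, w) \<in> D u"
    and "(u, w) \<in> arcs_ends G \<Longrightarrow> E (\<phi> (u, w)) = \<phi> (w, u)"
  using assms by (auto simp: labelling_def)

lemma labelling_eq_iff:
  assumes "labelling \<phi> E" "a \<in> arcs_ends G" "b \<in> arcs_ends G" shows "\<phi> a = \<phi> b \<longleftrightarrow> a = b"
  by (rule inj_on_eq_iff[OF bij_betw_imp_inj_on[OF labellingD(1)[OF assms(1)]] assms(2,3)])

lemma labellingE:
  assumes "labelling \<phi> E" "u \<in> verts G" "x \<in> D u"
  obtains w where "(u, w) \<in> arcs_ends G" "x = \<phi> (u, w)"
proof -
  have "x \<in> \<phi> ` arcs_ends G" using labellingD(1)[OF assms(1)] dartsI[OF assms(2,3)] by (simp add: bij_betw_def)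
  then obtain a b where ab: "(a, b) \<in> arcs_ends G" "x = \<phi> (a, b)" by auto
  then have "a = u" using D_disjoint[of a u x] labellingD(2)[OF assms(1) ab(1)] arcs_endsD(1)[OF ab(1)] assms(2,3) by simp
  with ab that show thesis by blast
qed

lemma edge_scheme_labelling:
  assumes E: "E \<in> edge_schemes G D"
  obtains \<phi> where "labelling \<phi> E"
proof -
  let ?A = "darts G D"
  have perm: "E permutes ?A" and EE: "E (E x) = x" for x
    using E by (auto simp: edge_schemes_def fun_eq_iff)
  have ex: "\<exists>c. c \<in> (\<lambda>x. {x, E x}) ` ?A \<and> c \<inter> D u \<noteq> {} \<and> c \<inter> D w \<noteq> {}"
    if "(u, w) \<in> arcs_ends G" for u w
    using E that unfolding edge_schemes_def by blast
  define vt where "vt x = (THE u. u \<in> verts G \<and> x \<in> D u)" for x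
  have vt: "vt x = u" if "u \<in> verts G" "x \<in> D u" for x u
    unfolding vt_def by (rule the_equality) (use that D_disjoint in blast)+
  define lab where "lab x = (vt x, vt (E x))" for x
  \<comment> \<open>Only surjectivity onto the arcs is read off the scheme; equal cardinalities then
    exclude both repeated arcs and 2-cycles over non-adjacent vertices.\<close>
  have sub: "arcs_ends G \<subseteq> lab ` ?A"
  proof
    fix e assume "e \<in> arcs_ends G"
    then obtain u w where e: "e = (u, w)" "(u, w) \<in> arcs_ends G" by (cases e) auto
    note uw = arcs_endsD[OF e(2)]
    obtain x where x: "x \<in> ?A" "{x, E x} \<inter> D u \<noteq> {}" "{x, E x} \<inter> D w \<noteq> {}" using ex[OF e(2)] by blast
    have "x \<in> D u \<and> E x \<in> D w \<or> E x \<in> D u \<and> x \<in> D w"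
      using x(2,3) D_disjoint[of u w] uw(1-3) by blast
    then show "e \<in> lab ` ?A"
    proof
      assume "x \<in> D u \<and> E x \<in> D w"
      then have "lab x = e" using e(1) vt uw by (simp add: lab_def)
      then show ?thesis using x(1) by blast
    next
      assume "E x \<in> D u \<and> x \<in> D w"
      then have "lab (E x) = e" using e(1) vt uw EE by (simp add: lab_def)
      then show ?thesis using x(1) permutes_in_image[OF perm] by blast
    qed
  qed
  have cle: "card (lab ` ?A) \<le> card (arcs_ends G)" using card_image_le[OF finite_darts, of lab] card_darts by simp
  have img: "arcs_ends G = lab ` ?A" using finite_darts sub cle by (intro card_seteq) auto
  then have inj: "inj_on lab ?A" using finite_darts card_darts by (intro eq_card_imp_inj_on) auto
  then have bij: "bij_betw lab ?A (arcs_ends G)" using img by (simp add: bij_betw_def)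
  define \<phi> where "\<phi> = inv_into ?A lab"
  have "bij_betw \<phi> (arcs_ends G) ?A" unfolding \<phi>_def using bij by (rule bij_betw_inv_into)
  moreover have "\<phi> (u, w) \<in> D u \<and> E (\<phi> (u, w)) = \<phi> (w, u)" if uw: "(u, w) \<in> arcs_ends G" for u w
  proof -
    have x: "\<phi> (u, w) \<in> ?A" "lab (\<phi> (u, w)) = (u, w)"
      using uw unfolding \<phi>_def img by (auto simp: inv_into_into f_inv_into_f)
    have "\<phi> (u, w) \<in> D u" using x vt by (auto simp: lab_def elim!: dartsE)
    moreover have "lab (E (\<phi> (u, w))) = (w, u)" using x(2) EE by (simp add: lab_def)
    then have "\<phi> (w, u) = E (\<phi> (u, w))"
      unfolding \<phi>_def[symmetric] using inj permutes_in_image[OF perm] x(1)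
      by (metis \<phi>_def inv_into_f_f)
    ultimately show ?thesis by simp
  qed
  ultimately have "labelling \<phi> E" by (simp add: labelling_def)
  then show thesis by (rule that)
qed

text \<open>With one dart per arc, the two darts over an edge are the only candidates for its
  2-cycle. This converse of \<open>edge_scheme_labelling\<close> is the way edge schemes are built
  and conjugated.\<close>

lemma edge_schemeI:
  assumes lab: "labelling \<phi> E" and out: "\<And>x. x \<notin> darts G D \<Longrightarrow> E x = x"
  shows "E \<in> edge_schemes G D"
proof -
  let ?A = "darts G D"
  have img: "?A = \<phi> ` arcs_ends G" using labellingD(1)[OF lab] by (simp add: bij_betw_def)
  have A: "\<exists>u w. (u, w) \<in> arcs_ends G \<and> x = \<phi> (u, w)" if "x \<in> ?A" for x using that unfolding img by auto
  have in_A: "\<phi> (u, w) \<in> ?A" if "(u, w) \<in> arcs_ends G" for u w using that img by blast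
  have EE: "E (E x) = x" for x
  proof (cases "x \<in> ?A")
    case True
    then obtain u w where uw: "(u, w) \<in> arcs_ends G" "x = \<phi> (u, w)" using A by blast
    then show ?thesis using labellingD(3)[OF lab] arcs_endsD(4) by simp
  qed (simp add: out)
  have "E permutes ?A"
    unfolding permutes_def using EE out by metis
  moreover have "E \<circ> E = id" using EE by (simp add: fun_eq_iff)
  moreover have "E x \<noteq> x" if "x \<in> ?A" for x
  proof -
    obtain u w where uw: "(u, w) \<in> arcs_ends G" "x = \<phi> (u, w)" using A[OF \<open>x \<in> ?A\<close>] by blast
    then show ?thesis
      using labellingD(3)[OF lab uw(1)] labelling_eq_iff[OF lab arcs_endsD(4)[OF uw(1)] uw(1)] arcs_endsD(3)[OF uw(1)] by auto
  qed
  moreover have "\<exists>!c. c \<in> (\<lambda>x. {x, E x}) ` ?A \<and> c \<inter> D u \<noteq> {} \<and> c \<inter> D w \<noteq> {}"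
    if uw: "(u, w) \<in> arcs_ends G" for u w
  proof (rule ex1I)
    note wu = arcs_endsD[OF uw]
    show "{\<phi> (u, w), E (\<phi> (u, w))} \<in> (\<lambda>x. {x, E x}) ` ?A \<and> {\<phi> (u, w), E (\<phi> (u, w))} \<inter> D u \<noteq> {} \<and>
        {\<phi> (u, w), E (\<phi> (u, w))} \<inter> D w \<noteq> {}"
      using in_A[OF uw] labellingD(2)[OF lab uw] labellingD(2)[OF lab wu(4)] labellingD(3)[OF lab uw] by auto
    fix c assume c: "c \<in> (\<lambda>x. {x, E x}) ` ?A \<and> c \<inter> D u \<noteq> {} \<and> c \<inter> D w \<noteq> {}"
    then obtain a b where ab: "(a, b) \<in> arcs_ends G" "c = {\<phi> (a, b), E (\<phi> (a, b))}" using A by blast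
    note ba = arcs_endsD[OF ab(1)]
    have E: "E (\<phi> (a, b)) = \<phi> (b, a)" using labellingD(3)[OF lab ab(1)] .
    have D: "\<phi> (a, b) \<in> D a" "\<phi> (b, a) \<in> D b" using labellingD(2)[OF lab] ab(1) ba(4) by blast+
    have "u = a \<or> u = b" "w = a \<or> w = b"
      using c D D_disjoint ba(1,2) wu(1,2) unfolding ab(2) E by blast+
    then have "(a, b) = (u, w) \<or> (a, b) = (w, u)" using wu(3) by auto
    then show "c = {\<phi> (u, w), E (\<phi> (u, w))}"
      unfolding ab(2) E labellingD(3)[OF lab uw] by auto
  qed
  ultimately show ?thesis by (simp add: edge_schemes_def)
qed

lemma edge_schemes_nonempty: "edge_schemes G D \<noteq> {}"
proof -
  have "\<exists>h. bij_betw h {w. (u, w) \<in> arcs_ends G} (D u)" if "u \<in> verts G" for u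
  proof (rule finite_same_card_bij)
    show "finite {w. (u, w) \<in> arcs_ends G}"
      using finite_vertices arcs_endsD(2) by (auto intro: finite_subset[of _ "verts G"])
  qed (use that finite_D card_D in auto)
  then obtain h where h: "\<And>u. u \<in> verts G \<Longrightarrow> bij_betw (h u) {w. (u, w) \<in> arcs_ends G} (D u)" by metis
  define \<phi> where "\<phi> = (\<lambda>(u, w). h u w)"
  have D: "\<phi> (u, w) \<in> D u" if "(u, w) \<in> arcs_ends G" for u w
    using h[OF arcs_endsD(1)[OF that]] that by (auto simp: \<phi>_def bij_betw_def)
  have bij: "bij_betw \<phi> (arcs_ends G) (darts G D)"
  proof (rule bij_betw_imageI)
    show "inj_on \<phi> (arcs_ends G)"
    proof (rule inj_onI, clarify)
      fix u w a b assume *: "(u, w) \<in> arcs_ends G" "(a, b) \<in> arcs_ends G" "\<phi> (u, w) = \<phi> (a, b)"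
      then have "u = a" using D D_disjoint arcs_endsD(1) by metis
      moreover have "inj_on (h u) {w. (u, w) \<in> arcs_ends G}" using h arcs_endsD(1)[OF *(1)] by (simp add: bij_betw_def)
      ultimately show "u = a \<and> w = b" using * by (auto simp: \<phi>_def inj_on_def)
    qed
    show "\<phi> ` arcs_ends G = darts G D"
    proof
      show "\<phi> ` arcs_ends G \<subseteq> darts G D"
      proof (rule image_subsetI, clarify)
        fix u w assume "(u, w) \<in> arcs_ends G"
        then show "\<phi> (u, w) \<in> darts G D" using dartsI[OF arcs_endsD(1) D] by blast
      qed
      show "darts G D \<subseteq> \<phi> ` arcs_ends G"
      proof
        fix x assume "x \<in> darts G D"
        then obtain u where u: "u \<in> verts G" "x \<in> D u" by (rule dartsE)
        then have "x \<in> h u ` {w. (u, w) \<in> arcs_ends G}" using h[OF u(1)] by (simp add: bij_betw_def)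
        then show "x \<in> \<phi> ` arcs_ends G" by (force simp: \<phi>_def)
      qed
    qed
  qed
  define E where "E x = (if x \<in> darts G D then \<phi> (prod.swap (inv_into (arcs_ends G) \<phi> x)) else x)" for x
  have "E (\<phi> (u, w)) = \<phi> (w, u)" if "(u, w) \<in> arcs_ends G" for u w
    using bij that by (auto simp: E_def bij_betw_def inv_into_f_f)
  then have "labelling \<phi> E" using bij D by (simp add: labelling_def)
  then have "E \<in> edge_schemes G D" by (rule edge_schemeI) (simp add: E_def)
  then show ?thesis by blast
qed

lemma permutes_glue:
  assumes s: "\<And>u. u \<in> verts G \<Longrightarrow> s u permutes D u"
  obtains g where "g permutes darts G D" "\<And>u x. u \<in> verts G \<Longrightarrow> x \<in> D u \<Longrightarrow> g x = s u x"
proof -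
  define vt where "vt x = (THE u. u \<in> verts G \<and> x \<in> D u)" for x
  have vt: "vt x = u" if "u \<in> verts G" "x \<in> D u" for x u
    unfolding vt_def by (rule the_equality) (use that D_disjoint in blast)+
  define g where "g x = (if x \<in> darts G D then s (vt x) x else x)" for x
  have g: "g x = s u x" if "u \<in> verts G" "x \<in> D u" for u x
    using that vt dartsI by (simp add: g_def)
  have "darts G D \<subseteq> g ` darts G D"
  proof
    fix y assume "y \<in> darts G D"
    then obtain u where u: "u \<in> verts G" "y \<in> D u" by (rule dartsE)
    then have "inv (s u) y \<in> D u" "s u (inv (s u) y) = y"
      using s[OF u(1)] by (simp_all add: permutes_inv permutes_in_image permutes_inverses)
    then show "y \<in> g ` darts G D" using g[OF u(1)] dartsI[OF u(1)] by (metis imageI)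
  qed
  moreover have "g ` darts G D \<subseteq> darts G D"
    using g s permutes_in_image dartsI by (fastforce elim!: dartsE)
  ultimately have "g ` darts G D = darts G D" by blast
  then have "bij_betw g (darts G D) (darts G D)"
    using finite_darts by (simp add: bij_betw_def eq_card_imp_inj_on)
  then have "g permutes darts G D" by (rule bij_imp_permutes) (simp add: g_def)
  then show thesis using g by (rule that)
qed

lemma rotations_nonempty: "rotations G D \<noteq> {}"
proof -
  have "\<exists>s. s permutes D u \<and> (D u \<noteq> {} \<longrightarrow> cyclic_on s (D u))" if u: "u \<in> verts G" for u
  proof (cases "D u = {}")
    case False
    have "card {g. g permutes D u \<and> cyclic_on g (D u)} \<noteq> 0"
      using card_cyclic[OF finite_D[OF u] False] by simp
    then have "{g. g permutes D u \<and> cyclic_on g (D u)} \<noteq> {}" by (metis card.empty)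
    then show ?thesis by blast
  qed (use permutes_id in auto)
  then obtain s where s: "\<And>u. u \<in> verts G \<Longrightarrow> s u permutes D u"
      "\<And>u. u \<in> verts G \<Longrightarrow> D u \<noteq> {} \<Longrightarrow> cyclic_on (s u) (D u)" by metis
  obtain g where g: "g permutes darts G D" "\<And>u x. u \<in> verts G \<Longrightarrow> x \<in> D u \<Longrightarrow> g x = s u x"
    using permutes_glue[of s] s(1) by metis
  have "cyclic_on g (D u)" if "u \<in> verts G" "D u \<noteq> {}" for u
    using s(2)[OF that] g(2)[OF that(1)] cyclic_cong[of "D u" g "s u"] by simp
  then have "g \<in> rotations G D" using g(1) by (simp add: rotations_def)
  then show ?thesis by blast
qed

lemma rotationsD:
  assumes "R \<in> rotations G D"
  shows "R permutes darts G D"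
    and "u \<in> verts G \<Longrightarrow> D u \<noteq> {} \<Longrightarrow> cyclic_on R (D u)"
    and "u \<in> verts G \<Longrightarrow> R x \<in> D u \<longleftrightarrow> x \<in> D u"
proof -
  show R: "R permutes darts G D" and c: "\<And>u. u \<in> verts G \<Longrightarrow> D u \<noteq> {} \<Longrightarrow> cyclic_on R (D u)"
    using assms by (simp_all add: rotations_def)
  show "R x \<in> D u \<longleftrightarrow> x \<in> D u" if "u \<in> verts G"
    using cyclic_on_inI[OF c[OF that]] cyclic_on_f_in[OF R c[OF that]] by blast
qed

lemma finite_rotations: "finite (rotations G D)"
  by (rule finite_subset[OF _ finite_permutations[OF finite_darts]]) (auto simp: rotations_def)

lemma finite_edge_schemes: "finite (edge_schemes G D)"
  by (rule finite_subset[OF _ finite_permutations[OF finite_darts]]) (auto simp: edge_schemes_def)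

lemma edge_schemesD:
  assumes "E \<in> edge_schemes G D" shows "E permutes darts G D" "E (E x) = x"
  using assms by (auto simp: edge_schemes_def fun_eq_iff)

text \<open>Relabellings of the darts within each vertex. Conjugation by them preserves rotations
  and edge schemes separately, so the two components of an embedding may be relabelled
  independently.\<close>

definition dart_symmetries :: "('d \<Rightarrow> 'd) set" where
  "dart_symmetries = {s. s permutes darts G D \<and> (\<forall>u\<in>verts G. s ` D u = D u)}"

lemma dart_symmetriesD:
  assumes "s \<in> dart_symmetries"
  shows "s permutes darts G D" "bij s" "u \<in> verts G \<Longrightarrow> s ` D u = D u"
  using assms by (auto simp: dart_symmetries_def permutes_bij)

lemma permutes_D_symmetry:
  assumes v: "v \<in> verts G" and s: "s permutes D v" shows "s \<in> dart_symmetries"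
proof -
  have "s ` D u = D u" if u: "u \<in> verts G" for u
  proof (cases "u = v")
    case False
    then have "\<And>x. x \<in> D u \<Longrightarrow> s x = x" using s v u D_disjoint by (metis permutes_not_in)
    then show ?thesis by simp
  qed (use permutes_image[OF s] in simp)
  moreover have "s permutes darts G D"
    using s by (rule permutes_subset) (use v in \<open>auto simp: darts_def\<close>)
  ultimately show ?thesis by (simp add: dart_symmetries_def)
qed

lemma inv_dart_symmetry:
  assumes "s \<in> dart_symmetries" shows "inv s \<in> dart_symmetries"
proof -
  have "inv s ` D u = D u" if "u \<in> verts G" for u
  proof -
    have "inv s ` s ` D u = D u"
      using dart_symmetriesD(2)[OF assms] by (simp add: bij_is_inj image_image)
    then show ?thesis using dart_symmetriesD(3)[OF assms that] by simp
  qed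
  then show ?thesis using assms permutes_inv by (auto simp: dart_symmetries_def)
qed

lemma rotations_conj:
  assumes s: "s \<in> dart_symmetries" and R: "R \<in> rotations G D"
  shows "conj_perm s R \<in> rotations G D"
proof -
  have "cyclic_on (conj_perm s R) (D u)" if "u \<in> verts G" "D u \<noteq> {}" for u
    using cyclic_on_conj_perm[OF dart_symmetriesD(2)[OF s] rotationsD(2)[OF R that]]
    by (simp add: dart_symmetriesD(3)[OF s that(1)])
  then show ?thesis
    using conj_perm_permutes_same[OF dart_symmetriesD(1)[OF s] rotationsD(1)[OF R]] by (simp add: rotations_def)
qed

lemma edge_schemes_conj:
  assumes s: "s \<in> dart_symmetries" and E: "E \<in> edge_schemes G D"
  shows "conj_perm s E \<in> edge_schemes G D"
proof -
  obtain \<phi> where \<phi>: "labelling \<phi> E" using E by (rule edge_scheme_labelling)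
  have bij: "bij_betw s (darts G D) (darts G D)" using dart_symmetriesD(1)[OF s] by (rule permutes_imp_bij)
  have "labelling (s \<circ> \<phi>) (conj_perm s E)"
    unfolding labelling_def
  proof (intro conjI allI impI)
    show "bij_betw (s \<circ> \<phi>) (arcs_ends G) (darts G D)"
      using labellingD(1)[OF \<phi>] bij by (rule bij_betw_trans)
    fix u w assume uw: "(u, w) \<in> arcs_ends G"
    show "(s \<circ> \<phi>) (u, w) \<in> D u"
      using labellingD(2)[OF \<phi> uw] dart_symmetriesD(3)[OF s arcs_endsD(1)[OF uw]] by auto
    show "conj_perm s E ((s \<circ> \<phi>) (u, w)) = (s \<circ> \<phi>) (w, u)"
      using labellingD(3)[OF \<phi> uw] by (simp add: conj_perm_apply[OF dart_symmetriesD(2)[OF s]])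
  qed
  moreover have "conj_perm s E permutes darts G D"
    using dart_symmetriesD(1)[OF s] edge_schemesD(1)[OF E] by (rule conj_perm_permutes_same)
  ultimately show ?thesis by (intro edge_schemeI) (auto simp: permutes_not_in)
qed

text \<open>Any two full cycles on the same dart set are conjugate there, and disjointness of the
  dart sets lets the conjugating maps be glued.\<close>

lemma rotations_conjugate:
  assumes R: "R \<in> rotations G D" and Q: "Q \<in> rotations G D"
  obtains s where "s \<in> dart_symmetries" "conj_perm s R = Q"
proof -
  have "\<exists>s. s permutes D u \<and> (\<forall>x\<in>D u. s (R x) = Q (s x))" if u: "u \<in> verts G" for u
  proof (cases "D u = {}")
    case False
    then show ?thesis
      using cyclic_on_conjugate[OF rotationsD(2)[OF R u] rotationsD(2)[OF Q u]] by metis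
  qed (use permutes_id in auto)
  then obtain s where s: "\<And>u. u \<in> verts G \<Longrightarrow> s u permutes D u"
      "\<And>u x. u \<in> verts G \<Longrightarrow> x \<in> D u \<Longrightarrow> s u (R x) = Q (s u x)" by metis
  obtain g where g: "g permutes darts G D" "\<And>u x. u \<in> verts G \<Longrightarrow> x \<in> D u \<Longrightarrow> g x = s u x"
    using permutes_glue[of s] s(1) by metis
  have "g ` D u = D u" if u: "u \<in> verts G" for u
    using g(2)[OF u] permutes_image[OF s(1)[OF u]] by (metis (no_types, lifting) image_cong)
  then have sym: "g \<in> dart_symmetries" using g(1) by (simp add: dart_symmetries_def)
  have "conj_perm g R = Q"
  proof (rule conj_perm_eqI)
    show "bij g" using g(1) by (rule permutes_bij)
    fix x
    show "Q (g x) = g (R x)"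
    proof (cases "x \<in> darts G D")
      case True
      then obtain u where u: "u \<in> verts G" "x \<in> D u" by (rule dartsE)
      then show ?thesis using g(2)[OF u] g(2)[OF u(1), of "R x"] s(2)[OF u] rotationsD(3)[OF R u(1)] by simp
    next
      case False
      then show ?thesis using g(1) rotationsD(1)[OF R] rotationsD(1)[OF Q] by (simp add: permutes_not_in)
    qed
  qed
  with sym show thesis by (rule that)
qed

text \<open>
  The part of the local permutation that does not depend on the rotation at \<open>v\<close>.
\<close>

definition face_trace :: "'v \<Rightarrow> ('d \<Rightarrow> 'd) \<Rightarrow> ('d \<Rightarrow> 'd) \<Rightarrow> 'd \<Rightarrow> 'd" where
  "face_trace v R E = induced_perm (perm_restrict R (darts G D - D v) \<circ> E) (D v)"

context
  fixes v R E
  assumes v: "v \<in> verts G" and R: "R \<in> rotations G D" and E: "E \<in> edge_schemes G D"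
begin

lemma D_subset_darts: "D v \<subseteq> darts G D"
  using v by (auto simp: darts_def)

lemma perm_restrict_outside_permutes: "perm_restrict R (darts G D - D v) permutes darts G D"
proof (cases "D v = {}")
  case True
  then show ?thesis using rotationsD(1)[OF R] by simp
next
  case False
  have "perm_restrict R (darts G D - D v) permutes darts G D - D v"
    using rotationsD(1)[OF R] rotationsD(2)[OF R v False] by (rule perm_restrict_diff_cyclic)
  then show ?thesis by (rule permutes_subset) blast
qed

lemma perm_restrict_local_permutes: "perm_restrict R (D v) permutes D v"
proof (rule bij_imp_permutes)
  have "inj_on R (D v)" using permutes_inj[OF rotationsD(1)[OF R]] by (rule inj_on_subset) simp
  moreover have "R ` D v \<subseteq> D v" using rotationsD(3)[OF R v] by blast
  ultimately have "bij_betw R (D v) (D v)"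
    using finite_D[OF v] by (intro bij_betw_imageI endo_inj_surj)
  then show "bij_betw (perm_restrict R (D v)) (D v) (D v)"
    by (rule bij_betw_cong[THEN iffD1, rotated]) (simp add: perm_restrict_def)
qed (simp add: perm_restrict_def)

lemma face_trace_permutes: "face_trace v R E permutes D v"
  unfolding face_trace_def
  using permutes_compose[OF edge_schemesD(1)[OF E] perm_restrict_outside_permutes] finite_darts D_subset_darts
  by (rule induced_perm_permutes)

text \<open>\<open>R\<close> is the product of its restrictions to \<open>D v\<close> and to the
  other darts. The former permutes \<open>D v\<close>, so \<open>induced_perm_comp_left\<close>
  takes it out of the induced permutation.\<close>

lemma local_perm_eq: "local_perm D v (R, E) = perm_restrict R (D v) \<circ> face_trace v R E"
proof -
  have "R x = perm_restrict R (D v) (perm_restrict R (darts G D - D v) x)" for x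
    using rotationsD(3)[OF R v, of x] rotationsD(1)[OF R]
    by (auto simp: perm_restrict_def permutes_not_in)
  then have "R \<circ> E = perm_restrict R (D v) \<circ> (perm_restrict R (darts G D - D v) \<circ> E)"
    by (auto simp: fun_eq_iff)
  then show ?thesis
    unfolding local_perm_def face_trace_def face_perm.simps
    using permutes_compose[OF edge_schemesD(1)[OF E] perm_restrict_outside_permutes] finite_darts
      perm_restrict_local_permutes by (simp add: induced_perm_comp_left)
qed

lemma perm_restrict_local_conj:
  assumes s: "s permutes D v"
  shows "perm_restrict (conj_perm s R) (D v) = conj_perm s (perm_restrict R (D v))"
proof (rule conj_perm_eqI[symmetric])
  show "bij s" using s by (rule permutes_bij)
  then show "perm_restrict (conj_perm s R) (D v) (s x) = s (perm_restrict R (D v) x)" for x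
    using s by (simp add: perm_restrict_def permutes_in_image conj_perm_apply)
qed

text \<open>Relabelling \<open>R\<close> by \<open>r\<close> changes only the rotation at
  \<open>v\<close>, which the trace discards, while \<open>s\<close> commutes with the rotations
  elsewhere. Thus \<open>r\<close> and \<open>s\<close> act on different factors of
  \<open>local_perm_eq\<close>.\<close>

lemma face_trace_conj:
  assumes r: "r permutes D v" and s: "s permutes D v"
  shows "face_trace v (conj_perm r R) (conj_perm s E) = conj_perm s (face_trace v R E)"
proof -
  have bs: "bij s" and br: "bij r" using r s by (simp_all add: permutes_bij)
  have "perm_restrict (conj_perm r R) (darts G D - D v) = perm_restrict R (darts G D - D v)"
  proof
    fix x
    have "conj_perm r R x = R x" if "x \<notin> D v"
      using that conj_perm_apply[OF br, of R x] r rotationsD(3)[OF R v, of x] by (simp add: permutes_not_in)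
    then show "perm_restrict (conj_perm r R) (darts G D - D v) x = perm_restrict R (darts G D - D v) x"
      by (simp add: perm_restrict_def)
  qed
  moreover have "conj_perm s (perm_restrict R (darts G D - D v)) = perm_restrict R (darts G D - D v)"
  proof (rule conj_perm_eqI[OF bs])
    fix x
    show "perm_restrict R (darts G D - D v) (s x) = s (perm_restrict R (darts G D - D v) x)"
    proof (cases "x \<in> D v")
      case True
      then show ?thesis using s by (simp add: perm_restrict_def permutes_in_image)
    next
      case False
      then show ?thesis using s rotationsD(3)[OF R v, of x] by (simp add: perm_restrict_def permutes_not_in)
    qed
  qed
  ultimately have "perm_restrict (conj_perm r R) (darts G D - D v) \<circ> conj_perm s E =
      conj_perm s (perm_restrict R (darts G D - D v) \<circ> E)"
    by (simp add: conj_perm_comp[OF bs])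
  then show ?thesis
    unfolding face_trace_def using induced_perm_conj[OF bs, of "perm_restrict R (darts G D - D v) \<circ> E" "D v"]
    by (simp add: permutes_image[OF s])
qed

end

end

section \<open>Deleting a vertex\<close>

text \<open>By \<open>trans\<close> any two fibres inject into each other, so all have the same
  size. The conclusion is the equality of two averages with denominators cleared.\<close>

lemma fiber_average:
  fixes h :: "'b \<Rightarrow> real"
  assumes A: "finite A" and B: "finite B" and sub: "\<And>a. a \<in> A \<Longrightarrow> \<theta> a \<in> B"
    and trans: "\<And>b c. b \<in> B \<Longrightarrow> c \<in> B \<Longrightarrow>
      \<exists>\<pi>. inj_on \<pi> A \<and> (\<forall>a\<in>A. \<theta> a = b \<longrightarrow> \<pi> a \<in> A \<and> \<theta> (\<pi> a) = c)"
  shows "card B * (\<Sum>a\<in>A. h (\<theta> a)) = card A * (\<Sum>b\<in>B. h b)"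
proof -
  define F where "F b = {a \<in> A. \<theta> a = b}" for b
  have finF: "finite (F b)" for b using A by (simp add: F_def)
  have le: "card (F b) \<le> card (F c)" if "b \<in> B" "c \<in> B" for b c
  proof -
    obtain \<pi> where "inj_on \<pi> A" "\<forall>a\<in>A. \<theta> a = b \<longrightarrow> \<pi> a \<in> A \<and> \<theta> (\<pi> a) = c" using trans[OF \<open>b \<in> B\<close> \<open>c \<in> B\<close>] by blast
    then show ?thesis
      using finF by (intro card_inj_on_le[of \<pi>]) (auto simp: F_def intro: inj_on_subset)
  qed
  show ?thesis
  proof (cases "B = {}")
    case True
    then have "A = {}" using sub by blast
    then show ?thesis using True by simp
  next
    case False
    then obtain b0 where b0: "b0 \<in> B" by blast
    have F: "card (F b) = card (F b0)" if "b \<in> B" for b using le that b0 by (intro antisym) auto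
    have "(\<Sum>a\<in>A. g (\<theta> a)) = card (F b0) * (\<Sum>b\<in>B. g b)" for g :: "'b \<Rightarrow> real"
    proof -
      have "(\<Sum>a\<in>A. g (\<theta> a)) = (\<Sum>b\<in>B. \<Sum>a\<in>F b. g (\<theta> a))"
        unfolding F_def using A B sub by (intro sum.group[symmetric]) auto
      also have "\<dots> = (\<Sum>b\<in>B. card (F b) * g b)" by (intro sum.cong) (auto simp: F_def)
      finally show ?thesis using F by (simp add: sum_distrib_left)
    qed
    from this[of h] this[of "\<lambda>_. 1"] show ?thesis by simp
  qed
qed

text \<open>The smaller graph has a dart set of its own, possibly of another type, so the induced
  rotation must be pulled back along \<open>f\<close>, which is injective on \<open>A\<close>
  wherever this is used.\<close>

definition reduct :: "('e \<Rightarrow> 'd) \<Rightarrow> 'e set \<Rightarrow> ('d \<Rightarrow> 'd) \<Rightarrow> 'e \<Rightarrow> 'e" where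
  "reduct f A R x = (if x \<in> A then inv_into A f (induced_perm R (f ` A) (f x)) else x)"

context
  fixes f :: "'e \<Rightarrow> 'd" and A :: "'e set" and Z :: "'d set" and R :: "'d \<Rightarrow> 'd"
  assumes R: "R permutes Z" and Z: "finite Z" and fA: "f ` A \<subseteq> Z" and inj: "inj_on f A"
begin

lemma reduct_apply:
  assumes "x \<in> A" shows "reduct f A R x \<in> A" "f (reduct f A R x) = induced_perm R (f ` A) (f x)"
proof -
  have "induced_perm R (f ` A) (f x) \<in> f ` A"
    using induced_perm_permutes[OF R Z fA] assms by (simp add: permutes_in_image)
  then show "reduct f A R x \<in> A" "f (reduct f A R x) = induced_perm R (f ` A) (f x)"
    using assms by (simp_all add: reduct_def inv_into_into f_inv_into_f)
qed

lemma reduct_permutes: "reduct f A R permutes A"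
proof (rule bij_imp_permutes)
  have "finite A" using Z fA inj by (meson finite_imageD finite_subset)
  moreover have "inj_on (reduct f A R) A"
  proof (rule inj_onI)
    fix x y assume xy: "x \<in> A" "y \<in> A" "reduct f A R x = reduct f A R y"
    then have "induced_perm R (f ` A) (f x) = induced_perm R (f ` A) (f y)" using reduct_apply(2) by metis
    then have "f x = f y" using permutes_inj[OF induced_perm_permutes[OF R Z fA]] by (simp add: inj_eq)
    then show "x = y" using inj xy(1,2) by (simp add: inj_on_eq_iff)
  qed
  ultimately show "bij_betw (reduct f A R) A A"
    using reduct_apply(1) by (intro bij_betw_imageI endo_inj_surj) auto
qed (simp add: reduct_def)

lemma reduct_conj:
  assumes s: "s permutes Z" and s': "s' permutes A" and fs: "\<And>x. x \<in> A \<Longrightarrow> s (f x) = f (s' x)"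
  shows "reduct f A (conj_perm s R) = conj_perm s' (reduct f A R)"
proof (rule conj_perm_eqI[symmetric, OF permutes_bij[OF s']])
  fix x
  have bs: "bij s" using s by (rule permutes_bij)
  show "reduct f A (conj_perm s R) (s' x) = s' (reduct f A R x)"
  proof (cases "x \<in> A")
    case True
    have s'x: "s' x \<in> A" using True s' by (simp add: permutes_in_image)
    have "s ` f ` A = f ` s' ` A" using fs by (auto simp: image_image)
    then have sfA: "s ` f ` A = f ` A" using permutes_image[OF s'] by simp
    have "induced_perm (conj_perm s R) (f ` A) (f (s' x)) = conj_perm s (induced_perm R (f ` A)) (s (f x))"
      using induced_perm_conj[OF bs, of R "f ` A"] fs[OF True] by (simp add: sfA)
    also have "\<dots> = f (s' (reduct f A R x))"
      using fs[OF reduct_apply(1)[OF True]] reduct_apply(2)[OF True] by (simp add: conj_perm_apply[OF bs])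
    finally show ?thesis
      using s'x s' reduct_apply(1)[OF True] inj by (simp add: reduct_def permutes_in_image inv_into_f_f)
  next
    case False
    then show ?thesis using s' by (simp add: reduct_def permutes_not_in)
  qed
qed

end

text \<open>Both edge schemes are fixed here and need not be related: the comparison averages over
  rotations, for each pair of schemes.\<close>

locale vertex_deletion =
  G: dart_graph G D + H: dart_graph "pre_digraph.del_vert G v" D'
  for G :: "('v, 'a) pre_digraph" and D :: "'v \<Rightarrow> 'd set" and v :: 'v and D' :: "'v \<Rightarrow> 'e set" +
  fixes E :: "'d \<Rightarrow> 'd" and E' :: "'e \<Rightarrow> 'e"
  assumes v: "v \<in> verts G" and E: "E \<in> edge_schemes G D"
    and E': "E' \<in> edge_schemes (pre_digraph.del_vert G v) D'"
begin

abbreviation "H \<equiv> pre_digraph.del_vert G v"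
abbreviation "A \<equiv> darts H D'"

lemma verts_H: "verts H = verts G - {v}"
  by (simp add: pre_digraph.del_vert_def)

lemma arcs_ends_H: "arcs_ends H = {(a, b) \<in> arcs_ends G. a \<noteq> v \<and> b \<noteq> v}"
  by (auto simp: arcs_ends_def arc_to_ends_def pre_digraph.del_vert_def)

text \<open>Both schemes label darts by arcs, and \<open>f\<close> matches equal labels. The darts
  missed by \<open>f\<close> belong to the arcs at \<open>v\<close>; as the graph is simple, every
  other vertex has at most one of them, and its partner lies at \<open>v\<close>.\<close>

lemma transfer_exists:
  "\<exists>f. inj_on f A \<and> (\<forall>u\<in>verts H. f ` D' u = D u \<inter> f ` A) \<and> (\<forall>x\<in>A. f (E' x) = E (f x)) \<and>
     (\<forall>u\<in>verts H. \<forall>z\<in>D u - f ` A. \<forall>z'\<in>D u - f ` A. z = z') \<and>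
     (\<forall>x\<in>D v. E x \<notin> D v) \<and> f ` A \<inter> D v = {} \<and> (\<forall>u\<in>verts H. \<forall>z\<in>D u - f ` A. E z \<in> D v)"
proof -
  obtain \<phi> where \<phi>: "G.labelling \<phi> E" using E by (rule G.edge_scheme_labelling)
  obtain \<psi> where \<psi>: "H.labelling \<psi> E'" using E' by (rule H.edge_scheme_labelling)
  define f where "f = \<phi> \<circ> inv_into (arcs_ends H) \<psi>"
  have sub: "arcs_ends H \<subseteq> arcs_ends G" by (auto simp: arcs_ends_H)
  have \<psi>bij: "bij_betw \<psi> (arcs_ends H) A" using \<psi> by (rule H.labellingD(1))
  have inj\<phi>: "inj_on \<phi> (arcs_ends H)"
    using bij_betw_imp_inj_on[OF G.labellingD(1)[OF \<phi>]] sub by (rule inj_on_subset)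
  have f\<psi>: "f (\<psi> a) = \<phi> a" if "a \<in> arcs_ends H" for a
    using that \<psi>bij by (simp add: f_def bij_betw_def)
  have A: "A = \<psi> ` arcs_ends H" using \<psi>bij by (simp add: bij_betw_def)
  have fA: "f ` A = \<phi> ` arcs_ends H" using f\<psi> by (simp add: A image_image)
  have injf: "inj_on f A"
    unfolding f_def using bij_betw_inv_into[OF \<psi>bij] inj\<phi> by (intro comp_inj_on) (simp_all add: bij_betw_def)
  have mem: "\<phi> (a, b) \<in> f ` A \<longleftrightarrow> a \<noteq> v \<and> b \<noteq> v" if "(a, b) \<in> arcs_ends G" for a b
  proof
    assume "\<phi> (a, b) \<in> f ` A"
    then obtain e where "e \<in> arcs_ends H" "\<phi> (a, b) = \<phi> e" unfolding fA by blast
    then have "(a, b) \<in> arcs_ends H" using G.labelling_eq_iff[OF \<phi> that, of e] sub by auto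
    then show "a \<noteq> v \<and> b \<noteq> v" by (simp add: arcs_ends_H)
  next
    assume "a \<noteq> v \<and> b \<noteq> v"
    then show "\<phi> (a, b) \<in> f ` A" using that unfolding fA by (intro imageI) (simp add: arcs_ends_H)
  qed
  have 1: "f ` D' u = D u \<inter> f ` A" if u: "u \<in> verts H" for u
  proof
    show "f ` D' u \<subseteq> D u \<inter> f ` A"
    proof
      fix y assume "y \<in> f ` D' u"
      then obtain x where x: "x \<in> D' u" "y = f x" by blast
      obtain w where w: "(u, w) \<in> arcs_ends H" "x = \<psi> (u, w)" using \<psi> u x(1) by (rule H.labellingE)
      have "y = \<phi> (u, w)" using x(2) w f\<psi> by simp
      moreover have "(u, w) \<in> arcs_ends G" using w(1) sub by blast
      ultimately show "y \<in> D u \<inter> f ` A" using G.labellingD(2)[OF \<phi>] w(1) fA by auto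
    qed
    show "D u \<inter> f ` A \<subseteq> f ` D' u"
    proof
      fix y assume y: "y \<in> D u \<inter> f ` A"
      obtain w where w: "(u, w) \<in> arcs_ends G" "y = \<phi> (u, w)"
        using y u verts_H by (auto intro: G.labellingE[OF \<phi>, of u y])
      then have "(u, w) \<in> arcs_ends H" using y mem[OF w(1)] by (simp add: arcs_ends_H)
      then have "y = f (\<psi> (u, w))" "\<psi> (u, w) \<in> D' u" using w(2) f\<psi> H.labellingD(2)[OF \<psi>] by simp_all
      then show "y \<in> f ` D' u" by blast
    qed
  qed
  have 2: "f (E' x) = E (f x)" if "x \<in> A" for x
  proof -
    have "x \<in> \<psi> ` arcs_ends H" using that A by simp
    then obtain a b where ab: "(a, b) \<in> arcs_ends H" "x = \<psi> (a, b)" by auto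
    then show ?thesis
      using f\<psi> H.labellingD(3)[OF \<psi> ab(1)] H.arcs_endsD(4)[OF ab(1)] G.labellingD(3)[OF \<phi>, of a b] sub by auto
  qed
  have out: "\<exists>z. z = \<phi> (u, v) \<and> (u, v) \<in> arcs_ends G \<and> y = z" if "u \<in> verts H" "y \<in> D u - f ` A" for u y
  proof -
    have uy: "u \<in> verts G" "y \<in> D u" using that verts_H by auto
    obtain w where w: "(u, w) \<in> arcs_ends G" "y = \<phi> (u, w)" using \<phi> uy by (rule G.labellingE)
    have "w = v" using mem[OF w(1)] w(2) that verts_H by auto
    then show ?thesis using w by blast
  qed
  have 3: "z = z'" if "u \<in> verts H" "z \<in> D u - f ` A" "z' \<in> D u - f ` A" for u z z'
    using out[OF that(1,2)] out[OF that(1,3)] by blast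
  have 4: "E x \<notin> D v" if x: "x \<in> D v" for x
  proof -
    obtain w where w: "(v, w) \<in> arcs_ends G" "x = \<phi> (v, w)" using \<phi> v x by (rule G.labellingE)
    note wv = G.arcs_endsD[OF w(1)]
    have "E x \<in> D w" using w(2) G.labellingD(3)[OF \<phi> w(1)] G.labellingD(2)[OF \<phi> wv(4)] by simp
    then show ?thesis using G.D_disjoint[of v w "E x"] wv by blast
  qed
  have 5: "f ` A \<inter> D v = {}"
  proof (rule ccontr)
    assume "f ` A \<inter> D v \<noteq> {}"
    then obtain y where y: "y \<in> f ` A" "y \<in> D v" by blast
    obtain w where w: "(v, w) \<in> arcs_ends G" "y = \<phi> (v, w)" using \<phi> v y(2) by (rule G.labellingE)
    then show False using mem[OF w(1)] y(1) by simp
  qed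
  have 6: "E z \<in> D v" if "u \<in> verts H" "z \<in> D u - f ` A" for u z
    using out[OF that] G.labellingD(3)[OF \<phi>, of u v] G.labellingD(2)[OF \<phi>, of v u] G.arcs_endsD(4)[of u v] by auto
  show ?thesis
  proof (intro exI[of _ f] conjI ballI)
    show "inj_on f A" "f ` A \<inter> D v = {}" by (fact injf, fact 5)
  qed (erule 1 2 4 | rule 3 6; assumption)+
qed

definition dart_map :: "'e \<Rightarrow> 'd" where
  "dart_map = (SOME dart_map. inj_on dart_map A \<and> (\<forall>u\<in>verts H. dart_map ` D' u = D u \<inter> dart_map ` A) \<and> (\<forall>x\<in>A. dart_map (E' x) = E (dart_map x)) \<and>
     (\<forall>u\<in>verts H. \<forall>z\<in>D u - dart_map ` A. \<forall>z'\<in>D u - dart_map ` A. z = z') \<and>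
     (\<forall>x\<in>D v. E x \<notin> D v) \<and> dart_map ` A \<inter> D v = {} \<and> (\<forall>u\<in>verts H. \<forall>z\<in>D u - dart_map ` A. E z \<in> D v))"

lemma dart_map:
  shows dart_map_inj: "inj_on dart_map A"
    and dart_map_image_D: "u \<in> verts H \<Longrightarrow> dart_map ` D' u = D u \<inter> dart_map ` A"
    and dart_map_E: "x \<in> A \<Longrightarrow> dart_map (E' x) = E (dart_map x)"
    and outside_unique: "u \<in> verts H \<Longrightarrow> z \<in> D u - dart_map ` A \<Longrightarrow> z' \<in> D u - dart_map ` A \<Longrightarrow> z = z'"
    and E_leaves: "z \<in> D v \<Longrightarrow> E z \<notin> D v"
    and dart_map_disjoint: "dart_map ` A \<inter> D v = {}"
    and outside_E: "u \<in> verts H \<Longrightarrow> z \<in> D u - dart_map ` A \<Longrightarrow> E z \<in> D v"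
proof -
  note * = someI_ex[OF transfer_exists, folded dart_map_def]
  show "inj_on dart_map A" using * by (elim conjE)
  show "dart_map ` D' u = D u \<inter> dart_map ` A" if "u \<in> verts H" using * that by (elim conjE) (rule bspec)
  show "dart_map (E' x) = E (dart_map x)" if "x \<in> A" using * that by (elim conjE) (rule bspec)
  show "z = z'" if "u \<in> verts H" "z \<in> D u - dart_map ` A" "z' \<in> D u - dart_map ` A"
    using * that by (elim conjE) metis
  show "E z \<notin> D v" if "z \<in> D v" using * that by (elim conjE) (rule bspec)
  show "dart_map ` A \<inter> D v = {}" using * by (elim conjE)
  show "E z \<in> D v" if "u \<in> verts H" "z \<in> D u - dart_map ` A" using * that by (elim conjE) metis
qed

lemma dart_map_image_subset: "dart_map ` A \<subseteq> darts G D"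
proof -
  have "dart_map ` D' u \<subseteq> darts G D" if "u \<in> verts H" for u
    using dart_map_image_D[OF that] that verts_H G.dartsI by auto
  then show ?thesis by (auto elim!: H.dartsE)
qed

lemma dart_map_E_in: "y \<in> dart_map ` A \<Longrightarrow> E y \<in> dart_map ` A"
proof -
  assume "y \<in> dart_map ` A"
  then obtain x where x: "x \<in> A" "y = dart_map x" by blast
  then have "E' x \<in> A" using permutes_in_image[OF H.edge_schemesD(1)[OF E']] by simp
  then show "E y \<in> dart_map ` A" using dart_map_E[OF x(1)] x(2) by (metis imageI)
qed

lemma reduct_rotation:
  assumes R: "R \<in> rotations G D" shows "reduct dart_map A R \<in> rotations H D'"
proof -
  note R' = G.rotationsD[OF R]
  note red = reduct_apply[OF R'(1) G.finite_darts dart_map_image_subset dart_map_inj]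
  have "cyclic_on (reduct dart_map A R) (D' u)" if u: "u \<in> verts H" "D' u \<noteq> {}" for u
  proof -
    have ne: "D u \<inter> dart_map ` A \<noteq> {}" using dart_map_image_D[OF u(1)] u(2) by blast
    have uG: "u \<in> verts G" using u(1) verts_H by blast
    have c: "cyclic_on (induced_perm R (dart_map ` A)) (D u \<inter> dart_map ` A)"
      using R'(1) G.finite_darts R'(2)[OF uG] ne by (intro cyclic_on_induced_perm) blast+
    obtain x where x: "x \<in> D' u" using u(2) by blast
    have xA: "x \<in> A" using H.dartsI[OF u(1) x] .
    have sub: "D' u \<subseteq> A" using H.dartsI[OF u(1)] by blast
    have "dart_map x \<in> D u \<inter> dart_map ` A" using x dart_map_image_D[OF u(1)] by blast
    then have "dart_map ` D' u = orbit (induced_perm R (dart_map ` A)) (dart_map x)"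
      using orbit_cyclic_eq3[OF c] dart_map_image_D[OF u(1)] by simp
    also have "\<dots> = dart_map ` orbit (reduct dart_map A R) x"
      using red xA by (intro orbit_semiconj[where A=A]) simp_all
    finally have "dart_map ` D' u = dart_map ` orbit (reduct dart_map A R) x" .
    moreover have "orbit (reduct dart_map A R) x \<subseteq> A"
      using reduct_permutes[OF R'(1) G.finite_darts dart_map_image_subset dart_map_inj] xA by (rule permutes_orbit_subset)
    ultimately have "D' u = orbit (reduct dart_map A R) x"
      using inj_on_image_eq_iff[OF dart_map_inj sub] by blast
    with x show ?thesis by (rule cyclic_on_singleI)
  qed
  then show ?thesis
    using reduct_permutes[OF R'(1) G.finite_darts dart_map_image_subset dart_map_inj] by (simp add: rotations_def)
qed

lemma lift_symmetry:
  assumes s: "s \<in> H.dart_symmetries"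
  obtains t where "t \<in> G.dart_symmetries" "\<And>x. x \<in> A \<Longrightarrow> t (dart_map x) = dart_map (s x)"
proof -
  have sA: "s permutes A" using s by (rule H.dart_symmetriesD(1))
  \<comment> \<open>Extension by the identity: the missed darts stay in place, so every
    \<open>D u\<close> is still preserved.\<close>
  define t where "t z = (if z \<in> dart_map ` A then dart_map (s (inv_into A dart_map z)) else z)" for z
  have tf: "t (dart_map x) = dart_map (s x)" if "x \<in> A" for x using that dart_map_inj by (simp add: t_def)
  have img: "t ` dart_map ` D' u = dart_map ` D' u" if u: "u \<in> verts H" for u
  proof -
    have "t ` dart_map ` D' u = dart_map ` s ` D' u" using tf H.dartsI[OF u] by (simp add: image_image)
    then show ?thesis using H.dart_symmetriesD(3)[OF s u] by simp
  qed
  have tD: "t ` D u = D u" if u: "u \<in> verts G" for u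
  proof (cases "u = v")
    case True
    then have "\<And>z. z \<in> D u \<Longrightarrow> t z = z" using dart_map_disjoint by (auto simp: t_def)
    then show ?thesis by simp
  next
    case False
    then have uH: "u \<in> verts H" using u verts_H by blast
    have "D u = dart_map ` D' u \<union> (D u - dart_map ` A)" using dart_map_image_D[OF uH] by blast
    moreover have "t ` (D u - dart_map ` A) = D u - dart_map ` A" by (auto simp: t_def)
    ultimately show ?thesis using img[OF uH] by (metis image_Un)
  qed
  have "t ` darts G D = darts G D" using tD by (simp add: darts_def image_UN)
  then have "bij_betw t (darts G D) (darts G D)"
    using G.finite_darts by (simp add: bij_betw_def eq_card_imp_inj_on)
  then have "t permutes darts G D"
    by (rule bij_imp_permutes) (use dart_map_image_subset in \<open>auto simp: t_def\<close>)
  then have "t \<in> G.dart_symmetries" using tD by (simp add: G.dart_symmetries_def)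
  then show thesis using tf by (rule that)
qed

text \<open>A symmetry conjugating one rotation of the smaller graph into another lifts to the large
  graph and carries one fibre of the reduction into the other. So the reduction of a uniform
  rotation is uniform.\<close>

lemma reduct_average:
  fixes h :: "('e \<Rightarrow> 'e) \<Rightarrow> real"
  shows "card (rotations H D') * (\<Sum>R\<in>rotations G D. h (reduct dart_map A R)) =
    card (rotations G D) * (\<Sum>R\<in>rotations H D'. h R)"
proof (rule fiber_average)
  fix b c assume "b \<in> rotations H D'" "c \<in> rotations H D'"
  then obtain s where s: "s \<in> H.dart_symmetries" "conj_perm s b = c" by (rule H.rotations_conjugate)
  obtain t where t: "t \<in> G.dart_symmetries" "\<And>x. x \<in> A \<Longrightarrow> t (dart_map x) = dart_map (s x)" using lift_symmetry[OF s(1)] by blast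
  have "inj_on (conj_perm t) (rotations G D)"
    by (rule inj_on_inverseI) (rule conj_perm_inv_cancel[OF G.dart_symmetriesD(2)[OF t(1)]])
  moreover have "conj_perm t R \<in> rotations G D \<and> reduct dart_map A (conj_perm t R) = c"
    if "R \<in> rotations G D" "reduct dart_map A R = b" for R
    using G.rotations_conj[OF t(1) that(1)]
      reduct_conj[OF G.rotationsD(1)[OF that(1)] G.finite_darts dart_map_image_subset dart_map_inj
        G.dart_symmetriesD(1)[OF t(1)] H.dart_symmetriesD(1)[OF s(1)] t(2)] that(2) s(2)
    by simp
  ultimately show "\<exists>\<pi>. inj_on \<pi> (rotations G D) \<and>
      (\<forall>a\<in>rotations G D. reduct dart_map A a = b \<longrightarrow> \<pi> a \<in> rotations G D \<and> reduct dart_map A (\<pi> a) = c)"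
    by blast
qed (use G.finite_rotations H.finite_rotations reduct_rotation in auto)

section \<open>Cycles through the deleted vertex and faces of the remaining graph\<close>

context
  fixes R assumes R: "R \<in> rotations G D"
begin

text \<open>The face permutation with the rotation at \<open>v\<close> switched off: a walk that
  reaches a dart of \<open>v\<close> does not rotate there and returns along the same edge. It
  induces \<open>face_trace\<close> on \<open>D v\<close>.\<close>

definition outer_perm :: "'d \<Rightarrow> 'd" where
  "outer_perm = perm_restrict R (darts G D - D v) \<circ> E"

lemma outer_perm_permutes: "outer_perm permutes darts G D"
  unfolding outer_perm_def using G.edge_schemesD(1)[OF E] G.perm_restrict_outside_permutes[OF v R E]
  by (rule permutes_compose)

lemma R_restrict: "x \<notin> D v \<Longrightarrow> perm_restrict R (darts G D - D v) x = R x"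
  using G.rotationsD(1)[OF R] by (auto simp: perm_restrict_def permutes_not_in)

lemma outer_perm_E: "z \<notin> D v \<Longrightarrow> outer_perm (E z) = R z"
  by (simp add: outer_perm_def G.edge_schemesD(2)[OF E] R_restrict)

text \<open>If \<open>z = R (E y)\<close> is the missing dart of its vertex,
  \<open>outer_perm\<close> takes the detour \<open>z\<close>, \<open>E z\<close>,
  \<open>R z\<close> through \<open>v\<close>, while the induced rotation just skips
  \<open>z\<close>: three steps against two. Only one dart is missing at a vertex, so
  \<open>R z\<close> is in the image again.\<close>

lemma induced_perm_outer_perm:
  assumes y: "y \<in> dart_map ` A"
  shows "induced_perm outer_perm (dart_map ` A) y = induced_perm R (dart_map ` A) (E y)"
proof -
  have Ey: "E y \<in> dart_map ` A" using y by (rule dart_map_E_in)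
  then obtain x where "x \<in> A" "E y = dart_map x" by blast
  then obtain u where u: "u \<in> verts H" "x \<in> D' u" by (blast elim: H.dartsE)
  then have EyD: "E y \<in> D u" using dart_map_image_D[OF u(1)] \<open>E y = dart_map x\<close> by blast
  have uG: "u \<in> verts G" "u \<noteq> v" using u(1) verts_H by auto
  have not_v: "z \<notin> D v" if "z \<in> D u" for z using G.D_disjoint[OF uG(1) v] uG(2) that by blast
  have gy: "outer_perm y = R (E y)" using R_restrict[OF not_v[OF EyD]] by (simp add: outer_perm_def)
  define z where "z = R (E y)"
  have zD: "z \<in> D u" using G.rotationsD(3)[OF R uG(1)] EyD by (simp add: z_def)
  show ?thesis
  proof (cases "z \<in> dart_map ` A")
    case True
    then show ?thesis using induced_perm_step[OF y, of outer_perm] induced_perm_step[OF Ey, of R] gy by (simp add: z_def)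
  next
    case False
    have Ez: "E z \<in> D v" using outside_E[OF u(1)] zD False by blast
    have gz: "outer_perm z = E z" using Ez by (simp add: outer_perm_def perm_restrict_def)
    have gEz: "outer_perm (E z) = R z" using outer_perm_E[OF not_v[OF zD]] .
    have RzD: "R z \<in> D u" using G.rotationsD(3)[OF R uG(1)] zD by simp
    have Rz: "R z \<in> dart_map ` A"
    proof (rule ccontr)
      assume "R z \<notin> dart_map ` A"
      then have "R z = z" using outside_unique[OF u(1)] RzD zD False by blast
      then have "R z = R (E y)" by (simp add: z_def)
      then have "z = E y" using permutes_inj[OF G.rotationsD(1)[OF R]] by (simp add: inj_eq)
      then show False using False Ey by simp
    qed
    have EzA: "E z \<notin> dart_map ` A" using Ez dart_map_disjoint by blast
    have g3: "(outer_perm ^^ 3) y = R z" by (simp add: numeral_3_eq_3 gy z_def[symmetric] gz gEz)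
    have "induced_perm outer_perm (dart_map ` A) y = (outer_perm ^^ 3) y"
    proof (rule induced_perm_eqI[OF y])
      fix j :: nat assume "0 < j" "j < 3"
      then have "j = 1 \<or> j = 2" by auto
      then show "(outer_perm ^^ j) y \<notin> dart_map ` A"
        using False EzA by (auto simp: numeral_2_eq_2 gy z_def[symmetric] gz)
    qed (use Rz g3 in auto)
    moreover have "induced_perm R (dart_map ` A) (E y) = (R ^^ 2) (E y)"
    proof (rule induced_perm_eqI[OF Ey])
      fix j :: nat assume "0 < j" "j < 2"
      then have "j = 1" by simp
      then show "(R ^^ j) (E y) \<notin> dart_map ` A" using False by (simp add: z_def)
    qed (use Rz in \<open>auto simp: numeral_2_eq_2 z_def\<close>)
    ultimately show ?thesis by (simp add: g3 numeral_2_eq_2 z_def)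
  qed
qed

text \<open>On the darts of the smaller graph, its face permutation is the one induced by
  \<open>outer_perm\<close>, so its face orbits are the traces of cycles of
  \<open>outer_perm\<close>.\<close>

lemma orbit_reduct:
  assumes x: "x \<in> A"
  shows "dart_map ` orbit (reduct dart_map A R \<circ> E') x = orbit outer_perm (dart_map x) \<inter> dart_map ` A"
proof -
  note red = reduct_apply[OF G.rotationsD(1)[OF R] G.finite_darts dart_map_image_subset dart_map_inj]
  have E'A: "E' y \<in> A" if "y \<in> A" for y
    using that H.edge_schemesD(1)[OF E'] by (simp add: permutes_in_image)
  have "orbit (induced_perm outer_perm (dart_map ` A)) (dart_map x) = dart_map ` orbit (reduct dart_map A R \<circ> E') x"
  proof (rule orbit_semiconj[where A=A])
    fix y assume y: "y \<in> A"
    show "(reduct dart_map A R \<circ> E') y \<in> A" using red(1)[OF E'A[OF y]] by simp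
    show "dart_map ((reduct dart_map A R \<circ> E') y) = induced_perm outer_perm (dart_map ` A) (dart_map y)"
      using red(2)[OF E'A[OF y]] induced_perm_outer_perm[of "dart_map y"] dart_map_E[OF y] y by simp
  qed (rule x)
  then show ?thesis
    using orbit_induced_perm[OF outer_perm_permutes G.finite_darts, of "dart_map x" "dart_map ` A"] x by simp
qed

text \<open>A cycle of \<open>outer_perm\<close> through \<open>D v\<close> that meets the image of
  \<open>dart_map\<close> comes from a face orbit. One that misses it runs along an edge from
  \<open>v\<close> to a vertex without further darts; this neighbour is isolated after the deletion
  and is counted by the second summand of \<open>num_faces\<close>.\<close>

lemma card_trace_orbits_le:
  "card (orbit (G.face_trace v R E) ` D v) \<le> num_faces H D' (reduct dart_map A R, E')"
proof -
  have perm: "permutation outer_perm" using outer_perm_permutes G.finite_darts permutation_permutes by blast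
  have orb_eq: "orbit outer_perm a = orbit outer_perm b" if "a \<in> orbit outer_perm b" for a b
    using cyclic_on_orbit'[OF perm] that by (rule orbit_cyclic_eq3)
  have finv: "finite (D v)" using G.finite_D[OF v] .
  define P where "P = {x \<in> D v. orbit outer_perm x \<inter> dart_map ` A \<noteq> {}}"
  have "orbit (G.face_trace v R E) ` D v = (\<lambda>O'. O' \<inter> D v) ` orbit outer_perm ` D v"
    using orbit_induced_perm[OF outer_perm_permutes G.finite_darts]
    by (simp add: G.face_trace_def outer_perm_def[symmetric] image_image)
  then have "card (orbit (G.face_trace v R E) ` D v) \<le> card (orbit outer_perm ` D v)"
    using finv by (simp add: card_image_le)
  also have "orbit outer_perm ` D v = orbit outer_perm ` P \<union> orbit outer_perm ` (D v - P)" by (auto simp: P_def)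
  also have "card \<dots> \<le> card (orbit outer_perm ` P) + card (orbit outer_perm ` (D v - P))" by (rule card_Un_le)
  also have "card (orbit outer_perm ` P) \<le> card (orbit (reduct dart_map A R \<circ> E') ` A)"
  proof (rule surj_card_le)
    show "finite (orbit (reduct dart_map A R \<circ> E') ` A)" using H.finite_darts by simp
    \<comment> \<open>The union names the cycle of \<open>outer_perm\<close> belonging to a face:
      all its members are that same cycle.\<close>
    show "orbit outer_perm ` P \<subseteq> (\<lambda>O'. \<Union>y\<in>O'. orbit outer_perm (dart_map y)) ` orbit (reduct dart_map A R \<circ> E') ` A"
    proof
      fix O' assume "O' \<in> orbit outer_perm ` P"
      then obtain x where x: "O' = orbit outer_perm x" "orbit outer_perm x \<inter> dart_map ` A \<noteq> {}" by (auto simp: P_def)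
      then obtain y where y: "y \<in> A" "dart_map y \<in> orbit outer_perm x" by blast
      have fy: "orbit outer_perm (dart_map y) = O'" using orb_eq[OF y(2)] x(1) by simp
      have "orbit outer_perm (dart_map z) = O'" if "z \<in> orbit (reduct dart_map A R \<circ> E') y" for z
      proof -
        have "dart_map z \<in> orbit outer_perm (dart_map y)" using orbit_reduct[OF y(1)] that by blast
        then have "orbit outer_perm (dart_map z) = orbit outer_perm (dart_map y)" by (rule orb_eq)
        then show ?thesis using fy by simp
      qed
      then have "(\<Union>z\<in>orbit (reduct dart_map A R \<circ> E') y. orbit outer_perm (dart_map z)) = O'"
        using orbit_nonempty[of "reduct dart_map A R \<circ> E'" y] by auto
      then show "O' \<in> (\<lambda>O'. \<Union>y\<in>O'. orbit outer_perm (dart_map y)) ` orbit (reduct dart_map A R \<circ> E') ` A" using y(1) by blast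
    qed
  qed
  also have "card (orbit outer_perm ` (D v - P)) \<le> card {u \<in> verts H. D' u = {}}"
  proof (rule surj_card_le)
    show "finite {u \<in> verts H. D' u = {}}" using H.finite_vertices by simp
    \<comment> \<open>For a neighbour \<open>u\<close> of degree one, \<open>the_elem (D u)\<close>
      is its dart and \<open>E\<close> leads from there back to \<open>v\<close>, so
      \<open>u\<close> determines the cycle.\<close>
    show "orbit outer_perm ` (D v - P) \<subseteq> (\<lambda>u. orbit outer_perm (E (the_elem (D u)))) ` {u \<in> verts H. D' u = {}}"
    proof
      fix O' assume "O' \<in> orbit outer_perm ` (D v - P)"
      then obtain x where x: "O' = orbit outer_perm x" "x \<in> D v" "orbit outer_perm x \<inter> dart_map ` A = {}" by (auto simp: P_def)
      define z where "z = E x"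
      have Ez: "E z = x" by (simp add: z_def G.edge_schemesD(2)[OF E])
      have zv: "z \<notin> D v" using E_leaves[OF x(2)] by (simp add: z_def)
      have zA: "z \<notin> dart_map ` A"
      proof
        assume "z \<in> dart_map ` A"
        then have "x \<in> dart_map ` A" using dart_map_E_in Ez by metis
        then show False using x(2) dart_map_disjoint by blast
      qed
      have "z \<in> darts G D"
        using x(2) G.dartsI[OF v] G.edge_schemesD(1)[OF E] by (simp add: z_def permutes_in_image)
      then obtain u where u: "u \<in> verts G" "z \<in> D u" by (rule G.dartsE)
      then have uH: "u \<in> verts H" using zv verts_H by blast
      have "R z = outer_perm x" using outer_perm_E[OF zv] Ez by simp
      then have "R z \<notin> dart_map ` A" using x(3) orbit.base[of outer_perm x] by auto
      then have "R z = z"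
        using outside_unique[OF uH] G.rotationsD(3)[OF R u(1)] u(2) zA by blast
      then have "orbit R z = {z}" by (simp add: orbit_eq_singleton_iff)
      moreover have "orbit R z = D u" using G.rotationsD(2)[OF R u(1)] u(2) by (intro orbit_cyclic_eq3) auto
      ultimately have Du: "D u = {z}" by simp
      then have "dart_map ` D' u = {}" using dart_map_image_D[OF uH] zA by simp
      then have "D' u = {}" by simp
      moreover have "O' = orbit outer_perm (E (the_elem (D u)))" using Du Ez x(1) by simp
      ultimately show "O' \<in> (\<lambda>u. orbit outer_perm (E (the_elem (D u)))) ` {u \<in> verts H. D' u = {}}" using uH by blast
    qed
  qed
  finally show ?thesis unfolding num_faces_def face_perm.simps by (simp only: add_left_mono add_right_mono)
qed

end

lemma sum_trace_orbits_le:
  "real (card (rotations H D')) * (\<Sum>R\<in>rotations G D. real (card (orbit (G.face_trace v R E) ` D v))) \<le>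
    real (card (rotations G D)) * (\<Sum>R\<in>rotations H D'. real (num_faces H D' (R, E')))"
proof -
  have "(\<Sum>R\<in>rotations G D. real (card (orbit (G.face_trace v R E) ` D v))) \<le>
      (\<Sum>R\<in>rotations G D. real (num_faces H D' (reduct dart_map A R, E')))"
    using card_trace_orbits_le by (intro sum_mono) simp
  then show ?thesis
    using reduct_average[of "\<lambda>R. real (num_faces H D' (R, E'))"] by (simp add: mult_left_mono flip: reduct_average)
qed

end

section \<open>The local permutation of a random embedding\<close>

text \<open>Composing \<open>r\<close> on the left with a map conjugating one full cycle into
  another carries fibre to fibre, so a random conjugate of \<open>z\<close> is a uniform full
  cycle.\<close>

lemma conj_perm_average:
  fixes h :: "('a \<Rightarrow> 'a) \<Rightarrow> real"
  assumes X: "finite X" and z: "z permutes X" "cyclic_on z X"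
  shows "(\<Sum>r | r permutes X. h (conj_perm r z)) / fact (card X) =
    (\<Sum>b | b permutes X. cycle_density X b * h b)"
proof -
  let ?S = "{r. r permutes X}" and ?C = "{b. b permutes X \<and> cyclic_on b X}"
  have ne: "X \<noteq> {}" using z(2) by (auto simp: cyclic_on_def)
  have finS: "finite ?S" using X by (rule finite_permutations)
  have "card ?C * (\<Sum>r\<in>?S. h (conj_perm r z)) = card ?S * (\<Sum>b\<in>?C. h b)"
  proof (rule fiber_average)
    fix r assume "r \<in> ?S"
    then show "conj_perm r z \<in> ?C"
      using z cyclic_on_conj_perm[of r z X] conj_perm_permutes_same[of r X z]
      by (simp add: permutes_bij permutes_image)
  next
    fix b c assume "b \<in> ?C" "c \<in> ?C"
    then have bc: "b permutes X" "cyclic_on b X" "c permutes X" "cyclic_on c X" by auto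
    obtain s where s: "s permutes X" "\<And>x. x \<in> X \<Longrightarrow> s (b x) = c (s x)"
      using cyclic_on_conjugate[OF bc(2,4)] by metis
    have "c (s x) = s (b x)" for x
      using s bc(1,3) by (cases "x \<in> X") (simp_all add: permutes_not_in)
    then have "conj_perm s b = c" using permutes_bij[OF s(1)] by (intro conj_perm_eqI)
    moreover have "conj_perm (s \<circ> r) z = conj_perm s (conj_perm r z)" if "r \<in> ?S" for r
      using that s(1) by (intro conj_perm_conj_perm[symmetric]) (simp_all add: permutes_bij)
    ultimately have "conj_perm (s \<circ> r) z = c" if "r \<in> ?S" "conj_perm r z = b" for r
      using that by metis
    moreover have "inj_on ((\<circ>) s) ?S"
      by (rule inj_on_inverseI[where g="(\<circ>) (inv s)"]) (simp add: permutes_inv_o[OF s(1)] flip: comp_assoc)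
    ultimately show "\<exists>\<pi>. inj_on \<pi> ?S \<and> (\<forall>a\<in>?S. conj_perm a z = b \<longrightarrow> \<pi> a \<in> ?S \<and> conj_perm (\<pi> a) z = c)"
      using permutes_compose[OF _ s(1)] by (intro exI[of _ "(\<circ>) s"] conjI ballI impI) simp_all
  qed (use finS in auto)
  then have "fact (card X - 1) * (\<Sum>r\<in>?S. h (conj_perm r z)) = fact (card X) * (\<Sum>b\<in>?C. h b)"
    using card_cyclic[OF X ne] X by (simp add: card_permutations)
  then have "(\<Sum>r\<in>?S. h (conj_perm r z)) / fact (card X) = (\<Sum>b\<in>?C. h b) / fact (card X - 1)"
    by (simp add: field_simps)
  also have "\<dots> = (\<Sum>b\<in>?C. cycle_density X b * h b)"
    by (simp add: cycle_density_def sum_divide_distrib)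
  also have "\<dots> = (\<Sum>b\<in>?S. cycle_density X b * h b)"
    using finS by (intro sum.mono_neutral_left) (auto simp: cycle_density_def)
  finally show ?thesis .
qed

context dart_graph
begin

text \<open>For every pair of relabellings \<open>r\<close>, \<open>s\<close> of \<open>D v\<close>
  the sum is unchanged when the rotations are conjugated by \<open>r\<close> and the schemes by
  \<open>s\<close>. Summing over all pairs makes the rotation at \<open>v\<close> a uniform full
  cycle and the trace an independent random conjugate of itself, which is the law
  \<open>product_density\<close>.\<close>

lemma sum_local_perm:
  fixes h :: "('d \<Rightarrow> 'd) \<Rightarrow> real"
  assumes v: "v \<in> verts G" and ne: "D v \<noteq> {}"
  shows "(\<Sum>(R, E)\<in>embeddings G D. h (local_perm D v (R, E))) =
    (\<Sum>(R, E)\<in>embeddings G D. \<Sum>a | a permutes D v. product_density (D v) (face_trace v R E) a * h a)"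
proof -
  let ?X = "D v" and ?\<Omega> = "embeddings G D"
  let ?S = "{s. s permutes ?X}" and ?F = "fact (card ?X) :: real"
  let ?z = "\<lambda>R. perm_restrict R ?X"
  have finX: "finite ?X" using v by (rule finite_D)
  have cardS: "real (card ?S) = ?F" using finX by (simp add: card_permutations)
  have \<Omega>: "?\<Omega> = rotations G D \<times> edge_schemes G D" by (simp add: embeddings_def)
  have reindex: "(\<Sum>(R, E)\<in>?\<Omega>. k R E) = (\<Sum>(R, E)\<in>?\<Omega>. k (conj_perm r R) (conj_perm s E))"
    if rs: "r permutes ?X" "s permutes ?X" for r s and k :: "('d \<Rightarrow> 'd) \<Rightarrow> ('d \<Rightarrow> 'd) \<Rightarrow> real"
  proof -
    have sym: "r \<in> dart_symmetries" "s \<in> dart_symmetries" "inv r \<in> dart_symmetries" "inv s \<in> dart_symmetries"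
      using permutes_D_symmetry[OF v] rs inv_dart_symmetry by blast+
    have bij: "bij r" "bij s" using rs permutes_bij by blast+
    show ?thesis
      by (rule sum.reindex_bij_witness[of _ "\<lambda>(R, E). (conj_perm r R, conj_perm s E)"
            "\<lambda>(R, E). (conj_perm (inv r) R, conj_perm (inv s) E)"])
         (auto simp: \<Omega> rotations_conj edge_schemes_conj sym conj_perm_inv_cancel conj_perm_cancel_inv bij)
  qed
  have *: "(\<Sum>(R, E)\<in>?\<Omega>. h (local_perm D v (R, E))) =
      (\<Sum>(R, E)\<in>?\<Omega>. h (conj_perm r (?z R) \<circ> conj_perm s (face_trace v R E)))"
    if rs: "r \<in> ?S" "s \<in> ?S" for r s
  proof -
    have rs': "r permutes ?X" "s permutes ?X" using rs by auto
    have sym: "r \<in> dart_symmetries" "s \<in> dart_symmetries"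
      using permutes_D_symmetry[OF v] rs' by blast+
    have "local_perm D v (conj_perm r R, conj_perm s E) = conj_perm r (?z R) \<circ> conj_perm s (face_trace v R E)"
      if "R \<in> rotations G D" "E \<in> edge_schemes G D" for R E
      using local_perm_eq[OF v rotations_conj[OF sym(1) that(1)] edge_schemes_conj[OF sym(2) that(2)]]
        perm_restrict_local_conj[OF v that rs'(1)] face_trace_conj[OF v that rs'] by simp
    then show ?thesis
      unfolding reindex[OF rs', of "\<lambda>R E. h (local_perm D v (R, E))"] by (intro sum.cong) (auto simp: \<Omega>)
  qed
  have "(\<Sum>r\<in>?S. \<Sum>s\<in>?S. \<Sum>(R, E)\<in>?\<Omega>. h (local_perm D v (R, E))) =
      (\<Sum>r\<in>?S. \<Sum>s\<in>?S. \<Sum>(R, E)\<in>?\<Omega>. h (conj_perm r (?z R) \<circ> conj_perm s (face_trace v R E)))"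
    by (rule sum.cong[OF refl], rule sum.cong[OF refl], rule *)
  also have "\<dots> = (\<Sum>(R, E)\<in>?\<Omega>. \<Sum>r\<in>?S. \<Sum>s\<in>?S. h (conj_perm r (?z R) \<circ> conj_perm s (face_trace v R E)))"
    unfolding case_prod_beta by (subst sum.swap[of _ ?\<Omega> ?S]) (subst sum.swap[of _ ?\<Omega> ?S], rule refl)
  also have "\<dots> = (\<Sum>(R, E)\<in>?\<Omega>. ?F * (?F * (\<Sum>a\<in>?S. product_density ?X (face_trace v R E) a * h a)))"
  proof (rule sum.cong)
    fix m assume "m \<in> ?\<Omega>"
    then obtain R E where m: "m = (R, E)" "R \<in> rotations G D" "E \<in> edge_schemes G D" by (auto simp: \<Omega>)
    let ?t = "face_trace v R E"
    have t: "?t permutes ?X" using v m(2,3) by (rule face_trace_permutes)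
    have z: "?z R permutes ?X" using v m(2,3) by (rule perm_restrict_local_permutes)
    have zc: "cyclic_on (?z R) ?X" using rotationsD(2)[OF m(2) v ne] by (simp add: cyclic_on_perm_restrict)
    have "(\<Sum>r\<in>?S. \<Sum>s\<in>?S. h (conj_perm r (?z R) \<circ> conj_perm s ?t)) =
        ?F * (\<Sum>b\<in>?S. cycle_density ?X b * (\<Sum>s\<in>?S. h (b \<circ> conj_perm s ?t)))"
      using conj_perm_average[OF finX z zc, of "\<lambda>b. \<Sum>s\<in>?S. h (b \<circ> conj_perm s ?t)"] by (simp add: field_simps)
    also have "(\<Sum>b\<in>?S. cycle_density ?X b * (\<Sum>s\<in>?S. h (b \<circ> conj_perm s ?t))) =
        ?F * (\<Sum>a\<in>?S. product_density ?X ?t a * h a)"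
      unfolding sum_product_density_mult[OF finX t] sum_distrib_left
      by (intro sum.cong) (simp_all flip: sum_distrib_left)
    finally show "(case m of (R, E) \<Rightarrow> \<Sum>r\<in>?S. \<Sum>s\<in>?S. h (conj_perm r (?z R) \<circ> conj_perm s (face_trace v R E))) =
        (case m of (R, E) \<Rightarrow> ?F * (?F * (\<Sum>a\<in>?S. product_density ?X (face_trace v R E) a * h a)))"
      by (simp only: m(1) prod.case)
  qed simp
  also have "\<dots> = ?F * (?F * (\<Sum>(R, E)\<in>?\<Omega>. \<Sum>a\<in>?S. product_density ?X (face_trace v R E) a * h a))"
    by (simp add: case_prod_beta sum_distrib_left)
  finally have "?F * (?F * (\<Sum>(R, E)\<in>?\<Omega>. h (local_perm D v (R, E)))) =
      ?F * (?F * (\<Sum>(R, E)\<in>?\<Omega>. \<Sum>a\<in>?S. product_density ?X (face_trace v R E) a * h a))"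
    by (simp only: sum_constant cardS)
  then show ?thesis by simp
qed

lemma sign_local_perm:
  assumes v: "v \<in> verts G" and ne: "D v \<noteq> {}" and R: "R \<in> rotations G D" and E: "E \<in> edge_schemes G D"
  shows "sign (local_perm D v (R, E)) = (-1) ^ (card (D v) - 1) * sign (face_trace v R E)"
proof -
  let ?z = "perm_restrict R (D v)"
  have z: "?z permutes D v" using v R E by (rule perm_restrict_local_permutes)
  have c: "cyclic_on ?z (D v)" using rotationsD(2)[OF R v ne] by (simp add: cyclic_on_perm_restrict)
  have "permutation ?z" "permutation (face_trace v R E)"
    using z face_trace_permutes[OF v R E] finite_D[OF v] permutation_permutes by blast+
  then show ?thesis unfolding local_perm_eq[OF v R E] using sign_cyclic[OF c z] by (simp add: sign_compose)
qed

end

lemma graph_del_vert: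
  assumes "graph G" shows "graph (pre_digraph.del_vert G v)"
proof -
  interpret graph G by (rule assms)
  have ends: "arcs_ends (pre_digraph.del_vert G v) = {(a, b) \<in> arcs_ends G. a \<noteq> v \<and> b \<noteq> v}"
    by (auto simp: arcs_ends_def arc_to_ends_def pre_digraph.del_vert_def)
  have "symmetric (pre_digraph.del_vert G v)"
    using sym_arcs unfolding symmetric_def ends by (auto simp: sym_def)
  then show ?thesis
    using no_loops no_multi_arcs
    by unfold_locales (auto simp: pre_digraph.del_vert_def arc_to_ends_def)
qed

theorem theorem2:
  fixes G :: "('v, 'a) pre_digraph"
    and D :: "'v \<Rightarrow> 'd set" and D' :: "'v \<Rightarrow> 'e set"
    and v :: 'v and d :: nat and p :: real
  assumes "graph G"
    and "v \<in> verts G"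
    and "out_degree G v = d"
    and "d \<ge> 2"
    and "dart_system G D"
    and "dart_system (pre_digraph.del_vert G v) D'"
    and "p = measure_pmf.prob (random_embedding G D) {m. \<not> evenperm (local_perm D v m)}"
  shows "(tv_dist {\<alpha>. \<alpha> permutes D v} (pmf (local_dist G D v)) (parity_uniform (D v) p))\<^sup>2
    \<le> 2 * measure_pmf.expectation (random_embedding (pre_digraph.del_vert G v) D')
              (\<lambda>m. real (num_faces (pre_digraph.del_vert G v) D' m))
        / sqrt (real d - 1)"
proof -
  let ?H = "pre_digraph.del_vert G v" and ?X = "D v"
  let ?S = "{a. a permutes ?X}" and ?F = "fact (card ?X) :: real"
  interpret G: dart_graph G D using assms(1,5) by (rule dart_graph.intro)
  interpret H: dart_graph ?H D' using graph_del_vert[OF assms(1)] assms(6) by (rule dart_graph.intro)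
  have cardX: "card ?X = d" using assms(2,3,5) by (simp add: dart_system_def)
  have finX: "finite ?X" using assms(2) by (rule G.finite_D)
  have ne: "?X \<noteq> {}" using cardX assms(4) by auto
  define \<Omega> where "\<Omega> = embeddings G D"
  define \<Omega>' where "\<Omega>' = embeddings ?H D'"
  define N where "N = real (card \<Omega>)"
  define t where "t m = G.face_trace v (fst m) (snd m)" for m
  define \<omega> where "\<omega> = local_perm D v"
  define c where "c m = real (card (orbit (t m) ` ?X))" for m
  have \<Omega>: "finite \<Omega>" "\<Omega> \<noteq> {}"
    using G.finite_rotations G.finite_edge_schemes G.rotations_nonempty G.edge_schemes_nonempty
    by (simp_all add: \<Omega>_def embeddings_def)
  have \<Omega>': "finite \<Omega>'" "\<Omega>' \<noteq> {}"
    using H.finite_rotations H.finite_edge_schemes H.rotations_nonempty H.edge_schemes_nonempty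
    by (simp_all add: \<Omega>'_def embeddings_def)
  have N: "N > 0" using \<Omega> by (simp add: N_def card_gt_0_iff)
  have N': "real (card \<Omega>') > 0" using \<Omega>' by (simp add: card_gt_0_iff)
  have mem: "fst m \<in> rotations G D" "snd m \<in> edge_schemes G D" if "m \<in> \<Omega>" for m
    using that by (auto simp: \<Omega>_def embeddings_def)
  have t: "t m permutes ?X" if "m \<in> \<Omega>" for m
    unfolding t_def using assms(2) mem[OF that] by (rule G.face_trace_permutes)
  have sum_\<omega>: "(\<Sum>m\<in>\<Omega>. h (\<omega> m)) = (\<Sum>m\<in>\<Omega>. \<Sum>a\<in>?S. product_density ?X (t m) a * h a)"
    for h :: "('d \<Rightarrow> 'd) \<Rightarrow> real"
    using G.sum_local_perm[OF assms(2) ne, of h]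
    by (simp add: \<Omega>_def \<omega>_def t_def case_prod_beta)
  have law: "pmf (local_dist G D v) a = (\<Sum>m\<in>\<Omega>. product_density ?X (t m) a) / N" if a: "a \<in> ?S" for a
  proof -
    have "pmf (local_dist G D v) a = real (card (\<Omega> \<inter> \<omega> -` {a})) / N"
      using \<Omega> by (simp add: local_dist_def random_embedding_def pmf_map measure_pmf_of_set \<Omega>_def \<omega>_def N_def)
    also have "real (card (\<Omega> \<inter> \<omega> -` {a})) = (\<Sum>m\<in>\<Omega>. of_bool (\<omega> m = a))"
      using \<Omega>(1) by (simp add: of_bool_def sum.If_cases vimage_def)
    also have "\<dots> = (\<Sum>m\<in>\<Omega>. \<Sum>b\<in>?S. product_density ?X (t m) b * of_bool (b = a))"
      by (rule sum_\<omega>)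
    also have "\<dots> = (\<Sum>m\<in>\<Omega>. product_density ?X (t m) a)"
      using a finX by (intro sum.cong refl) (simp add: of_bool_def if_distrib sum.delta finite_permutations cong: if_cong)
    finally show ?thesis .
  qed
  \<comment> \<open>Given \<open>m\<close>, the parity law is determined by the sign of
    \<open>\<omega> m\<close>, so the mixture depends only on the mean sign, which is
    \<open>1 - 2 * p\<close>.\<close>
  have target: "parity_uniform ?X p a = (\<Sum>m\<in>\<Omega>. parity_density ?X (t m) a) / N" if a: "a \<in> ?S" for a
  proof -
    define k where "k = real (card {m \<in> \<Omega>. \<not> evenperm (\<omega> m)})"
    have p: "p = k / N"
      using assms(7) \<Omega>
      by (simp add: random_embedding_def measure_pmf_of_set \<Omega>_def[symmetric] \<omega>_def k_def N_def Int_def)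
    have sgn: "sign (\<omega> m) = (-1) ^ (card ?X - 1) * sign (t m)" if "m \<in> \<Omega>" for m
      using G.sign_local_perm[OF assms(2) ne mem[OF that]] by (simp add: \<omega>_def t_def)
    have sgn': "(-1) ^ (card ?X - 1) * real_of_int (sign (t m)) = of_int (sign (\<omega> m))" if "m \<in> \<Omega>" for m
      unfolding sgn[OF that] by simp
    have "(\<Sum>m\<in>\<Omega>. parity_density ?X (t m) a) = (\<Sum>m\<in>\<Omega>. 1 + of_int (sign (\<omega> m)) * of_int (sign a)) / ?F"
      unfolding sum_divide_distrib parity_density_def using sgn' by (intro sum.cong) simp_all
    also have "(\<Sum>m\<in>\<Omega>. 1 + of_int (sign (\<omega> m)) * of_int (sign a)) =
        N + (\<Sum>m\<in>\<Omega>. of_int (sign (\<omega> m))) * of_int (sign a)"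
      by (simp add: sum.distrib sum_distrib_right N_def)
    also have "(\<Sum>m\<in>\<Omega>. of_int (sign (\<omega> m))) = N - 2 * k"
    proof -
      have "(\<Sum>m\<in>\<Omega>. of_int (sign (\<omega> m))) = (\<Sum>m\<in>\<Omega>. 1 - 2 * of_bool (\<not> evenperm (\<omega> m)) :: real)"
        by (intro sum.cong) (simp_all add: sign_def)
      also have "\<dots> = N - 2 * (\<Sum>m\<in>\<Omega>. of_bool (\<not> evenperm (\<omega> m)))"
        by (simp add: sum_subtractf sum_distrib_left N_def)
      also have "(\<Sum>m\<in>\<Omega>. of_bool (\<not> evenperm (\<omega> m))) = k"
        using \<Omega>(1) by (simp add: of_bool_def sum.If_cases k_def Int_def)
      finally show ?thesis .
    qed
    finally have "(\<Sum>m\<in>\<Omega>. parity_density ?X (t m) a) = (N + (N - 2 * k) * of_int (sign a)) / ?F" .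
    then have eq: "(\<Sum>m\<in>\<Omega>. parity_density ?X (t m) a) / N = (N + (N - 2 * k) * of_int (sign a)) / ?F / N"
      by simp
    show ?thesis unfolding eq using a N
      by (cases "evenperm a") (simp_all add: parity_uniform_def p sign_def field_simps)
  qed
  have avg: "(\<Sum>m\<in>\<Omega>. c m) / N \<le>
      measure_pmf.expectation (random_embedding ?H D') (\<lambda>m. real (num_faces ?H D' m))"
  proof -
    let ?f = "\<lambda>R E. real (num_faces ?H D' (R, E))"
    let ?r = "real (card (rotations G D))" and ?r' = "real (card (rotations ?H D'))"
    let ?e = "real (card (edge_schemes G D))" and ?e' = "real (card (edge_schemes ?H D'))"
    \<comment> \<open>The comparison holds for each pair of edge schemes, one for either graph.
      Summing over all pairs supplies the factors \<open>?e\<close> and \<open>?e'\<close> that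
      complete both averages.\<close>
    have le: "?r' * (\<Sum>R\<in>rotations G D. c (R, E)) \<le> ?r * (\<Sum>R\<in>rotations ?H D'. ?f R E')"
      if "E \<in> edge_schemes G D" "E' \<in> edge_schemes ?H D'" for E E'
    proof -
      interpret vertex_deletion G D v D' E E'
        by (intro vertex_deletion.intro vertex_deletion_axioms.intro G.dart_graph_axioms H.dart_graph_axioms
          assms(2) that)
      show ?thesis using sum_trace_orbits_le by (simp add: c_def t_def)
    qed
    have "(\<Sum>E'\<in>edge_schemes ?H D'. \<Sum>E\<in>edge_schemes G D. ?r' * (\<Sum>R\<in>rotations G D. c (R, E))) \<le>
        (\<Sum>E'\<in>edge_schemes ?H D'. \<Sum>E\<in>edge_schemes G D. ?r * (\<Sum>R\<in>rotations ?H D'. ?f R E'))"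
      using le by (intro sum_mono)
    moreover have "(\<Sum>m\<in>\<Omega>. c m) = (\<Sum>E\<in>edge_schemes G D. \<Sum>R\<in>rotations G D. c (R, E))"
      unfolding \<Omega>_def embeddings_def by (subst sum.swap) (simp add: sum.cartesian_product)
    moreover have "(\<Sum>m\<in>\<Omega>'. real (num_faces ?H D' m)) = (\<Sum>E\<in>edge_schemes ?H D'. \<Sum>R\<in>rotations ?H D'. ?f R E)"
      unfolding \<Omega>'_def embeddings_def by (subst sum.swap) (simp add: sum.cartesian_product)
    ultimately have "?e' * (?r' * (\<Sum>m\<in>\<Omega>. c m)) \<le> ?e * (?r * (\<Sum>m\<in>\<Omega>'. real (num_faces ?H D' m)))"
      by (simp add: sum_distrib_left[symmetric] mult.left_commute)
    then have "real (card \<Omega>') * (\<Sum>m\<in>\<Omega>. c m) \<le> N * (\<Sum>m\<in>\<Omega>'. real (num_faces ?H D' m))"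
      by (simp add: N_def \<Omega>_def \<Omega>'_def embeddings_def card_cartesian_product mult_ac)
    then have "(\<Sum>m\<in>\<Omega>. c m) / N \<le> (\<Sum>m\<in>\<Omega>'. real (num_faces ?H D' m)) / real (card \<Omega>')"
      using N N' by (simp add: field_simps)
    also have "\<dots> = measure_pmf.expectation (random_embedding ?H D') (\<lambda>m. real (num_faces ?H D' m))"
      using \<Omega>' by (simp add: random_embedding_def \<Omega>'_def[symmetric] integral_pmf_of_set)
    finally show ?thesis .
  qed
  define T where "T m = (\<Sum>a\<in>?S. \<bar>product_density ?X (t m) a - parity_density ?X (t m) a\<bar>)" for m
  have sq: "sqrt (real d - 1) > 0" using assms(4) by simp
  have T2: "(T m)\<^sup>2 \<le> 8 * c m / sqrt (real d - 1)" if "m \<in> \<Omega>" for m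
    using product_density_parity_bound[OF finX _ t[OF that]] assms(4) cardX by (simp add: T_def c_def)
  have "tv_dist ?S (pmf (local_dist G D v)) (parity_uniform ?X p) \<le> (1 / 2) * ((\<Sum>m\<in>\<Omega>. T m) / N)"
  proof -
    have "(\<Sum>a\<in>?S. \<bar>pmf (local_dist G D v) a - parity_uniform ?X p a\<bar>) =
        (\<Sum>a\<in>?S. \<bar>\<Sum>m\<in>\<Omega>. product_density ?X (t m) a - parity_density ?X (t m) a\<bar> / N)"
      using N by (intro sum.cong refl) (simp add: law target sum_subtractf diff_divide_distrib[symmetric])
    also have "\<dots> \<le> (\<Sum>a\<in>?S. (\<Sum>m\<in>\<Omega>. \<bar>product_density ?X (t m) a - parity_density ?X (t m) a\<bar>) / N)"
      using N by (intro sum_mono divide_right_mono sum_abs) simp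
    also have "\<dots> = (\<Sum>m\<in>\<Omega>. T m) / N"
      unfolding T_def sum_divide_distrib[symmetric] by (subst sum.swap) (rule refl)
    finally show ?thesis by (simp add: tv_dist_def)
  qed
  moreover have "0 \<le> tv_dist ?S (pmf (local_dist G D v)) (parity_uniform ?X p)"
    by (simp add: tv_dist_def sum_nonneg)
  ultimately have "(tv_dist ?S (pmf (local_dist G D v)) (parity_uniform ?X p))\<^sup>2 \<le>
      ((1 / 2) * ((\<Sum>m\<in>\<Omega>. T m) / N))\<^sup>2"
    by (intro power_mono)
  also have "\<dots> = (\<Sum>m\<in>\<Omega>. T m)\<^sup>2 / (4 * N\<^sup>2)" by (simp add: power_mult_distrib power_divide)
  \<comment> \<open>Cauchy-Schwarz moves the square inside the mean over embeddings. The 4 stems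
    from the factor one half in \<open>tv_dist\<close> and turns the 8 of \<open>T2\<close> into the
    final 2.\<close>
  also have "\<dots> \<le> (\<Sum>m\<in>\<Omega>. (T m)\<^sup>2) * N / (4 * N\<^sup>2)"
    unfolding N_def by (intro divide_right_mono sum_squared_le_sum_of_squares) simp
  also have "\<dots> = (\<Sum>m\<in>\<Omega>. (T m)\<^sup>2) / (4 * N)" using N by (simp add: power2_eq_square)
  also have "\<dots> \<le> (\<Sum>m\<in>\<Omega>. 8 * c m / sqrt (real d - 1)) / (4 * N)"
    using N T2 by (intro divide_right_mono sum_mono) simp_all
  also have "\<dots> = 2 * ((\<Sum>m\<in>\<Omega>. c m) / N) / sqrt (real d - 1)"
    using N sq by (simp add: sum_divide_distrib[symmetric] sum_distrib_left[symmetric])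
  also have "\<dots> \<le> 2 * measure_pmf.expectation (random_embedding ?H D') (\<lambda>m. real (num_faces ?H D' m)) / sqrt (real d - 1)"
    using avg sq by (intro divide_right_mono mult_left_mono) simp_all
  finally show ?thesis .
qed

end
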